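(* For every integer $\alpha\ge 1$ let $\psi(\alpha):=\left\lfloor \frac{5^{\alpha+1}}{12}\right\rfloor+1$. Then for all $\alpha\ge 1$, \[ \frac{(1+5y)^{\psi(\alpha)}}{5^{\alpha}\cdot F}\cdot L_{\alpha}\in\mathbb{Z}[y], \] i.e. there is a polynomial $P_\alpha\in\mathbb{Z}[X]$ with $(1+5y(\tau))^{\psi(\alpha)}L_\alpha(\tau)=5^\alpha F(\tau)P_\alpha(y(\tau))$.
   Context: Let $q=e^{2\pi i\tau}$ with $\tau$ in the upper half-plane, and $(q^k;q^k)_\infty=\prod_{m\ge1}(1-q^{km})$. Let $E_2(\tau)=1-24\sum_{n\ge1}\frac{nq^n}{1-q^n}$. Define integers $c(n)$ by $\sum_{n\ge0}c(n)q^n=\frac{2E_2(2\tau)-E_2(\tau)}{(q^2;q^2)_\infty}$. For $\alpha\ge1$ let $\lambda_{2\alpha-1}=\frac{1+7\cdot5^{2\alpha-1}}{12}$ and $\lambda_{2\alpha}=\frac{1+11\cdot 5^{2\alpha}}{12}$ (these are the minimal positive integer solutions of $12x\equiv1\pmod{5^{\alpha}}$), and define $L_{2\alpha-1}=(q^{10};q^{10})_\infty\sum_{n\ge0}c(5^{2\alpha-1}n+\lambda_{2\alpha-1})q^{n+1}$ and $L_{2\alpha}=(q^{2};q^{2})_\infty\sum_{n\ge0}c(5^{2\alpha}n+\lambda_{2\alpha})q^{n+1}$. Let $F(\tau)=\frac1{24}\left(50E_2(10\tau)-25E_2(5\tau)-2E_2(2\tau)+E_2(\tau)\right)$, and $y(\tau)=q\prod_{m\ge1}\frac{(1-q^{2m})(1-q^{10m})^3}{(1-q^m)^3(1-q^{5m})}$.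 *)

theory Defs
  imports "HOL-Complex_Analysis.Complex_Analysis"
begin

definition qexp :: "complex \<Rightarrow> complex" where
  "qexp \<tau> = exp (2 * of_real pi * \<i> * \<tau>)"

(* Series and products over m \<ge> 1 are indexed by m :: nat through Suc m throughout. *)

definition qpoch :: "nat \<Rightarrow> complex \<Rightarrow> complex" where
  "qpoch k \<tau> = (\<Prod>m. 1 - qexp \<tau> ^ (k * Suc m))"

definition E2 :: "complex \<Rightarrow> complex" where
  "E2 \<tau> = 1 - 24 * (\<Sum>n. of_nat (Suc n) * qexp \<tau> ^ Suc n / (1 - qexp \<tau> ^ Suc n))"

(* Existence and uniqueness of such a sequence are proved in c_seq_ex1 below. *)

definition c_seq :: "nat \<Rightarrow> int" where
  "c_seq = (THE c. \<forall>\<tau>. Im \<tau> > 0 \<longrightarrow>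
     (\<lambda>n. of_int (c n) * qexp \<tau> ^ n) sums ((2 * E2 (2 * \<tau>) - E2 \<tau>) / qpoch 2 \<tau>))"

(* The division by 12 is exact, see twelve_mult_lam below. *)

definition lam :: "nat \<Rightarrow> nat" where
  "lam a = (if odd a then (1 + 7 * 5 ^ a) div 12 else (1 + 11 * 5 ^ a) div 12)"

definition L_fun :: "nat \<Rightarrow> complex \<Rightarrow> complex" where
  "L_fun a \<tau> = (if odd a then qpoch 10 \<tau> else qpoch 2 \<tau>) *
     (\<Sum>n. of_int (c_seq (5 ^ a * n + lam a)) * qexp \<tau> ^ (n + 1))"

definition F_fun :: "complex \<Rightarrow> complex" where
  "F_fun \<tau> = 1 / 24 * (50 * E2 (10 * \<tau>) - 25 * E2 (5 * \<tau>) - 2 * E2 (2 * \<tau>) + E2 \<tau>)"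

definition y_fun :: "complex \<Rightarrow> complex" where
  "y_fun \<tau> = qexp \<tau> * (\<Prod>m. (1 - qexp \<tau> ^ (2 * Suc m)) * (1 - qexp \<tau> ^ (10 * Suc m)) ^ 3 /
                        ((1 - qexp \<tau> ^ Suc m) ^ 3 * (1 - qexp \<tau> ^ (5 * Suc m))))"

definition psi :: "nat \<Rightarrow> nat" where
  "psi a = 5 ^ (a + 1) div 12 + 1"

lemma twelve_mult_lam: "12 * lam a = (if odd a then 1 + 7 * 5 ^ a else 1 + 11 * 5 ^ a)"
proof -
  have ex: "\<exists>j. (5::nat) ^ (2 * k) = 12 * j + 1" for k
  proof (induction k)
    case (Suc k)
    then obtain j where "(5::nat) ^ (2 * k) = 12 * j + 1" by blast
    then have "(5::nat) ^ (2 * Suc k) = 12 * (25 * j + 2) + 1" by simp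
    then show ?case by blast
  qed simp
  show ?thesis
  proof (cases "odd a")
    case True
    then obtain k where k: "a = Suc (2 * k)" by (auto elim: oddE)
    obtain j where "(5::nat) ^ (2 * k) = 12 * j + 1" using ex by blast
    then have "1 + 7 * 5 ^ a = 12 * (35 * j + 3 :: nat)" using k by simp
    then show ?thesis using True by (simp only: lam_def if_True) simp
  next
    case False
    then obtain k where k: "a = 2 * k" by (auto elim: evenE)
    obtain j where "(5::nat) ^ (2 * k) = 12 * j + 1" using ex by blast
    then have "1 + 11 * 5 ^ a = 12 * (11 * j + 1 :: nat)" using k by simp
    then show ?thesis using False by (simp only: lam_def if_False) simp
  qed
qed

lemma norm_qexp_less_1: "Im \<tau> > 0 \<Longrightarrow> norm (qexp \<tau>) < 1"
  by (simp add: qexp_def)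

lemma qexp_nonzero [simp]: "qexp \<tau> \<noteq> 0"
  by (simp add: qexp_def)

lemma qexp_double: "qexp (2 * \<tau>) = qexp \<tau> ^ 2"
  by (simp add: qexp_def exp_double[symmetric] algebra_simps)

lemma qexp_surj:
  assumes "z \<noteq> 0" "norm z < 1"
  obtains \<tau> where "Im \<tau> > 0" "qexp \<tau> = z"
proof
  let ?t = "Ln z / (2 * of_real pi * \<i>)"
  show "qexp ?t = z" using assms by (simp add: qexp_def)
  have "Im ?t = - ln (norm z) / (2 * pi)"
    using assms by (simp add: Im_divide power2_eq_square field_simps)
  moreover have "ln (norm z) < 0" using assms by simp
  ultimately show "Im ?t > 0" by (simp add: divide_neg_pos)
qed

lemma power_neq_1_of_norm_less_1:
  fixes z :: complex
  assumes "norm z < 1" "n > 0"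
  shows "1 - z ^ n \<noteq> 0"
proof
  assume "1 - z ^ n = 0"
  then have "norm z ^ n = 1" by (metis eq_iff_diff_eq_0 norm_one norm_power)
  moreover have "norm z ^ n < 1" using assms by (simp add: power_less_one_iff)
  ultimately show False by simp
qed

definition int_coeffs :: "(complex \<Rightarrow> complex) \<Rightarrow> bool" where
  "int_coeffs f \<longleftrightarrow> f holomorphic_on ball 0 1 \<and> (\<forall>n. fps_nth (fps_expansion f 0) n \<in> \<int>)"

lemma holomorphic_has_fps_expansion:
  assumes "f holomorphic_on ball 0 1"
  shows "f has_fps_expansion fps_expansion f 0"
proof -
  have "f analytic_on {0}"
    using assms by (meson analytic_at centre_in_ball open_ball zero_less_one)
  then show ?thesis
    by (metis analytic_at_imp_has_fps_expansion_0 )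
qed

lemma int_coeffsI:
  assumes "f holomorphic_on ball 0 1" "f has_fps_expansion G" "\<And>n. fps_nth G n \<in> \<int>"
  shows "int_coeffs f"
  using assms fps_expansion_eqI[OF assms(2)] by (simp add: int_coeffs_def)

lemma int_coeffs_const: "a \<in> \<int> \<Longrightarrow> int_coeffs (\<lambda>_. a)"
  by (rule int_coeffsI[where G = "fps_const a"]) (auto intro: fps_expansion_intros)

lemma int_coeffs_power: "int_coeffs (\<lambda>z. z ^ k)"
  by (rule int_coeffsI[where G = "fps_X ^ k"])
     (auto intro!: fps_expansion_intros holomorphic_intros simp: fps_X_power_nth)

lemma int_coeffs_mult:
  assumes "int_coeffs f" "int_coeffs g" shows "int_coeffs (\<lambda>z. f z * g z)"
proof (rule int_coeffsI)
  show "(\<lambda>z. f z * g z) has_fps_expansion fps_expansion f 0 * fps_expansion g 0"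
    using assms by (intro fps_expansion_intros holomorphic_has_fps_expansion) (auto simp: int_coeffs_def)
  show "fps_nth (fps_expansion f 0 * fps_expansion g 0) n \<in> \<int>" for n
    using assms unfolding fps_mult_nth int_coeffs_def by (intro Ints_sum Ints_mult) auto
qed (use assms in \<open>auto simp: int_coeffs_def intro!: holomorphic_intros\<close>)

lemma int_coeffs_add:
  assumes "int_coeffs f" "int_coeffs g" shows "int_coeffs (\<lambda>z. f z + g z)"
proof (rule int_coeffsI)
  show "(\<lambda>z. f z + g z) has_fps_expansion fps_expansion f 0 + fps_expansion g 0"
    using assms by (intro fps_expansion_intros holomorphic_has_fps_expansion) (auto simp: int_coeffs_def)
qed (use assms in \<open>auto simp: int_coeffs_def intro!: holomorphic_intros\<close>)

lemma int_coeffs_diff: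
  assumes "int_coeffs f" "int_coeffs g" shows "int_coeffs (\<lambda>z. f z - g z)"
  using int_coeffs_add[OF assms(1) int_coeffs_mult[OF int_coeffs_const[of "-1"] assms(2)]] by simp

lemma int_coeffs_sum:
  assumes "\<And>i. i \<in> A \<Longrightarrow> int_coeffs (f i)" shows "int_coeffs (\<lambda>z. \<Sum>i\<in>A. f i z)"
  using assms by (induction A rule: infinite_finite_induct)
                 (auto intro: int_coeffs_add int_coeffs_const)

lemma int_coeffs_prod:
  assumes "\<And>i. i \<in> A \<Longrightarrow> int_coeffs (f i)" shows "int_coeffs (\<lambda>z. \<Prod>i\<in>A. f i z)"
  using assms by (induction A rule: infinite_finite_induct)
                 (auto intro: int_coeffs_mult int_coeffs_const)

lemma int_coeffs_inverse:
  assumes f: "int_coeffs f" and f0: "f 0 = 1" and nz: "\<And>z. norm z < 1 \<Longrightarrow> f z \<noteq> 0"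
  shows "int_coeffs (\<lambda>z. inverse (f z))"
proof (rule int_coeffsI)
  let ?G = "fps_expansion f 0"
  have fG: "f has_fps_expansion ?G"
    using f by (intro holomorphic_has_fps_expansion) (auto simp: int_coeffs_def)
  have G0: "fps_nth ?G 0 = 1" using f0 by (simp add: fps_expansion_def)
  show "(\<lambda>z. inverse (f z)) has_fps_expansion inverse ?G"
    using fG G0 by (intro fps_expansion_intros) auto
  show "fps_nth (inverse ?G) n \<in> \<int>" for n
  proof (induction n rule: less_induct)
    case (less n)
    have GI: "?G * inverse ?G = 1" using G0 by (simp add: inverse_mult_eq_1')
    show ?case
    proof (cases "n = 0")
      case True
      then show ?thesis using G0 by simp
    next
      case False
      have "0 = fps_nth (?G * inverse ?G) n" unfolding GI using False by simp
      also have "\<dots> = fps_nth (inverse ?G) n +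
                      (\<Sum>i=Suc 0..n. fps_nth ?G i * fps_nth (inverse ?G) (n - i))"
        unfolding fps_mult_nth by (subst sum.atLeast_Suc_atMost) (auto simp: G0)
      finally have eq: "fps_nth (inverse ?G) n =
          - (\<Sum>i=Suc 0..n. fps_nth ?G i * fps_nth (inverse ?G) (n - i))"
        by (simp add: eq_neg_iff_add_eq_0)
      show ?thesis unfolding eq using f less
        by (intro Ints_minus Ints_sum Ints_mult) (auto simp: int_coeffs_def)
    qed
  qed
qed (use f nz in \<open>auto simp: int_coeffs_def intro!: holomorphic_intros\<close>)

lemma int_coeffs_limit:
  assumes f: "\<And>n. int_coeffs (f n)"
    and lim: "\<And>r. 0 < r \<Longrightarrow> r < 1 \<Longrightarrow> uniform_limit (cball 0 r) f g sequentially"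
  shows "int_coeffs g"
  unfolding int_coeffs_def
proof (intro conjI allI)
  show "g holomorphic_on ball 0 1"
  proof (rule holomorphic_uniform_sequence[where f = f])
    fix x :: complex assume x: "x \<in> ball 0 1"
    define d where "d = (1 - norm x) / 2"
    have d: "d > 0" "norm x + d < 1" using x by (auto simp: d_def field_simps)
    have sub: "cball x d \<subseteq> cball 0 (norm x + d)"
      by (simp add: cball_subset_cball_iff)
    have "uniform_limit (cball x d) f g sequentially"
      by (rule uniform_limit_on_subset[OF lim sub]) (use d in \<open>auto intro: add_nonneg_pos\<close>)
    moreover have "cball x d \<subseteq> ball 0 1" using sub d by (force simp: subset_iff)
    ultimately show "\<exists>d>0. cball x d \<subseteq> ball 0 1 \<and> uniform_limit (cball x d) f g sequentially"
      using d by blast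
  qed (use f in \<open>auto simp: int_coeffs_def\<close>)
next
  fix n
  have sub: "ball 0 (1/2) \<subseteq> cball (0::complex) (1/2)" "ball 0 (1/2) \<subseteq> ball (0::complex) 1"
    by (auto simp: subset_iff)
  have ul: "uniform_limit (ball 0 (1/2)) f g sequentially"
    by (rule uniform_limit_on_subset[OF lim sub(1)]) auto
  have "(\<lambda>k. (deriv ^^ n) (f k) 0) \<longlonglongrightarrow> (deriv ^^ n) g 0"
    by (rule higher_deriv_complex_uniform_limit[OF ul])
       (use f sub in \<open>auto simp: int_coeffs_def intro!: always_eventually
                        intro: holomorphic_on_subset\<close>)
  then have "(\<lambda>k. fps_nth (fps_expansion (f k) 0) n) \<longlonglongrightarrow> fps_nth (fps_expansion g 0) n"
    by (auto simp: fps_expansion_def intro!: tendsto_intros)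
  then show "fps_nth (fps_expansion g 0) n \<in> \<int>"
    by (rule Lim_in_closed_set[OF closed_Ints, rotated 2])
       (use f in \<open>auto simp: int_coeffs_def\<close>)
qed

lemma int_coeffs_inverse_1_minus_power:
  assumes "n > 0" shows "int_coeffs (\<lambda>z. inverse (1 - z ^ n))"
  using assms
  by (intro int_coeffs_inverse int_coeffs_diff int_coeffs_const int_coeffs_power
        power_neq_1_of_norm_less_1) auto

lemma int_coeffs_lambert:
  "int_coeffs (\<lambda>z. \<Sum>n. of_nat (Suc n) * z ^ Suc n / (1 - z ^ Suc n))"
proof (rule int_coeffs_limit)
  show "int_coeffs (\<lambda>z. \<Sum>n<N. of_nat (Suc n) * z ^ Suc n / (1 - z ^ Suc n))" for N
    unfolding divide_inverse
    by (intro int_coeffs_sum int_coeffs_mult int_coeffs_const int_coeffs_power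
          int_coeffs_inverse_1_minus_power) auto
  fix r :: real assume r: "0 < r" "r < 1"
  show "uniform_limit (cball 0 r)
          (\<lambda>N z. \<Sum>n<N. of_nat (Suc n) * z ^ Suc n / (1 - z ^ Suc n))
          (\<lambda>z. \<Sum>n. of_nat (Suc n) * z ^ Suc n / (1 - z ^ Suc n :: complex)) sequentially"
  proof (rule Weierstrass_m_test)
    have "summable (\<lambda>n. of_nat (Suc n) * r ^ n)"
      using termdiff_converges[of r 1 "\<lambda>_. 1"] r by (simp add: diffs_def)
    then have "summable (\<lambda>n. r / (1 - r) * (of_nat (Suc n) * r ^ n))"
      by (rule summable_mult)
    then show "summable (\<lambda>n. of_nat (Suc n) * r ^ Suc n / (1 - r))"
      by (simp add: mult_ac)
    fix n and z :: complex assume z: "z \<in> cball 0 r"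
    have zr: "norm z ^ Suc n \<le> r ^ Suc n" using z by (intro power_mono) auto
    have "r ^ Suc n \<le> r" using r power_decreasing[of 1 "Suc n" r] by simp
    then have "1 - r \<le> norm (1 - z ^ Suc n)"
      using zr norm_triangle_ineq2[of 1 "z ^ Suc n"] by (simp add: norm_power del: power_Suc)
    then show "norm (of_nat (Suc n) * z ^ Suc n / (1 - z ^ Suc n)) \<le> of_nat (Suc n) * r ^ Suc n / (1 - r)"
      unfolding norm_divide norm_mult norm_power norm_of_nat
      using zr r by (intro frac_le mult_left_mono mult_nonneg_nonneg) auto
  qed
qed

lemma summable_norm_power_mult_Suc:
  fixes z :: complex
  assumes "norm z < 1" "k > 0"
  shows "summable (\<lambda>m. norm (z ^ (k * Suc m)))"
proof -
  have "norm (z ^ k) < 1" using assms by (simp add: norm_power power_less_one_iff)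
  then have "summable (\<lambda>m. norm (z ^ k) ^ Suc m)"
    by (subst summable_Suc_iff) (rule summable_geometric, simp)
  then show ?thesis by (simp only: norm_power power_mult)
qed

lemma has_prod_1_minus_power:
  fixes z :: complex
  assumes "norm z < 1" "k > 0"
  shows "convergent_prod (\<lambda>m. 1 - z ^ (k * Suc m))"
    and "(\<lambda>N. \<Prod>m<N. 1 - z ^ (k * Suc m)) \<longlonglongrightarrow> (\<Prod>m. 1 - z ^ (k * Suc m))"
    and "(\<Prod>m. 1 - z ^ (k * Suc m)) \<noteq> 0"
proof -
  have nz: "1 - z ^ (k * Suc m) \<noteq> 0" for m
    using assms by (intro power_neq_1_of_norm_less_1) auto
  show cp: "convergent_prod (\<lambda>m. 1 - z ^ (k * Suc m))"
    using summable_norm_power_mult_Suc[OF assms]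
    by (intro abs_convergent_prod_imp_convergent_prod summable_imp_abs_convergent_prod) simp
  show "(\<lambda>N. \<Prod>m<N. 1 - z ^ (k * Suc m)) \<longlonglongrightarrow> (\<Prod>m. 1 - z ^ (k * Suc m))"
    using convergent_prod_LIMSEQ[OF cp] by (subst LIMSEQ_lessThan_iff_atMost)
  show "(\<Prod>m. 1 - z ^ (k * Suc m)) \<noteq> 0"
    using prodinf_nonzero[OF cp nz] .
qed

lemma int_coeffs_qpoch:
  assumes k: "k > 0"
  shows "int_coeffs (\<lambda>z. \<Prod>m. 1 - z ^ (k * Suc m))"
proof (rule int_coeffs_limit)
  show "int_coeffs (\<lambda>z. \<Prod>m<N. 1 - z ^ (k * Suc m))" for N
    by (intro int_coeffs_prod int_coeffs_diff int_coeffs_const int_coeffs_power) auto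
  fix r :: real assume r: "0 < r" "r < 1"
  have "uniformly_convergent_on (cball 0 r) (\<lambda>N z. \<Prod>m<N. 1 - (z::complex) ^ (k * Suc m))"
  proof (rule uniformly_convergent_on_prod')
    show "uniformly_convergent_on (cball 0 r)
            (\<lambda>N z. \<Sum>m<N. norm (1 - (z::complex) ^ (k * Suc m) - 1))"
    proof (rule Weierstrass_m_test_ev[THEN uniformly_convergentI])
      show "summable (\<lambda>m. r ^ (k * Suc m))"
        using summable_norm_power_mult_Suc[of "of_real r" k] r k by (simp add: norm_power)
      show "\<forall>\<^sub>F m in sequentially. \<forall>z\<in>cball 0 r.
              norm (norm (1 - (z::complex) ^ (k * Suc m) - 1)) \<le> r ^ (k * Suc m)"
        by (intro always_eventually allI ballI) (auto simp: norm_power intro!: power_mono)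
    qed
  qed (auto intro!: continuous_intros)
  then obtain l where l: "uniform_limit (cball 0 r)
      (\<lambda>N z. \<Prod>m<N. 1 - (z::complex) ^ (k * Suc m)) l sequentially"
    by (auto simp: uniformly_convergent_on_def)
  have "l z = (\<Prod>m. 1 - z ^ (k * Suc m))" if "z \<in> cball 0 r" for z
    using tendsto_uniform_limitI[OF l that] has_prod_1_minus_power(2)[of z k] that r k
    by (intro LIMSEQ_unique) auto
  then show "uniform_limit (cball 0 r) (\<lambda>N z. \<Prod>m<N. 1 - z ^ (k * Suc m))
      (\<lambda>z. \<Prod>m. 1 - (z::complex) ^ (k * Suc m)) sequentially"
    by (intro uniform_limit_cong'[THEN iffD1, OF _ _ l] refl)
qed

lemma int_coeffs_compose_square:
  assumes "int_coeffs f" shows "int_coeffs (\<lambda>z. f (z ^ 2))"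
proof (rule int_coeffsI)
  have "(f \<circ> (\<lambda>z. z ^ 2)) has_fps_expansion (fps_expansion f 0 oo fps_X ^ 2)"
    using assms
    by (intro fps_expansion_intros holomorphic_has_fps_expansion)
       (auto simp: int_coeffs_def intro!: fps_expansion_intros)
  then show "(\<lambda>z. f (z ^ 2)) has_fps_expansion (fps_expansion f 0 oo fps_X ^ 2)"
    by (simp add: o_def)
  show "fps_nth (fps_expansion f 0 oo fps_X ^ 2) n \<in> \<int>" for n
    using assms unfolding fps_compose_nth power_mult[symmetric] fps_X_power_nth int_coeffs_def
    by (intro Ints_sum Ints_mult) auto
  have "(f \<circ> (\<lambda>z. z ^ 2)) holomorphic_on ball 0 1"
  proof (rule holomorphic_on_compose_gen)
    show "f holomorphic_on ball 0 1" using assms by (simp add: int_coeffs_def)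
    show "(\<lambda>z. z ^ 2) ` ball (0::complex) 1 \<subseteq> ball (0::complex) 1"
    proof
      fix w :: complex assume "w \<in> (\<lambda>z. z ^ 2) ` ball 0 1"
      then obtain z where "w = z ^ 2" "norm z < 1" by auto
      then show "w \<in> ball 0 1" using power_less_one_iff[of "norm z" 2] by (simp add: norm_power)
    qed
  qed (auto intro!: holomorphic_intros)
  then show "(\<lambda>z. f (z ^ 2)) holomorphic_on ball 0 1" by (simp add: o_def)
qed

lemma c_seq_ex1:
  "\<exists>!c :: nat \<Rightarrow> int. \<forall>\<tau>. Im \<tau> > 0 \<longrightarrow>
     (\<lambda>n. of_int (c n) * qexp \<tau> ^ n) sums ((2 * E2 (2 * \<tau>) - E2 \<tau>) / qpoch 2 \<tau>)"
proof -
  define e where "e = (\<lambda>z::complex. 1 - 24 * (\<Sum>n. of_nat (Suc n) * z ^ Suc n / (1 - z ^ Suc n)))"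
  define p where "p = (\<lambda>z::complex. \<Prod>m. 1 - z ^ (2 * Suc m))"
  define g where "g = (\<lambda>z. (2 * e (z ^ 2) - e z) * inverse (p z))"
  have e: "int_coeffs e" unfolding e_def
    by (intro int_coeffs_diff int_coeffs_mult int_coeffs_const int_coeffs_lambert) auto
  have p: "int_coeffs p" unfolding p_def by (rule int_coeffs_qpoch) simp
  have "int_coeffs (\<lambda>z. inverse (p z))"
    by (rule int_coeffs_inverse[OF p])
       (use has_prod_1_minus_power(3)[of _ 2] in \<open>auto simp: p_def\<close>)
  then have g: "int_coeffs g" unfolding g_def
    by (intro int_coeffs_mult int_coeffs_diff int_coeffs_const e int_coeffs_compose_square) auto
  have g_eq: "g (qexp \<tau>) = (2 * E2 (2 * \<tau>) - E2 \<tau>) / qpoch 2 \<tau>" for \<tau>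
    by (simp only: g_def e_def p_def E2_def qpoch_def qexp_double divide_inverse)
  show ?thesis
  proof (rule ex_ex1I)
    have "\<exists>c :: nat \<Rightarrow> int. \<forall>n. fps_nth (fps_expansion g 0) n = of_int (c n)"
      using g unfolding int_coeffs_def by (intro choice) (auto elim!: Ints_cases)
    then obtain c :: "nat \<Rightarrow> int" where c: "\<And>n. fps_nth (fps_expansion g 0) n = of_int (c n)"
      by blast
    have "(\<lambda>n. of_int (c n) * qexp \<tau> ^ n) sums g (qexp \<tau>)" if "Im \<tau> > 0" for \<tau>
      unfolding c[symmetric]
      by (rule has_fps_expansion_imp_sums_complex[where r = 1])
         (use g norm_qexp_less_1[OF that] in
            \<open>auto simp: int_coeffs_def one_ereal_def intro!: holomorphic_has_fps_expansion\<close>)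
    then show "\<exists>c :: nat \<Rightarrow> int. \<forall>\<tau>. Im \<tau> > 0 \<longrightarrow>
     (\<lambda>n. of_int (c n) * qexp \<tau> ^ n) sums ((2 * E2 (2 * \<tau>) - E2 \<tau>) / qpoch 2 \<tau>)"
      unfolding g_eq by blast
  next
    fix c d :: "nat \<Rightarrow> int"
    assume c: "\<forall>\<tau>. Im \<tau> > 0 \<longrightarrow>
      (\<lambda>n. of_int (c n) * qexp \<tau> ^ n) sums ((2 * E2 (2 * \<tau>) - E2 \<tau>) / qpoch 2 \<tau>)"
    assume d: "\<forall>\<tau>. Im \<tau> > 0 \<longrightarrow>
      (\<lambda>n. of_int (d n) * qexp \<tau> ^ n) sums ((2 * E2 (2 * \<tau>) - E2 \<tau>) / qpoch 2 \<tau>)"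
    define a :: "nat \<Rightarrow> complex" where "a n = of_int (c n - d n)" for n
    have a: "(\<lambda>n. a n * z ^ n) sums 0" if z: "z \<noteq> 0" "norm z < 1" for z
    proof -
      obtain \<tau> where \<tau>: "Im \<tau> > 0" "qexp \<tau> = z" using qexp_surj z by metis
      show ?thesis
        using sums_diff[OF c[rule_format, OF \<tau>(1)] d[rule_format, OF \<tau>(1)]]
        by (simp add: a_def algebra_simps \<tau>(2))
    qed
    have "((\<lambda>_. 0) \<longlongrightarrow> a 0) (at (0::complex))"
      by (rule powser_limit_0_strong[where s = 1 and f = "\<lambda>_. 0"]) (use a in auto)
    then have a0: "a 0 = 0" by (simp add: tendsto_const_iff)
    have a': "(\<lambda>n. a n * (z - 0) ^ n) sums 0" if "norm (z - 0) < 1" for z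
      using a[of z] that powser_sums_zero[of a] a0 by (cases "z = 0") auto
    have "a m = 0" for m
    proof (rule ccontr)
      assume m: "a m \<noteq> 0"
      with a0 have "m > 0" by (cases m) auto
      then obtain s where s: "s > 0" "\<And>z::complex. z \<in> cball 0 s - {0} \<Longrightarrow> (0::complex) \<noteq> 0"
        using powser_0_nonzero[where \<xi> = "0::complex" and r = 1 and a = a and f = "\<lambda>_. 0" and m = m]
          a' m by (metis zero_less_one)
      have "of_real s \<in> cball 0 s - {0::complex}" using s(1) by auto
      then show False using s(2) by blast
    qed
    then show "c = d" by (intro ext) (simp add: a_def)
  qed
qed

lemma c_seq_sums:
  assumes "Im \<tau> > 0"
  shows "(\<lambda>n. of_int (c_seq n) * qexp \<tau> ^ n) sums ((2 * E2 (2 * \<tau>) - E2 \<tau>) / qpoch 2 \<tau>)"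
  using theI'[OF c_seq_ex1] assms unfolding c_seq_def by blast

lemma summable_L_fun:
  assumes "Im \<tau> > 0"
  shows "summable (\<lambda>n. of_int (c_seq (5 ^ a * n + lam a)) * qexp \<tau> ^ (n + 1))"
proof -
  define N :: nat where "N = 5 ^ a"
  have N: "N > 0" by (simp add: N_def)
  define t where "t = \<tau> / of_nat N"
  have t: "Im t > 0" using assms N by (simp add: t_def Im_divide_of_nat)
  have qt: "qexp \<tau> = qexp t ^ N"
    using N by (simp add: qexp_def t_def exp_of_nat_mult[symmetric])
  have Im: "Im (t / 2) > 0" using t by simp
  have "norm (qexp (t / 2)) < 1" by (rule norm_qexp_less_1[OF Im])
  moreover have "qexp t = qexp (t / 2) ^ 2" using qexp_double[of "t / 2"] by simp
  ultimately have less: "norm (qexp t) < norm (qexp (t / 2))"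
    using power_strict_decreasing[of 1 2 "norm (qexp (t / 2))"] by (simp add: norm_power)
  have "summable (\<lambda>n. norm (of_int (c_seq n) * qexp t ^ n))"
    by (rule powser_insidea[OF sums_summable[OF c_seq_sums[OF Im]] less])
  then have "summable ((\<lambda>n. norm (of_int (c_seq n) * qexp t ^ n)) \<circ> (\<lambda>n. N * n + lam a))"
  proof (rule summable_reindex)
    show "inj (\<lambda>n. N * n + lam a)" using N by (intro injI) simp
  qed simp
  then have "summable (\<lambda>n. of_int (c_seq (N * n + lam a)) * qexp t ^ (N * n + lam a))"
    unfolding o_def by (rule summable_norm_cancel)
  then have "summable (\<lambda>n. of_int (c_seq (N * n + lam a)) * qexp t ^ (N * n + lam a) *
                           (qexp \<tau> / qexp t ^ lam a))"
    by (rule summable_mult2)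
  then show ?thesis
    by (simp add: power_add qt N_def mult_ac flip: power_mult)
qed

end

theory Submission
  imports Defs
begin

text \<open>Write \<open>q = qexp \<tau>\<close>, \<open>D = q d/dq\<close>, let \<open>U\<close> be the operator keeping every fifth coefficient, and
  \<open>Z = q\<^sup>2 \<Prod> (1 - q\<^bsup>50m\<^esup>) / (1 - q\<^bsup>2m\<^esup>)\<close>. Then \<open>L\<^sub>1 = U (Z A)\<close> for \<open>A = 2 E\<^sub>2(2\<tau>) - E\<^sub>2(\<tau>)\<close>, and
  \<open>L\<close> at \<open>\<alpha> + 1\<close> is \<open>U (L\<^sub>\<alpha>)\<close> for odd and \<open>U (Z L\<^sub>\<alpha>)\<close> for even \<open>\<alpha>\<close>. Logarithmic differentiation of three
  eta quotients of level ten, which are linked by \<open>w = 1/y + 4\<close> and \<open>x = 1/y + 5\<close>, gives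
  \<open>D y = y (1 + 4y) F\<close> and \<open>A = R(y) D y\<close> with an explicit rational function \<open>R\<close>.

  The functions \<open>y(\<tau>)\<close> and \<open>Y = y(5\<tau>)\<close> satisfy a modular equation \<open>\<Phi>(y, Y) = 0\<close> of degree five in \<open>y\<close>,
  and on this curve \<open>D y\<close> and \<open>Z D y\<close> are polynomials in \<open>y, Y\<close> times \<open>D Y / \<Phi>'(y)\<close>. The roots of \<open>\<Phi>(_, Y)\<close> are the five
  values of \<open>y\<close> at \<open>q, \<zeta>q, \<dots>, \<zeta>\<^sup>4q\<close>, so Lagrange interpolation turns \<open>U (y\<^sup>n D y)\<close> and \<open>U (Z y\<^sup>n D y)\<close> into
  integral polynomials in \<open>y\<close> times \<open>D y\<close>. Hence \<open>L\<^sub>\<alpha> = H\<^sub>\<alpha>(y) D y\<close> where the power series \<open>H\<^sub>\<alpha>\<close> arise from two explicit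
  operators: 5-adic estimates for their matrices give the factor \<open>5\<^sup>\<alpha>\<close>, and following the pole at
  \<open>y = -1/5\<close>, whose order is multiplied by roughly five in each step, gives the denominator \<open>(1 + 5y)\<close> to the power \<open>psi \<alpha>\<close>.\<close>

text \<open>No theory of modular forms enters; all identities are reduced to the Jacobi triple
  product. Comparing the five-dissections of \<open>pp (q^2)^2\<close> and of \<open>pp q\<close>
  times Ramanujan's psi function makes the Rogers-Ramanujan fraction appear, and all level ten
  quotients are rational in the parameter k = r(q) r(q^2)^2. One level higher, y(q) is determined by
  k(q^5) and a single fifth root v; \<open>Phi\<close> is what remains after taking the norm in v.

  Some identities come out only up to a root of unity: x through its cube, Z through its square. The
  right root is found from the behaviour as q tends to 0. Therefore the analytic identities are
  stated for small nonzero q, and uniqueness of power series carries the result to the whole disc.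

  Because 1/(1+5X) is an integral power series, divisibility is proved for the coefficients of the
  series H, polynomiality of the numerator is proved separately, and the two are joined at the end.
  A bare factor 5^alpha would not survive the iteration: both matrices have entries prime to 5, so
  coefficient n of H must carry a further power of 5 that grows with n.\<close>

section \<open>The modular equation\<close>

text \<open>The modular equation is \<open>Phi (y(\<tau>)) (y(5\<tau>)) = 0\<close>. The polynomials \<open>res0\<close> (the partial derivative of \<open>- Phi\<close> in \<open>Y\<close>)
  and \<open>res1\<close> are the numerators of \<open>D y\<close> and \<open>Z D y\<close>, up to the factor \<open>5 D Y\<close>.\<close>

fun mcoef :: "nat \<Rightarrow> 'a::comm_ring_1 \<Rightarrow> 'a" where
  "mcoef 0 Y = Y + 20 * Y ^ 2 + 150 * Y ^ 3 + 500 * Y ^ 4 + 625 * Y ^ 5"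
| "mcoef (Suc 0) Y = 15 * Y + 305 * Y ^ 2 + 2325 * Y ^ 3 + 7875 * Y ^ 4 + 10000 * Y ^ 5"
| "mcoef (Suc (Suc 0)) Y = 85 * Y + 1750 * Y ^ 2 + 13525 * Y ^ 3 + 46500 * Y ^ 4 + 60000 * Y ^ 5"
| "mcoef (Suc (Suc (Suc 0))) Y = 215 * Y + 4475 * Y ^ 2 + 35000 * Y ^ 3 + 122000 * Y ^ 4 + 160000 * Y ^ 5"
| "mcoef (Suc (Suc (Suc (Suc 0)))) Y = 205 * Y + 4300 * Y ^ 2 + 34000 * Y ^ 3 + 120000 * Y ^ 4 + 160000 * Y ^ 5"
| "mcoef _ Y = 0"

fun res0 :: "nat \<Rightarrow> 'a::comm_ring_1 \<Rightarrow> 'a" where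
  "res0 0 Y = 1 + 40 * Y + 450 * Y ^ 2 + 2000 * Y ^ 3 + 3125 * Y ^ 4"
| "res0 (Suc 0) Y = 15 + 610 * Y + 6975 * Y ^ 2 + 31500 * Y ^ 3 + 50000 * Y ^ 4"
| "res0 (Suc (Suc 0)) Y = 85 + 3500 * Y + 40575 * Y ^ 2 + 186000 * Y ^ 3 + 300000 * Y ^ 4"
| "res0 (Suc (Suc (Suc 0))) Y = 215 + 8950 * Y + 105000 * Y ^ 2 + 488000 * Y ^ 3 + 800000 * Y ^ 4"
| "res0 (Suc (Suc (Suc (Suc 0)))) Y = 205 + 8600 * Y + 102000 * Y ^ 2 + 480000 * Y ^ 3 + 800000 * Y ^ 4"
| "res0 _ Y = 0"

fun res1 :: "nat \<Rightarrow> 'a::comm_ring_1 \<Rightarrow> 'a" where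
  "res1 0 Y = 15 * Y + 325 * Y ^ 2 + 2625 * Y ^ 3 + 9375 * Y ^ 4 + 12500 * Y ^ 5"
| "res1 (Suc 0) Y = 220 * Y + 4900 * Y ^ 2 + 40500 * Y ^ 3 + 147500 * Y ^ 4 + 200000 * Y ^ 5"
| "res1 (Suc (Suc 0)) Y = 1 + 1230 * Y + 27825 * Y ^ 2 + 234500 * Y ^ 3 + 870000 * Y ^ 4 + 1200000 * Y ^ 5"
| "res1 (Suc (Suc (Suc 0))) Y = 9 + 3100 * Y + 70500 * Y ^ 2 + 604000 * Y ^ 3 + 2280000 * Y ^ 4 + 3200000 * Y ^ 5"
| "res1 (Suc (Suc (Suc (Suc 0)))) Y = 25 + 2980 * Y + 67200 * Y ^ 2 + 584000 * Y ^ 3 + 2240000 * Y ^ 4 + 3200000 * Y ^ 5"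
| "res1 _ Y = 0"

definition evx :: "(nat \<Rightarrow> 'a::comm_ring_1 \<Rightarrow> 'a) \<Rightarrow> 'a \<Rightarrow> 'a \<Rightarrow> 'a" where
  "evx c x Y = (\<Sum>j<5. c j Y * x ^ j)"

definition Phi :: "'a::comm_ring_1 \<Rightarrow> 'a \<Rightarrow> 'a" where
  "Phi x Y = x ^ 5 - evx mcoef x Y"

lemma evx_expand: "evx c x Y = c 0 Y + c (Suc 0) Y * x + c (Suc (Suc 0)) Y * x ^ 2
    + c (Suc (Suc (Suc 0))) Y * x ^ 3 + c (Suc (Suc (Suc (Suc 0)))) Y * x ^ 4"
  unfolding evx_def by (simp add: eval_nat_numeral)

lemmas evx_unfold = evx_expand mcoef.simps res0.simps res1.simps

text \<open>The norm of \<open>a0 + a1 v + a2 v\<^sup>2 + a3 v\<^sup>3 + a4 v\<^sup>4\<close> from \<open>\<complex>(v)\<close> down to \<open>\<complex>(s)\<close>, \<open>s = v\<^sup>5\<close>: it eliminates \<open>v\<close>.\<close>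

definition quintic_norm :: "complex \<Rightarrow> complex \<Rightarrow> complex \<Rightarrow> complex
    \<Rightarrow> complex \<Rightarrow> complex \<Rightarrow> complex" where
  "quintic_norm a0 a1 a2 a3 a4 s = a4^5 * s^4 + a3^5 * s^3 - 5 * a2 * a3^3 * a4 * s^3 + 5 * a2^2 * a3 * a4^2 *
      s^3 + a2^5 * s^2 + 5 * a1 * a3^2 * a4^2 * s^3 - 5 * a1 * a2 * a4^3 * s^3 - 5 * a1 * a2^3 * a3 * s^2 + 5
      * a1^2 * a2 * a3^2 * s^2 + 5 * a1^2 * a2^2 * a4 * s^2 - 5 * a1^3 * a3 * a4 * s^2 + a1^5 * s - 5 * a0 *
      a3 * a4^3 * s^3 + 5 * a0 * a2^2 * a3^2 * s^2 - 5 * a0 * a2^3 * a4 * s^2 - 5 * a0 * a1 * a3^3 * s^2 - 5 *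
      a0 * a1 * a2 * a3 * a4 * s^2 + 5 * a0 * a1^2 * a4^2 * s^2 - 5 * a0 * a1^3 * a2 * s + 5 * a0^2 * a3^2 *
      a4 * s^2 + 5 * a0^2 * a2 * a4^2 * s^2 + 5 * a0^2 * a1 * a2^2 * s + 5 * a0^2 * a1^2 * a3 * s - 5 * a0^3 *
      a2 * a3 * s - 5 * a0^3 * a1 * a4 * s + a0^5"

text \<open>The second factor is the product of the other four conjugates, those with v replaced by
  zeta^j v, sorted by powers of v. Only the vanishing of the norm whenever the first factor vanishes
  is needed.\<close>

lemma norm_quintic:
  fixes a0 a1 a2 a3 a4 v s :: complex
  assumes "v^5 = s"
  shows "quintic_norm a0 a1 a2 a3 a4 s = (a0 + a1 * v + a2 * v^2 + a3 * v^3 + a4 * v^4) * ((a2^2 * a3^2 * s^2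
      - a3 * a4^3 * s^3 - a2^3 * a4 * s^2 - a1 * a3^3 * s^2 - a1 * a2 * a3 * a4 * s^2 + a1^2 * a4^2 * s^2 -
      a1^3 * a2 * s + 2 * a0 * a3^2 * a4 * s^2 + 2 * a0 * a2 * a4^2 * s^2 + 2 * a0 * a1 * a2^2 * s + 2 * a0 *
      a1^2 * a3 * s - 3 * a0^2 * a2 * a3 * s - 3 * a0^2 * a1 * a4 * s + a0^4) + (a4^4 * s^3 - a2 * a3^3 * s^2
      + 2 * a2^2 * a3 * a4 * s^2 + 2 * a1 * a3^2 * a4 * s^2 - 3 * a1 * a2 * a4^2 * s^2 + a1^2 * a2^2 * s -
      a1^3 * a3 * s - 3 * a0 * a3 * a4^2 * s^2 - a0 * a2^3 * s - a0 * a1 * a2 * a3 * s + 2 * a0 * a1^2 * a4 *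
      s + a0^2 * a3^2 * s + 2 * a0^2 * a2 * a4 * s - a0^3 * a1) * v + (a3^4 * s^2 - 3 * a2 * a3^2 * a4 * s^2 +
      a2^2 * a4^2 * s^2 + 2 * a1 * a3 * a4^2 * s^2 - a1 * a2^3 * s + 2 * a1^2 * a2 * a3 * s - a1^3 * a4 * s -
      a0 * a4^3 * s^2 + 2 * a0 * a2^2 * a3 * s - 3 * a0 * a1 * a3^2 * s - a0 * a1 * a2 * a4 * s + 2 * a0^2 *
      a3 * a4 * s + a0^2 * a1^2 - a0^3 * a2) * v^2 + (2 * a2 * a3 * a4^2 * s^2 - a3^3 * a4 * s^2 + a2^4 * s -
      a1 * a4^3 * s^2 - 3 * a1 * a2^2 * a3 * s + a1^2 * a3^2 * s + 2 * a1^2 * a2 * a4 * s + 2 * a0 * a2 * a3^2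
      * s - 3 * a0 * a2^2 * a4 * s - a0 * a1 * a3 * a4 * s - a0 * a1^3 + a0^2 * a4^2 * s + 2 * a0^2 * a1 * a2
      - a0^3 * a3) * v^3 + (a3^2 * a4^2 * s^2 - a2 * a4^3 * s^2 - a2^3 * a3 * s + 2 * a1 * a2 * a3^2 * s + 2 *
      a1 * a2^2 * a4 * s - 3 * a1^2 * a3 * a4 * s + a1^4 - a0 * a3^3 * s - a0 * a2 * a3 * a4 * s + 2 * a0 * a1
      * a4^2 * s - 3 * a0 * a1^2 * a2 + a0^2 * a2^2 + 2 * a0^2 * a1 * a3 - a0^3 * a4) * v^4)"
  unfolding quintic_norm_def assms[symmetric] by algebra

text \<open>The first hypothesis is a quartic equation for v, so its norm vanishes; the second one
  replaces v^5 by a function of m. What is left no longer contains v.\<close>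

lemma norm_quintic_special:
  fixes A B m v :: complex
  assumes eq: "A * (1 - m * v^2 - m^2 * v^4) = B * (m * v * (1 - v - v^2))"
    and T: "v^5 * m^2 * (m + 1) = m - 1"
  shows "(A^5 * m) * (m + 1)^4 * (m - 1)^0 + (5 * A * B^4 * m^3 - B^5 * m^4 - 5 * A^2 * B^3 * m^3 - 5 * A^3 *
      B^2 * m + 10 * A^3 * B^2 * m^2 + 5 * A^4 * B * m - 10 * A^4 * B * m^2) * (m + 1)^3 * (m - 1)^1 + (11 *
      B^5 * m^2 + 10 * A * B^4 * m - 25 * A * B^4 * m^2 - 10 * A * B^4 * m^3 - 10 * A^2 * B^3 * m + 25 * A^2 *
      B^3 * m^2 + 10 * A^2 * B^3 * m^3 - 25 * A^3 * B^2 * m^2 + 25 * A^4 * B * m^2 - 11 * A^5 * m^2) * (m +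
      1)^2 * (m - 1)^2 + (B^5 + 5 * A * B^4 * m - 5 * A^2 * B^3 * m - 10 * A^3 * B^2 * m^2 - 5 * A^3 * B^2 *
      m^3 + 10 * A^4 * B * m^2 + 5 * A^4 * B * m^3) * (m + 1)^1 * (m - 1)^3 + (0 - A^5 * m^3) * (m + 1)^0 * (m
      - 1)^4 = 0"
proof -
  define s where "s = v^5"
  define T where "T = s * m^2 * (m + 1)"
  have p0: "A + (- (B * m)) * v + (m * (B - A)) * v^2 + (B * m) * v^3 + (- (m^2 * A)) * v^4 = 0"
  proof -
    have "A + (- (B * m)) * v + (m * (B - A)) * v^2 + (B * m) * v^3 + (- (m^2 * A)) * v^4
        = A * (1 - m * v^2 - m^2 * v^4) - B * (m * v * (1 - v - v^2))" by algebra
    then show ?thesis using eq by simp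
  qed
  have n0: "quintic_norm A (- (B * m)) (m * (B - A)) (B * m) (- (m^2 * A)) s = 0"
    using norm_quintic[OF s_def[symmetric], where ?a0.0 = A and ?a1.0 = "- (B * m)" and ?a2.0 = "m * (B - A)"
        and ?a3.0 = "B * m" and ?a4.0 = "- (m^2 * A)"]
    unfolding p0 by (simp only: mult_zero_left)
  \<comment> \<open>The factor \<open>(m + 1)^4\<close> supplies \<open>m + 1\<close> for each of up
    to four powers of s, and the single m completes the powers of m, so that s occurs only through
    T.\<close>
  have "(A^5 * m) * (m + 1)^4 * T^0 + (5 * A * B^4 * m^3 - B^5 * m^4 - 5 * A^2 * B^3 * m^3 - 5 * A^3 * B^2 * m
      + 10 * A^3 * B^2 * m^2 + 5 * A^4 * B * m - 10 * A^4 * B * m^2) * (m + 1)^3 * T^1 + (11 * B^5 * m^2 + 10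
      * A * B^4 * m - 25 * A * B^4 * m^2 - 10 * A * B^4 * m^3 - 10 * A^2 * B^3 * m + 25 * A^2 * B^3 * m^2 + 10
      * A^2 * B^3 * m^3 - 25 * A^3 * B^2 * m^2 + 25 * A^4 * B * m^2 - 11 * A^5 * m^2) * (m + 1)^2 * T^2 + (B^5
      + 5 * A * B^4 * m - 5 * A^2 * B^3 * m - 10 * A^3 * B^2 * m^2 - 5 * A^3 * B^2 * m^3 + 10 * A^4 * B * m^2
      + 5 * A^4 * B * m^3) * (m + 1)^1 * T^3 + (0 - A^5 * m^3) * (m + 1)^0 * T^4 = m * (m + 1)^4 *
      (quintic_norm A (- (B * m)) (m * (B - A)) (B * m) (- (m^2 * A)) s)"
    unfolding T_def quintic_norm_def by algebra
  also have "\<dots> = 0" unfolding n0 by simp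
  finally show ?thesis using T by (simp only: T_def s_def)
qed

text \<open>This is \<open>(4 * g)^5\<close> times \<open>Phi y Y\<close> at Y = n / (4 g), so that
  the elimination below is an identity of polynomials.\<close>

definition homogeneous_Phi :: "complex \<Rightarrow> complex \<Rightarrow> complex \<Rightarrow> complex" where
  "homogeneous_Phi y n g = y^5 * (4 * g)^5 - ((1 * n^1 * (4 * g)^4 + 20 * n^2 * (4 * g)^3 + 150 * n^3 * (4 *
      g)^2 + 500 * n^4 * (4 * g)^1 + 625 * n^5 * (4 * g)^0) * y^0 + (15 * n^1 * (4 * g)^4 + 305 * n^2 * (4 *
      g)^3 + 2325 * n^3 * (4 * g)^2 + 7875 * n^4 * (4 * g)^1 + 10000 * n^5 * (4 * g)^0) * y^1 + (85 * n^1 * (4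
      * g)^4 + 1750 * n^2 * (4 * g)^3 + 13525 * n^3 * (4 * g)^2 + 46500 * n^4 * (4 * g)^1 + 60000 * n^5 * (4 *
      g)^0) * y^2 + (215 * n^1 * (4 * g)^4 + 4475 * n^2 * (4 * g)^3 + 35000 * n^3 * (4 * g)^2 + 122000 * n^4 *
      (4 * g)^1 + 160000 * n^5 * (4 * g)^0) * y^3 + (205 * n^1 * (4 * g)^4 + 4300 * n^2 * (4 * g)^3 + 34000 *
      n^3 * (4 * g)^2 + 120000 * n^4 * (4 * g)^1 + 160000 * n^5 * (4 * g)^0) * y^4)"

text \<open>The eliminant splits into the wanted equation and an extraneous factor of degree eight
  in m. At m = 1, the limit for q to 0, that factor equals 16.\<close>

lemma modular_equation_aux:
  fixes y m v :: complex
  assumes eq: "4 * y * (1 + m - m^2) * (1 - m * v^2 - m^2 * v^4) = (1 + 4 * y) * (m^2 + 4 * m - 1) * (m * v * (1 - v - v^2))"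
    and T: "v^5 * m^2 * (m + 1) = m - 1"
    and nz: "(m^8 + 6 * m^7 - 3 * m^6 - 42 * m^5 + 20 * m^4 + 42 * m^3 - 3 * m^2 - 6 * m + 1) \<noteq> 0"
    and g: "g = 1 + m - m^2" and n: "n = m^2 - 1"
  shows "homogeneous_Phi y n g = 0"
proof -
  define A B where "A = 4 * y * (1 + m - m^2)" and "B = (1 + 4 * y) * (m^2 + 4 * m - 1)"
  have "0 = (A^5 * m) * (m + 1)^4 * (m - 1)^0 + (5 * A * B^4 * m^3 - B^5 * m^4 - 5 * A^2 * B^3 * m^3 - 5 * A^3
      * B^2 * m + 10 * A^3 * B^2 * m^2 + 5 * A^4 * B * m - 10 * A^4 * B * m^2) * (m + 1)^3 * (m - 1)^1 + (11 *
      B^5 * m^2 + 10 * A * B^4 * m - 25 * A * B^4 * m^2 - 10 * A * B^4 * m^3 - 10 * A^2 * B^3 * m + 25 * A^2 *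
      B^3 * m^2 + 10 * A^2 * B^3 * m^3 - 25 * A^3 * B^2 * m^2 + 25 * A^4 * B * m^2 - 11 * A^5 * m^2) * (m +
      1)^2 * (m - 1)^2 + (B^5 + 5 * A * B^4 * m - 5 * A^2 * B^3 * m - 10 * A^3 * B^2 * m^2 - 5 * A^3 * B^2 *
      m^3 + 10 * A^4 * B * m^2 + 5 * A^4 * B * m^3) * (m + 1)^1 * (m - 1)^3 + (0 - A^5 * m^3) * (m + 1)^0 * (m
      - 1)^4"
    by (rule norm_quintic_special[symmetric, OF _ T]) (use eq in \<open>simp add: A_def B_def\<close>)
  also have "\<dots> = (m^8 + 6 * m^7 - 3 * m^6 - 42 * m^5 + 20 * m^4 + 42 * m^3 - 3 * m^2 - 6 * m + 1) * (homogeneous_Phi y n g)"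
    unfolding homogeneous_Phi_def A_def B_def g n by algebra
  finally show ?thesis using nz by simp
qed

text \<open>It will be applied with y = y(q), Y = y(q^5), v = q \<open>bb (q^5)\<close> and m = (1 +
  K) / (1 - K) for K = \<open>kk (q^5)\<close>.\<close>

lemma modular_equation:
  fixes y Y m v :: complex
  assumes "4 * y * (1 + m - m^2) * (1 - m * v^2 - m^2 * v^4) = (1 + 4 * y) * (m^2 + 4 * m - 1) * (m * v * (1 - v - v^2))"
    and "v^5 * m^2 * (m + 1) = m - 1"
    and "(m^8 + 6 * m^7 - 3 * m^6 - 42 * m^5 + 20 * m^4 + 42 * m^3 - 3 * m^2 - 6 * m + 1) \<noteq> 0" and g0: "1 + m - m^2 \<noteq> 0"
    and Y: "4 * (1 + m - m^2) * Y = m^2 - 1"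
  shows "Phi y Y = 0"
proof -
  define g where "g = 1 + m - m^2"
  have "0 = homogeneous_Phi y (4 * g * Y) g"
    using modular_equation_aux[OF assms(1-3) g_def Y] by (simp add: g_def)
  also have "\<dots> = (4 * g)^5 * Phi y Y"
    unfolding homogeneous_Phi_def Phi_def evx_unfold by algebra
  finally show ?thesis using g0 unfolding g_def[symmetric] by simp
qed

text \<open>The square of \<open>res1 = Z res0\<close>, reduced modulo \<open>Phi\<close>; the cofactor was found by polynomial division.\<close>

lemma residue_square:
  fixes x Y :: complex
  shows "evx res1 x Y ^ 2 * (1 + 4 * x)^3 * (1 + 5 * Y)^4 - evx res0 x Y ^ 2 * x^4 * (1 + 4 * Y)
    = Phi x Y * (0 - 225 * Y - 9750 * Y^2 - 184375 * Y^3 - 1987500 * Y^4 - 13359375 * Y^5 - 57343750 * Y^6 -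
        153515625 * Y^7 - 234375000 * Y^8 - 156250000 * Y^9 - 5925 * x * Y - 259625 * x * Y^2 - 4958750 * x *
        Y^3 - 53931250 * x * Y^4 - 365390625 * x * Y^5 - 1579453125 * x * Y^6 - 4254687500 * x * Y^7 -
        6531250000 * x * Y^8 - 4375000000 * x * Y^9 - 30 * x^2 - 67950 * x^2 * Y - 2979500 * x^2 * Y^2 -
        57297500 * x^2 * Y^3 - 627893750 * x^2 * Y^4 - 4285093750 * x^2 * Y^5 - 18647500000 * x^2 * Y^6 -
        50537500000 * x^2 * Y^7 - 78000000000 * x^2 * Y^8 - 52500000000 * x^2 * Y^9 - 620 * x^3 - 441050 * x^3
        * Y - 19113750 * x^3 * Y^2 - 368763750 * x^3 * Y^3 - 4065893750 * x^3 * Y^4 - 27931875000 * x^3 * Y^5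
        - 122330000000 * x^3 * Y^6 - 333500000000 * x^3 * Y^7 - 517500000000 * x^3 * Y^8 - 350000000000 * x^3
        * Y^9 - 5216 * x^4 - 1755110 * x^4 * Y - 74082400 * x^4 * Y^2 - 1427928750 * x^4 * Y^3 - 15815562500 *
        x^4 * Y^4 - 109295250000 * x^4 * Y^5 - 481580000000 * x^4 * Y^6 - 1320500000000 * x^4 * Y^7 -
        2060000000000 * x^4 * Y^8 - 1400000000000 * x^4 * Y^9 - 22275 * x^5 - 4294965 * x^5 * Y - 173652950 *
        x^5 * Y^2 - 3327425000 * x^5 * Y^3 - 36956150000 * x^5 * Y^4 - 256723000000 * x^5 * Y^5 -
        1137700000000 * x^5 * Y^6 - 3137200000000 * x^5 * Y^7 - 4920000000000 * x^5 * Y^8 - 3360000000000 *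
        x^5 * Y^9 - 48150 * x^6 - 5999225 * x^6 * Y - 228212400 * x^6 * Y^2 - 4321700000 * x^6 * Y^3 -
        48035000000 * x^6 * Y^4 - 335172000000 * x^6 * Y^5 - 1493440000000 * x^6 * Y^6 - 4140800000000 * x^6 *
        Y^7 - 6528000000000 * x^6 * Y^8 - 4480000000000 * x^6 * Y^9 - 42025 * x^7 - 3694100 * x^7 * Y -
        129884000 * x^7 * Y^2 - 2414320000 * x^7 * Y^3 - 26792800000 * x^7 * Y^4 - 187632000000 * x^7 * Y^5 -
        840320000000 * x^7 * Y^6 - 2342400000000 * x^7 * Y^7 - 3712000000000 * x^7 * Y^8 - 2560000000000 * x^7
        * Y^9)"
  unfolding Phi_def evx_unfold by algebra

section \<open>5-adic estimates\<close>

text \<open>Stated for complex numbers because the series of the analytic part have complex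
  coefficients; being an integer is part of the claim, so \<open>dv 0\<close> expresses
  integrality.\<close>

definition dv :: "nat \<Rightarrow> complex \<Rightarrow> bool" where
  "dv k c \<longleftrightarrow> (\<exists>i::int. c = of_int (5 ^ k * i))"

lemma dv_0 [simp]: "dv k 0"
  unfolding dv_def by (intro exI[of _ 0]) simp

lemma dv_add: "dv k a \<Longrightarrow> dv k b \<Longrightarrow> dv k (a + b)"
  unfolding dv_def by (metis distrib_left of_int_add)

lemma dv_sum: "(\<And>i. i \<in> A \<Longrightarrow> dv k (f i)) \<Longrightarrow> dv k (\<Sum>i\<in>A. f i)"
  by (induction A rule: infinite_finite_induct) (auto intro: dv_add)

lemma dv_mult: "dv j a \<Longrightarrow> dv k b \<Longrightarrow> dv (j + k) (a * b)"
  unfolding dv_def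
proof (elim exE)
  fix i i' assume "a = of_int (5 ^ j * i)" "b = of_int (5 ^ k * i')"
  then have "a * b = of_int (5 ^ (j + k) * (i * i'))" by (simp add: power_add)
  then show "\<exists>i. a * b = of_int (5 ^ (j + k) * i)" by blast
qed

lemma dv_mono: "dv k a \<Longrightarrow> j \<le> k \<Longrightarrow> dv j a"
  unfolding dv_def
proof (elim exE)
  fix i assume "a = of_int (5 ^ k * i)" "j \<le> k"
  then have "a = of_int (5 ^ j * (5 ^ (k - j) * i))"
    by (simp add: mult.assoc[symmetric] power_add[symmetric])
  then show "\<exists>i. a = of_int (5 ^ j * i)" by blast
qed

lemma dv_numeral: "(5::int) ^ k dvd numeral w \<Longrightarrow> dv k (numeral w)"
  unfolding dv_def dvd_def by (metis of_int_numeral)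

lemma dv_of_int [simp]: "dv 0 (of_int i)" unfolding dv_def by (intro exI[of _ i]) simp

lemma sum_lessThan_5: "(\<Sum>j<5. f j) = f 0 + f 1 + f 2 + f 3 + f (4::nat)"
  by (simp add: eval_nat_numeral)

lemma dv_1: "dv 0 1" unfolding dv_def by (intro exI[of _ 1]) simp

text \<open>The coefficient of \<open>X\<^sup>r\<close> has 5-adic valuation at least \<open>(5 r - d) / 6\<close>.\<close>

definition wt :: "int \<Rightarrow> complex fps \<Rightarrow> bool" where
  "wt d f \<longleftrightarrow> (\<forall>r. dv (nat ((5 * int r - d + 5) div 6)) (fps_nth f r))"

lemma wt_0 [simp]: "wt d 0" by (simp add: wt_def)

lemma wt_add: "wt d f \<Longrightarrow> wt d g \<Longrightarrow> wt d (f + g)"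
  by (auto simp: wt_def intro: dv_add)

lemma wt_sum: "(\<And>i. i \<in> A \<Longrightarrow> wt d (f i)) \<Longrightarrow> wt d (\<Sum>i\<in>A. f i)"
  by (induction A rule: infinite_finite_induct) (auto intro: wt_add)

text \<open>The exponent is the ceiling of (5 r - d) / 6, and ceilings are subadditive.\<close>

lemma wt_mult:
  assumes "wt d f" "wt e g"
  shows "wt (d + e) (f * g)"
  unfolding wt_def fps_mult_nth
proof (intro allI dv_sum)
  fix r i :: nat
  assume "i \<in> {0..r}"
  then have "nat ((5 * int r - (d + e) + 5) div 6)
      \<le> nat ((5 * int i - d + 5) div 6) + nat ((5 * int (r - i) - e + 5) div 6)"
    by (simp add: of_nat_diff)
  then show "dv (nat ((5 * int r - (d + e) + 5) div 6)) (fps_nth f i * fps_nth g (r - i))"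
    using assms unfolding wt_def by (meson dv_mono dv_mult)
qed

lemma wt_monom:
  assumes "dv (nat ((5 * int i - d + 5) div 6)) c"
  shows "wt d (fps_const c * fps_X ^ i)"
  using assms by (auto simp: wt_def fps_X_power_nth)

lemma wt_monom_numeral:
  assumes "(5::int) ^ nat ((5 * int i - d + 5) div 6) dvd numeral w"
  shows "wt d (numeral w * fps_X ^ i)"
  using wt_monom[OF dv_numeral[OF assms]] by (simp add: numeral_fps_const)

lemma wt_numeral:
  assumes "(5::int) ^ nat ((5 - d) div 6) dvd numeral w"
  shows "wt d (numeral w)"
  using wt_monom_numeral[of 0 d w] assms by simp

lemma wt_numeral_X:
  assumes "(5::int) ^ nat ((10 - d) div 6) dvd numeral w"
  shows "wt d (numeral w * fps_X)"
  using wt_monom_numeral[of 1 d w] assms by (simp add: algebra_simps)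

lemma wt_X: "d \<ge> 5 \<Longrightarrow> wt d fps_X"
  using wt_monom[of 1 d 1] by (simp add: dv_1)

lemma wt_1: "d \<ge> 0 \<Longrightarrow> wt d 1"
  using wt_monom[of 0 d 1] by (simp add: dv_1)

lemmas wt_intros = wt_add wt_monom_numeral wt_numeral wt_numeral_X wt_X wt_1

lemma less_5_cases:
  assumes "j < (5::nat)"
  shows "j = 0 \<or> j = Suc 0 \<or> j = Suc (Suc 0) \<or> j = Suc (Suc (Suc 0)) \<or> j = Suc (Suc (Suc (Suc 0)))"
  using assms by linarith

text \<open>If x has weight 1, then x^5 = sum of \<open>mcoef j\<close> x^j is homogeneous of weight
  5. This is what lets the recursion of \<open>hs\<close> propagate its weight.\<close>

lemma wt_mcoef: "j < 5 \<Longrightarrow> wt (5 - int j) (mcoef j fps_X)"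
  by (drule less_5_cases) (elim disjE; hypsubst; unfold mcoef.simps; intro wt_intros; simp)

text \<open>In the same grading \<open>evx res0\<close> has total weight 0 and
  \<open>evx res1\<close> total weight 3; with the shift by 4 in \<open>hs\<close> this yields the
  offsets -4 and -1 of the rows.\<close>

lemma wt_res0: "j < 5 \<Longrightarrow> wt (- int j) (res0 j fps_X)"
  by (drule less_5_cases) (elim disjE; hypsubst; unfold res0.simps; intro wt_intros; simp)

lemma wt_res1: "j < 5 \<Longrightarrow> wt (3 - int j) (res1 j fps_X)"
  by (drule less_5_cases) (elim disjE; hypsubst; unfold res1.simps; intro wt_intros; simp)

text \<open>If \<open>y\<^sub>i\<close> are the roots of \<open>Phi _ Y\<close>, then \<open>hs Y k\<close> is the sum of \<open>y\<^sub>i\<^sup>k / \<Phi>'(y\<^sub>i)\<close>, a shifted complete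
  homogeneous symmetric function.\<close>

fun hs :: "'a::comm_ring_1 \<Rightarrow> nat \<Rightarrow> 'a" where
  "hs Y k = (if k < 5 then (if k = 4 then 1 else 0) else (\<Sum>j<5. mcoef j Y * hs Y (k - 5 + j)))"

declare hs.simps [simp del]

lemma hs_add_5: "hs Y (k + 5) = (\<Sum>j<5. mcoef j Y * hs Y (k + j))"
  by (subst hs.simps) simp

lemma hs_small: "k < 5 \<Longrightarrow> hs Y k = (if k = 4 then 1 else 0)"
  by (subst hs.simps) simp

text \<open>The sum of \<open>c(y\<^sub>i) y\<^sub>i\<^sup>n / \<Phi>'(y\<^sub>i)\<close> over the roots: the rows of the matrix of \<open>U\<close> for \<open>c = res0, res1\<close>.\<close>

definition pw :: "(nat \<Rightarrow> 'a::comm_ring_1 \<Rightarrow> 'a) \<Rightarrow> 'a \<Rightarrow> nat \<Rightarrow> 'a" where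
  "pw c Y n = (\<Sum>j<5. c j Y * hs Y (n + j))"

lemma pw_add_5: "pw c Y (n + 5) = (\<Sum>j<5. mcoef j Y * pw c Y (n + j))"
proof -
  have "pw c Y (n + 5) = (\<Sum>i<5. c i Y * (\<Sum>j<5. mcoef j Y * hs Y (n + i + j)))"
    unfolding pw_def hs_add_5[symmetric] by (simp add: algebra_simps)
  also have "\<dots> = (\<Sum>j<5. mcoef j Y * (\<Sum>i<5. c i Y * hs Y (n + j + i)))"
    unfolding sum_distrib_left by (subst sum.swap) (simp add: algebra_simps)
  finally show ?thesis by (simp add: pw_def)
qed

lemma nat_cases_5: obtains "(k::nat) < 5" | i where "k = i + 5"
  by (metis add.commute le_iff_add not_less)

lemma wt_hs: "wt (int k - 4) (hs fps_X k)"
proof (induction k rule: less_induct)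
  case (less k)
  show ?case
  proof (cases k rule: nat_cases_5)
    case 1
    then show ?thesis by (auto simp: hs_small intro: wt_1)
  next
    case (2 i)
    show ?thesis unfolding 2 hs_add_5
    proof (rule wt_sum)
      fix j :: nat assume j: "j \<in> {..<5}"
      have "wt ((5 - int j) + (int (i + j) - 4)) (mcoef j fps_X * hs fps_X (i + j))"
        using j 2 by (intro wt_mult wt_mcoef less) auto
      then show "wt (int (i + 5) - 4) (mcoef j fps_X * hs fps_X (i + j))" by simp
    qed
  qed
qed

lemma wt_pw_res0: "wt (int n - 4) (pw res0 fps_X n)"
  unfolding pw_def
proof (rule wt_sum)
  fix j :: nat assume "j \<in> {..<5}"
  then have "wt (- int j + (int (n + j) - 4)) (res0 j fps_X * hs fps_X (n + j))"
    by (intro wt_mult wt_res0 wt_hs) auto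
  then show "wt (int n - 4) (res0 j fps_X * hs fps_X (n + j))" by simp
qed

lemma wt_pw_res1: "wt (int n - 1) (pw res1 fps_X n)"
  unfolding pw_def
proof (rule wt_sum)
  fix j :: nat assume "j \<in> {..<5}"
  then have "wt (3 - int j + (int (n + j) - 4)) (res1 j fps_X * hs fps_X (n + j))"
    by (intro wt_mult wt_res1 wt_hs) auto
  then show "wt (int n - 1) (res1 j fps_X * hs fps_X (n + j))" by simp
qed

section \<open>Congruences modulo 5\<close>

definition md5 :: "complex fps \<Rightarrow> complex fps \<Rightarrow> bool" where
  "md5 f g \<longleftrightarrow> (\<forall>r. dv 1 (fps_nth f r - fps_nth g r))"

lemma md5_refl [simp]: "md5 f f" by (simp add: md5_def)

lemma md5_add: "md5 f g \<Longrightarrow> md5 f' g' \<Longrightarrow> md5 (f + f') (g + g')"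
  unfolding md5_def by (metis (no_types, lifting) add_diff_add dv_add fps_add_nth)

lemma md5_sum: "(\<And>i. i \<in> A \<Longrightarrow> md5 (f i) (g i)) \<Longrightarrow> md5 (\<Sum>i\<in>A. f i) (\<Sum>i\<in>A. g i)"
  by (induction A rule: infinite_finite_induct) (auto intro: md5_add)

lemma md5_mult:
  assumes "md5 f g" "md5 f' g'" "\<And>r. dv 0 (fps_nth f' r)" "\<And>r. dv 0 (fps_nth g r)"
  shows "md5 (f * f') (g * g')"
  unfolding md5_def
proof
  fix r
  have "fps_nth (f * f') r - fps_nth (g * g') r =
      (\<Sum>i=0..r. (fps_nth f i - fps_nth g i) * fps_nth f' (r - i) + fps_nth g i * (fps_nth f' (r - i) - fps_nth g' (r - i)))"
    unfolding fps_mult_nth sum_subtractf[symmetric] by (intro sum.cong) (auto simp: algebra_simps)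
  moreover have "dv 1 \<dots>"
    using assms dv_mult[of 1 _ 0] dv_mult[of 0 _ 1]
    by (intro dv_sum dv_add) (auto simp: md5_def)
  ultimately show "dv 1 (fps_nth (f * f') r - fps_nth (g * g') r)" by simp
qed

lemma wt_imp_integral: "wt d f \<Longrightarrow> dv 0 (fps_nth f r)"
  unfolding wt_def using dv_mono by blast

text \<open>A Kronecker congruence: \<open>Phi x Y\<close> is x^5 - Y modulo 5. Hence
  \<open>hs\<close> is a monomial or zero modulo 5.\<close>

lemma md5_mcoef: "j < 5 \<Longrightarrow> md5 (mcoef j fps_X) (if j = 0 then fps_X else 0)"
proof (drule less_5_cases, elim disjE; hypsubst)
  show "md5 (mcoef 0 fps_X) (if 0 = (0::nat) then fps_X else 0)"
    unfolding mcoef.simps md5_def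
    by (auto simp: numeral_fps_const fps_X_power_nth intro: dv_numeral)
qed (simp_all add: md5_def fps_X_power_nth numeral_fps_const dv_numeral)

lemma md5_hs: "md5 (hs fps_X k) (if k mod 5 = 4 then fps_X ^ (k div 5) else 0)"
proof (induction k rule: less_induct)
  case (less k)
  show ?case
  proof (cases k rule: nat_cases_5)
    case 1
    then have "k = 4 \<longleftrightarrow> k mod 5 = 4" "k div 5 = 0" by auto
    then show ?thesis using 1 by (auto simp: hs_small)
  next
    case (2 i)
    have "md5 (\<Sum>j<5. mcoef j fps_X * hs fps_X (i + j))
        (\<Sum>j<5. (if j = 0 then fps_X else 0) * (if (i + j) mod 5 = 4 then fps_X ^ ((i + j) div 5) else 0))"
      using 2 by (intro md5_sum md5_mult md5_mcoef less wt_imp_integral[OF wt_hs]) (auto simp: fps_X_nth dv_1)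
    also have "(\<Sum>j<5. (if j = 0 then fps_X else 0) * (if (i + j) mod 5 = 4 then fps_X ^ ((i + j) div 5) else 0))
        = (if k mod 5 = 4 then fps_X ^ (k div 5) else (0 :: complex fps))"
      unfolding 2 by (simp add: if_distrib[of "\<lambda>x. x * _"] sum.If_cases cong: if_cong)
    finally show ?thesis unfolding 2 hs_add_5 .
  qed
qed

lemma md5_pw:
  assumes "\<And>j. j < 5 \<Longrightarrow> md5 (c j fps_X) (fps_const (of_int (a j)))"
  shows "md5 (pw c fps_X n) (\<Sum>j<5. fps_const (of_int (a j)) * (if (n + j) mod 5 = 4 then fps_X ^ ((n + j) div 5) else 0))"
  unfolding pw_def
  by (intro md5_sum md5_mult md5_hs wt_imp_integral[OF wt_hs] assms)
     (auto simp: dv_of_int)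

text \<open>Modulo 5 \<open>evx res0\<close> is the constant 1, so row n agrees with
  \<open>hs\<close> at n and has a single entry prime to 5.\<close>

lemma dv_pw_res0:
  assumes "n \<noteq> 5 * r + 4"
  shows "dv 1 (fps_nth (pw res0 fps_X n) r)"
proof -
  have "md5 (res0 j fps_X) (fps_const (of_int (if j = 0 then 1 else 0)))" if "j < 5" for j
    by (insert less_5_cases[OF that], elim disjE; hypsubst; unfold res0.simps)
       (auto simp: md5_def fps_X_power_nth numeral_fps_const dv_numeral)
  from md5_pw[of res0, where a = "\<lambda>j. if j = 0 then 1 else 0", OF this, of n]
  have "md5 (pw res0 fps_X n) (if n mod 5 = 4 then fps_X ^ (n div 5) else 0)"
    unfolding sum_lessThan_5 by (simp cong: if_cong)
  then have "dv 1 (fps_nth (pw res0 fps_X n) r - fps_nth (if n mod 5 = 4 then fps_X ^ (n div 5) else 0) r)"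
    unfolding md5_def by blast
  moreover have "n mod 5 = 4 \<Longrightarrow> r \<noteq> n div 5" using assms by presburger
  ultimately show ?thesis by (auto simp: fps_X_power_nth split: if_splits)
qed

text \<open>Modulo 5 \<open>evx res1\<close> is x^2 + 9 x^3, so two shifts of \<open>hs\<close>
  contribute, by n + 2 and by n + 3.\<close>

lemma dv_pw_res1:
  assumes "n \<noteq> 5 * r + 1" "n \<noteq> 5 * r + 2"
  shows "dv 1 (fps_nth (pw res1 fps_X n) r)"
proof -
  have "md5 (res1 j fps_X) (fps_const (of_int (if j = 2 then 1 else if j = 3 then 9 else 0)))" if "j < 5" for j
    by (insert less_5_cases[OF that], elim disjE; hypsubst; unfold res1.simps)
       (auto simp: md5_def fps_X_power_nth numeral_fps_const dv_numeral)
  from md5_pw[of res1, where a = "\<lambda>j. if j = 2 then 1 else if j = 3 then 9 else 0", OF this, of n]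
  have "md5 (pw res1 fps_X n) ((if (n + 2) mod 5 = 4 then fps_X ^ ((n + 2) div 5) else 0)
      + fps_const 9 * (if (n + 3) mod 5 = 4 then fps_X ^ ((n + 3) div 5) else 0))"
    unfolding sum_lessThan_5 by simp
  then have "dv 1 (fps_nth (pw res1 fps_X n) r - fps_nth ((if (n + 2) mod 5 = 4 then fps_X ^ ((n + 2) div 5) else 0)
      + fps_const 9 * (if (n + 3) mod 5 = 4 then fps_X ^ ((n + 3) div 5) else 0)) r)"
    unfolding md5_def by blast
  moreover have "(n + 2) mod 5 = 4 \<Longrightarrow> r \<noteq> (n + 2) div 5" "(n + 3) mod 5 = 4 \<Longrightarrow> r \<noteq> (n + 3) div 5"
    using assms by presburger+
  ultimately show ?thesis by (auto simp: fps_X_power_nth split: if_splits)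
qed

text \<open>Every \<open>mcoef j\<close> has constant term zero, so each use of the recursion lowers
  k by at most five and raises the order in X by at least one.\<close>

lemma hs_nth_0: "5 * r + 4 < k \<Longrightarrow> fps_nth (hs (fps_X :: complex fps) k) r = 0"
proof (induction k arbitrary: r rule: less_induct)
  case (less k)
  show ?case
  proof (cases k rule: nat_cases_5)
    case 1
    then show ?thesis using less.prems by simp
  next
    case (2 i)
    have mc0: "fps_nth (mcoef j (fps_X :: complex fps)) 0 = 0" if "j < 5" for j
      by (insert less_5_cases[OF that], elim disjE; hypsubst; unfold mcoef.simps)
         (simp_all add: fps_X_power_nth numeral_fps_const)
    have "fps_nth (mcoef j (fps_X :: complex fps)) m * fps_nth (hs fps_X (i + j)) (r - m) = 0" if "j < 5" "m \<le> r" for j m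
    proof (cases "m = 0")
      case False
      then have "5 * (r - m) + 4 < i + j" using that less.prems 2 by auto
      then show ?thesis using less.IH[of "i + j" "r - m"] that 2 by auto
    qed (simp add: mc0 that)
    then show ?thesis unfolding 2 hs_add_5 fps_sum_nth fps_mult_nth by (simp add: sum.neutral)
  qed
qed

lemma pw_nth_0:
  assumes "5 * r + 4 < n"
  shows "fps_nth (pw c (fps_X :: complex fps) n) r = 0"
proof -
  have "fps_nth (c j fps_X) m * fps_nth (hs (fps_X :: complex fps) (n + j)) (r - m) = 0" for j m
    using hs_nth_0[of "r - m" "n + j"] assms by simp
  then show ?thesis unfolding pw_def fps_sum_nth fps_mult_nth by (intro sum.neutral ballI)
qed

section \<open>The operators on power series in y\<close>

text \<open>The sum over all \<open>n\<close> of \<open>h\<^sub>n\<close> times row \<open>n\<close>; rows beyond \<open>5 r + 4\<close> do not reach \<open>X\<^sup>r\<close>.\<close>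

definition uop :: "(nat \<Rightarrow> complex fps \<Rightarrow> complex fps) \<Rightarrow> complex fps \<Rightarrow> complex fps" where
  "uop c h = Abs_fps (\<lambda>r. \<Sum>n\<le>5 * r + 4. fps_nth h n * fps_nth (pw c fps_X n) r)"

lemma uop_nth:
  assumes "5 * r + 4 \<le> M"
  shows "fps_nth (uop c h) r = (\<Sum>n\<le>M. fps_nth h n * fps_nth (pw c fps_X n) r)"
  unfolding uop_def fps_nth_Abs_fps
  by (rule sum.mono_neutral_left) (use assms in \<open>auto simp: pw_nth_0 not_le\<close>)

lemma uop_add: "uop c (f + g) = uop c f + uop c g"
  by (rule fps_ext) (simp add: uop_def sum.distrib algebra_simps)

lemma uop_sum: "uop c (\<Sum>i\<in>A. f i) = (\<Sum>i\<in>A. uop c (f i))"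
proof (induction A rule: infinite_finite_induct)
qed (auto simp: uop_add, auto simp: uop_def fps_eq_iff)

lemma uop_cmult: "uop c (fps_const a * f) = fps_const a * uop c f"
  by (rule fps_ext) (simp add: uop_def sum_distrib_left algebra_simps)

lemma uop_X_power_mult:
  assumes "5 * r + 4 \<le> M"
  shows "fps_nth (uop c (fps_X ^ j * h)) r = (\<Sum>n\<le>M. fps_nth h n * fps_nth (pw c fps_X (n + j)) r)"
proof -
  have "fps_nth (uop c (fps_X ^ j * h)) r = (\<Sum>n\<le>M + j. fps_nth (fps_X ^ j * h) n * fps_nth (pw c fps_X n) r)"
    by (rule uop_nth) (use assms in simp)
  also have "\<dots> = (\<Sum>n\<in>{j..M + j}. fps_nth (fps_X ^ j * h) n * fps_nth (pw c fps_X n) r)"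
    by (rule sum.mono_neutral_right) (auto simp: fps_X_power_mult_nth)
  also have "\<dots> = (\<Sum>n\<in>{0..M}. fps_nth (fps_X ^ j * h) (n + j) * fps_nth (pw c fps_X (n + j)) r)"
    using sum.shift_bounds_cl_nat_ivl[of _ 0 j M] by simp
  finally show ?thesis by (simp add: fps_X_power_mult_nth atLeast0AtMost)
qed

lemma uop_X_power: "uop c (fps_X ^ j) = pw c fps_X j"
proof (rule fps_ext)
  fix r
  have "fps_nth (uop c (fps_X ^ j * 1)) r = (\<Sum>n\<le>5 * r + 4. (if n = 0 then fps_nth (pw c fps_X (n + j)) r else 0))"
    by (subst uop_X_power_mult[OF order.refl], rule sum.cong) (simp_all add: fps_one_nth)
  then show "fps_nth (uop c (fps_X ^ j)) r = fps_nth (pw c fps_X j) r" by simp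
qed

text \<open>The variable inside \<open>uop c\<close> behaves like a root of \<open>Phi\<close>: its
  fifth power may be reduced, with the coefficients \<open>mcoef j\<close> passing outside as series
  in Y.\<close>

lemma uop_module: "uop c (fps_X ^ 5 * h) = (\<Sum>j<5. mcoef j fps_X * uop c (fps_X ^ j * h))"
proof (rule fps_ext)
  fix r
  have "fps_nth (uop c (fps_X ^ 5 * h)) r
      = (\<Sum>n\<le>5 * r + 4. fps_nth h n * (\<Sum>j<5. \<Sum>i=0..r. fps_nth (mcoef j fps_X) i * fps_nth (pw c fps_X (n + j)) (r - i)))"
    by (subst uop_X_power_mult[OF order.refl]) (simp add: pw_add_5 fps_sum_nth fps_mult_nth)
  also have "\<dots> = (\<Sum>j<5. \<Sum>i=0..r. fps_nth (mcoef j fps_X) i * (\<Sum>n\<le>5 * r + 4. fps_nth h n * fps_nth (pw c fps_X (n + j)) (r - i)))"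
    unfolding sum_distrib_left
    by (subst sum.swap, rule sum.cong, rule refl, subst sum.swap) (simp add: algebra_simps)
  also have "\<dots> = (\<Sum>j<5. \<Sum>i=0..r. fps_nth (mcoef j fps_X) i * fps_nth (uop c (fps_X ^ j * h)) (r - i))"
    by (intro sum.cong refl arg_cong2[where f = "(*)"] uop_X_power_mult[symmetric]) auto
  finally show "fps_nth (uop c (fps_X ^ 5 * h)) r = fps_nth (\<Sum>j<5. mcoef j fps_X * uop c (fps_X ^ j * h)) r"
    by (simp add: fps_sum_nth fps_mult_nth)
qed

section \<open>The order of the pole at y = -1/5\<close>

definition Pol :: "complex fps \<Rightarrow> bool" where
  "Pol f \<longleftrightarrow> (\<exists>p. f = fps_of_poly p)"

lemma Pol_add: "Pol f \<Longrightarrow> Pol g \<Longrightarrow> Pol (f + g)"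
  unfolding Pol_def by (metis fps_of_poly_add)

lemma Pol_mult: "Pol f \<Longrightarrow> Pol g \<Longrightarrow> Pol (f * g)"
  unfolding Pol_def by (metis fps_of_poly_mult)

lemma Pol_const: "Pol (fps_const a)"
  unfolding Pol_def by (metis fps_of_poly_const)

lemma Pol_numeral: "Pol (numeral w)"
  by (simp add: numeral_fps_const Pol_const)

lemma Pol_0: "Pol 0" and Pol_1: "Pol 1"
  using Pol_const[of 0] Pol_const[of 1] by simp_all

lemma Pol_uminus: "Pol f \<Longrightarrow> Pol (- f)"
  unfolding Pol_def by (metis fps_of_poly_uminus)

lemma Pol_diff: "Pol f \<Longrightarrow> Pol g \<Longrightarrow> Pol (f - g)"
  unfolding Pol_def by (metis fps_of_poly_diff)

lemma Pol_power: "Pol f \<Longrightarrow> Pol (f ^ n)"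
  by (induction n) (auto intro: Pol_mult Pol_1)

lemma Pol_X: "Pol fps_X"
  unfolding Pol_def by (metis fps_of_poly_fps_X)

lemma Pol_sum: "(\<And>i. i \<in> A \<Longrightarrow> Pol (f i)) \<Longrightarrow> Pol (\<Sum>i\<in>A. f i)"
  by (induction A rule: infinite_finite_induct) (auto intro: Pol_add Pol_0)

lemmas Pol_intros = Pol_add Pol_mult Pol_diff Pol_uminus Pol_power Pol_X Pol_1 Pol_0 Pol_numeral Pol_const

lemma Pol_mcoef: "j < 5 \<Longrightarrow> Pol (mcoef j fps_X)"
  by (drule less_5_cases) (elim disjE; hypsubst; unfold mcoef.simps; intro Pol_intros)

lemma Pol_res0: "j < 5 \<Longrightarrow> Pol (res0 j fps_X)"
  by (drule less_5_cases) (elim disjE; hypsubst; unfold res0.simps; intro Pol_intros)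

lemma Pol_res1: "j < 5 \<Longrightarrow> Pol (res1 j fps_X)"
  by (drule less_5_cases) (elim disjE; hypsubst; unfold res1.simps; intro Pol_intros)

lemma Pol_hs: "Pol (hs fps_X k)"
proof (induction k rule: less_induct)
  case (less k)
  show ?case
  proof (cases k rule: nat_cases_5)
    case 1
    then show ?thesis by (auto simp: hs_small Pol_0 Pol_1)
  next
    case (2 i)
    show ?thesis unfolding 2 hs_add_5 by (intro Pol_sum Pol_mult Pol_mcoef less) (auto simp: 2)
  qed
qed

lemma Pol_uop_poly:
  assumes c: "\<And>j. j < 5 \<Longrightarrow> Pol (c j fps_X)" and "Pol f"
  shows "Pol (uop c f)"
proof -
  obtain p where p: "f = fps_of_poly p" using assms unfolding Pol_def by blast
  have "f = (\<Sum>i\<le>degree p. fps_const (coeff p i) * fps_X ^ i)"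
    unfolding p by (subst poly_as_sum_of_monoms[symmetric])
      (simp add: fps_of_poly_sum fps_of_poly_monom)
  then have "uop c f = (\<Sum>i\<le>degree p. fps_const (coeff p i) * pw c fps_X i)"
    by (simp add: uop_sum uop_cmult uop_X_power)
  then show ?thesis using c by (auto simp: pw_def intro!: Pol_sum Pol_mult Pol_const Pol_hs)
qed

definition zz :: "complex fps" where "zz = 1 + 5 * fps_X"

text \<open>The quotient of \<open>Phi x Y - Phi (-1/5) Y\<close> by \<open>x + 1/5\<close>, scaled by \<open>625\<close>: it lowers the pole order at \<open>-1/5\<close>.\<close>

definition qz :: "nat \<Rightarrow> complex fps" where
  "qz k = [1 + 5 * mcoef 4 fps_X - 25 * mcoef 3 fps_X + 125 * mcoef 2 fps_X - 625 * mcoef 1 fps_X,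
           - 5 - 25 * mcoef 4 fps_X + 125 * mcoef 3 fps_X - 625 * mcoef 2 fps_X,
           25 + 125 * mcoef 4 fps_X - 625 * mcoef 3 fps_X,
           - 125 - 625 * mcoef 4 fps_X,
           625] ! k"

lemma res_numeral:
  "c 1 Y = c (Suc 0) Y" "c 2 Y = c (Suc (Suc 0)) Y"
  "c 3 Y = c (Suc (Suc (Suc 0))) Y" "c 4 Y = c (Suc (Suc (Suc (Suc 0)))) Y"
  by (simp_all add: eval_nat_numeral)

text \<open>This is -3125 \<open>Phi (-1/5) Y\<close>. Because it is a pure fifth power, a pole at y
  = -1/5 is carried to Y = -1/5 and nowhere else, with five times the order.\<close>

lemma Phi_at_minus_fifth:
  "1 + 5 * mcoef 4 (Y :: 'a::idom) - 25 * mcoef 3 Y + 125 * mcoef 2 Y - 625 * mcoef 1 Y + 3125 * mcoef 0 Y = (1 + 5 * Y) ^ 5"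
  unfolding res_numeral mcoef.simps by algebra

lemma qz_norm: "qz 0 + 3125 * mcoef 0 fps_X = zz ^ 5"
  unfolding qz_def zz_def nth_Cons_0 by (rule Phi_at_minus_fifth)

lemma qz_list:
  "qz 1 = - 5 - 25 * mcoef 4 fps_X + 125 * mcoef 3 fps_X - 625 * mcoef 2 fps_X"
  "qz 2 = 25 + 125 * mcoef 4 fps_X - 625 * mcoef 3 fps_X"
  "qz 3 = - 125 - 625 * mcoef 4 fps_X" "qz 4 = 625"
  by (simp_all add: qz_def eval_nat_numeral(2,3))

lemma qz_0: "qz 0 = 1 + 5 * mcoef 4 fps_X - 25 * mcoef 3 fps_X + 125 * mcoef 2 fps_X - 625 * mcoef 1 fps_X"
  by (simp add: qz_def)

lemma zz_step_ring:
  fixes g0 g1 g2 g3 g4 u0 u1 u2 u3 u4 :: "'a::idom"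
  shows "(1 + 5 * g4 - 25 * g3 + 125 * g2 - 625 * g1) * (u0 + 5 * u1)
    + (- 5 - 25 * g4 + 125 * g3 - 625 * g2) * (u1 + 5 * u2) + (25 + 125 * g4 - 625 * g3) * (u2 + 5 * u3)
    + (- 125 - 625 * g4) * (u3 + 5 * u4) + 625 * (u4 + 5 * (g0 * u0 + g1 * u1 + g2 * u2 + g3 * u3 + g4 * u4))
    = (1 + 5 * g4 - 25 * g3 + 125 * g2 - 625 * g1 + 3125 * g0) * u0"
  by algebra

lemma inverse_zz_ring:
  fixes g1 g2 g3 g4 c0 c1 c2 c3 c4 h5 h6 h7 h8 :: "'a::idom"
  assumes h: "h5 = g4" "h6 = g3 + g4 * h5" "h7 = g2 + g3 * h5 + g4 * h6"
    "h8 = g1 + g2 * h5 + g3 * h6 + g4 * h7"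
  shows "(1 + 5 * g4 - 25 * g3 + 125 * g2 - 625 * g1) * c4
    + (- 5 - 25 * g4 + 125 * g3 - 625 * g2) * (c3 + c4 * h5) + (25 + 125 * g4 - 625 * g3) * (c2 + c3 * h5 + c4 * h6)
    + (- 125 - 625 * g4) * (c1 + c2 * h5 + c3 * h6 + c4 * h7) + 625 * (c0 + c1 * h5 + c2 * h6 + c3 * h7 + c4 * h8)
    = 625 * c0 - 125 * c1 + 25 * c2 - 5 * c3 + c4"
  unfolding h by algebra

text \<open>This is 625 times \<open>evx res0\<close> at x = -1/5. Its factor cancels four of the
  five powers of 1 + 5Y in \<open>uop_inverse_zz\<close>; for \<open>res1\<close> only two cancel.
  The exponents 1 and 3 that remain are the increments in \<open>psi_Suc\<close>.\<close>

lemma res0_at_minus_fifth: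
  "625 * res0 0 (Y :: 'a::idom) - 125 * res0 1 Y + 25 * res0 2 Y - 5 * res0 3 Y + res0 4 Y = 5 * (1 + 5 * Y) ^ 4"
  unfolding res_numeral res0.simps by algebra

lemma res1_at_minus_fifth:
  "625 * res1 0 (Y :: 'a::idom) - 125 * res1 1 Y + 25 * res1 2 Y - 5 * res1 3 Y + res1 4 Y
    = 5 * (1 + 5 * Y) ^ 2 * (1 + 11 * Y + 55 * Y ^ 2 + 100 * Y ^ 3)"
  unfolding res_numeral res1.simps by algebra

text \<open>Modulo \<open>Phi x Y\<close>, the product of 1 + 5x and the sum of \<open>qz k\<close>
  x^k equals (1 + 5Y)^5, so one factor inside the operator is traded for five outside.\<close>

lemma zz_step: "zz ^ 5 * uop c h = (\<Sum>k<5. qz k * uop c (fps_X ^ k * (zz * h)))"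
proof -
  define u where "u k = uop c (fps_X ^ k * h)" for k
  have *: "uop c (fps_X ^ k * (zz * h)) = u k + 5 * u (k + 1)" for k
  proof -
    have "fps_X ^ k * (zz * h) = fps_X ^ k * h + fps_const 5 * (fps_X ^ (k + 1) * h)"
      by (simp add: zz_def algebra_simps numeral_fps_const)
    then show ?thesis by (simp add: u_def uop_add uop_cmult numeral_fps_const)
  qed
  have u5: "u 5 = mcoef 0 fps_X * u 0 + mcoef 1 fps_X * u 1 + mcoef 2 fps_X * u 2 + mcoef 3 fps_X * u 3 + mcoef 4 fps_X * u 4"
    unfolding u_def uop_module sum_lessThan_5 ..
  have "(\<Sum>k<5. qz k * uop c (fps_X ^ k * (zz * h))) =
      qz 0 * (u 0 + 5 * u 1) + qz 1 * (u 1 + 5 * u 2) + qz 2 * (u 2 + 5 * u 3) + qz 3 * (u 3 + 5 * u 4) + qz 4 * (u 4 + 5 * u 5)"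
    unfolding sum_lessThan_5 * by (simp add: eval_nat_numeral(2,3))
  also have "\<dots> = (qz 0 + 3125 * mcoef 0 fps_X) * u 0"
    unfolding u5 qz_list qz_0 by (rule zz_step_ring)
  finally show ?thesis unfolding qz_norm by (simp add: u_def)
qed

lemma hs_values:
  "hs Y 4 = 1" "hs Y 5 = mcoef 4 Y" "hs Y 6 = mcoef 3 Y + mcoef 4 Y * hs Y 5"
  "hs Y 7 = mcoef 2 Y + mcoef 3 Y * hs Y 5 + mcoef 4 Y * hs Y 6"
  "hs Y 8 = mcoef 1 Y + mcoef 2 Y * hs Y 5 + mcoef 3 Y * hs Y 6 + mcoef 4 Y * hs Y 7"
  using hs_add_5[of Y 0] hs_add_5[of Y 1] hs_add_5[of Y 2] hs_add_5[of Y 3]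
  by (simp_all add: sum_lessThan_5 hs_small)

text \<open>The formal counterpart of the partial fraction expansion of c / \<open>Phi\<close> taken
  at x = -1/5; the right side is 625 c(-1/5).\<close>

lemma uop_inverse_zz:
  "zz ^ 5 * uop c (inverse zz) = 625 * c 0 fps_X - 125 * c 1 fps_X + 25 * c 2 fps_X - 5 * c 3 fps_X + c 4 fps_X"
proof -
  have nz: "fps_nth zz 0 \<noteq> 0" by (simp add: zz_def)
  have p: "pw c X 0 = c 4 X" "pw c X 1 = c 3 X + c 4 X * hs X 5"
    "pw c X 2 = c 2 X + c 3 X * hs X 5 + c 4 X * hs X 6"
    "pw c X 3 = c 1 X + c 2 X * hs X 5 + c 3 X * hs X 6 + c 4 X * hs X 7"
    "pw c X 4 = c 0 X + c 1 X * hs X 5 + c 2 X * hs X 6 + c 3 X * hs X 7 + c 4 X * hs X 8"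
    for X :: "complex fps"
    unfolding pw_def sum_lessThan_5 by (simp_all add: hs_values(1) hs_small)
  have "zz ^ 5 * uop c (inverse zz) = (\<Sum>k<5. qz k * pw c fps_X k)"
    unfolding zz_step inverse_mult_eq_1'[OF nz] by (simp add: uop_X_power)
  also have "\<dots> = 625 * c 0 fps_X - 125 * c 1 fps_X + 25 * c 2 fps_X - 5 * c 3 fps_X + c 4 fps_X"
    unfolding sum_lessThan_5 qz_list qz_0 p by (rule inverse_zz_ring[OF hs_values(2-5)])
  finally show ?thesis .
qed

lemma zz_cancel: "zz ^ k * f = zz ^ k * g \<Longrightarrow> f = g"
proof -
  have "zz \<noteq> 0" by (auto simp: zz_def fps_eq_iff intro!: exI[of _ 0])
  then show "zz ^ k * f = zz ^ k * g \<Longrightarrow> f = g" by simp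
qed

lemma uop_res0_inverse_zz: "zz * uop res0 (inverse zz) = 5"
proof (rule zz_cancel[of 4])
  have eq: "zz ^ 4 * (zz * uop res0 (inverse zz)) = zz ^ 5 * uop res0 (inverse zz)"
    by (simp add: eval_nat_numeral mult_ac)
  show "zz ^ 4 * (zz * uop res0 (inverse zz)) = zz ^ 4 * 5"
    unfolding eq uop_inverse_zz res0_at_minus_fifth zz_def[symmetric] by (rule mult.commute)
qed

lemma uop_res1_inverse_zz:
  "zz ^ 3 * uop res1 (inverse zz) = 5 * (1 + 11 * fps_X + 55 * fps_X ^ 2 + 100 * fps_X ^ 3)"
proof (rule zz_cancel[of 2])
  have eq: "zz ^ 2 * (zz ^ 3 * uop res1 (inverse zz)) = zz ^ 5 * uop res1 (inverse zz)"
    by (simp add: eval_nat_numeral mult_ac)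
  show "zz ^ 2 * (zz ^ 3 * uop res1 (inverse zz))
      = zz ^ 2 * (5 * (1 + 11 * fps_X + 55 * fps_X ^ 2 + 100 * fps_X ^ 3))"
    unfolding eq uop_inverse_zz res1_at_minus_fifth zz_def[symmetric] by (simp only: mult_ac)
qed

lemma Pol_zz: "Pol zz" unfolding zz_def by (intro Pol_intros)

lemma Pol_qz: "k < 5 \<Longrightarrow> Pol (qz k)"
  unfolding qz_def
  by (drule less_5_cases) (elim disjE; hypsubst; simp; intro Pol_intros Pol_mcoef; simp)

text \<open>A pole of order m + 1 is first reduced to a simple one by m applications of
  \<open>zz_step\<close>, each costing five powers of \<open>zz\<close>; the simple pole costs
  b.\<close>

lemma Pol_uop:
  assumes c: "\<And>j. j < 5 \<Longrightarrow> Pol (c j fps_X)"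
    and base: "Pol (zz ^ b * uop c (inverse zz))"
    and "Pol (zz ^ Suc m * h)"
  shows "Pol (zz ^ (5 * m + b) * uop c h)"
  using assms(3)
proof (induction m arbitrary: h)
  case 0
  have nz: "fps_nth zz 0 \<noteq> 0" by (simp add: zz_def)
  obtain p where p: "zz * h = fps_of_poly p" using 0 by (auto simp: Pol_def)
  \<comment> \<open>Splitting off the value at -1/5 writes h as a polynomial plus a constant
    multiple of \<open>inverse zz\<close>, the two cases already handled.\<close>
  define q where "q = synthetic_div p (- 1 / 5)"
  have "p = [:1 / 5, 1:] * q + [:poly p (- 1 / 5):]"
    unfolding q_def using synthetic_div_correct'[of "- 1 / 5" p] by simp
  then have "fps_of_poly p = fps_of_poly [:1 / 5, 1:] * fps_of_poly q + fps_of_poly [:poly p (- 1 / 5):]"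
    by (metis fps_of_poly_add fps_of_poly_mult)
  moreover have "fps_of_poly [:1 / 5, 1:] = fps_const (1 / 5) * zz"
    by (simp add: fps_of_poly_pCons zz_def algebra_simps numeral_fps_const flip: fps_const_mult)
  ultimately have "zz * h = fps_const (1 / 5) * (zz * fps_of_poly q) + fps_const (poly p (- 1 / 5))"
    unfolding p by (simp add: fps_of_poly_const mult_ac)
  then have "inverse zz * (zz * h) = inverse zz * (zz * (fps_const (1 / 5) * fps_of_poly q)) + fps_const (poly p (- 1 / 5)) * inverse zz"
    by (simp add: algebra_simps)
  then have h: "h = fps_const (1 / 5) * fps_of_poly q + fps_const (poly p (- 1 / 5)) * inverse zz"
    by (simp only: mult.assoc[symmetric] inverse_mult_eq_1[OF nz] mult_1)
  have "zz ^ b * uop c h = fps_const (1 / 5) * (zz ^ b * uop c (fps_of_poly q))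
      + fps_const (poly p (- 1 / 5)) * (zz ^ b * uop c (inverse zz))"
    unfolding h uop_add uop_cmult by (simp add: algebra_simps)
  then show ?case
    using base Pol_uop_poly[where c = c and f = "fps_of_poly q", OF c]
    by (auto intro!: Pol_intros Pol_zz simp: Pol_def[of "fps_of_poly q"])
next
  case (Suc m)
  have "zz ^ (5 * Suc m + b) * uop c h = zz ^ (5 * m + b) * (zz ^ 5 * uop c h)"
    by (simp add: power_add mult_ac)
  also have "\<dots> = (\<Sum>k<5. qz k * (zz ^ (5 * m + b) * uop c (fps_X ^ k * (zz * h))))"
    unfolding zz_step by (simp add: sum_distrib_left mult_ac)
  finally have eq: "zz ^ (5 * Suc m + b) * uop c h = (\<Sum>k<5. qz k * (zz ^ (5 * m + b) * uop c (fps_X ^ k * (zz * h))))" .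
  have "Pol (zz ^ Suc m * (fps_X ^ k * (zz * h)))" for k
    using Pol_mult[OF Pol_power[OF Pol_X] Suc.prems, of k] by (simp add: mult_ac)
  from Pol_sum[of "{..<5}", OF Pol_mult[OF Pol_qz Suc.IH[OF this]]] show ?case unfolding eq by simp
qed

section \<open>Growth of the divisibility by 5 under the operators\<close>

definition tho :: "nat \<Rightarrow> nat" where "tho n = (n + 2) div 5"
definition the5 :: "nat \<Rightarrow> nat" where "the5 n = (n + 4) div 5"

lemma dv_uop:
  assumes "\<And>n. dv (a + t n) (fps_nth h n)"
    and "\<And>n r. n \<le> 5 * r + 4 \<Longrightarrow> dv (k n r) (fps_nth (pw c fps_X n) r)"
    and "\<And>n r. n \<le> 5 * r + 4 \<Longrightarrow> t' r + 1 \<le> t n + k n r"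
  shows "dv (Suc a + t' r) (fps_nth (uop c h) r)"
  unfolding uop_def fps_nth_Abs_fps
proof (rule dv_sum)
  fix n assume "n \<in> {..5 * r + 4}"
  then have n: "n \<le> 5 * r + 4" by simp
  have "dv ((a + t n) + k n r) (fps_nth h n * fps_nth (pw c fps_X n) r)"
    by (intro dv_mult assms n)
  then show "dv (Suc a + t' r) (fps_nth h n * fps_nth (pw c fps_X n) r)"
    by (rule dv_mono) (use assms(3)[OF n] in simp)
qed

text \<open>At n = 5r + 4, where the row entry is prime to 5, the coefficient of h brings
  \<open>tho n\<close> = r + 1 extra factors, enough for \<open>the5 r + 1\<close>. For smaller n
  the row entry contributes the ceiling of (5r + 4 - n) / 6 and makes up for the smaller
  \<open>tho n\<close>.\<close>

lemma dv_uop_res0: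
  assumes "\<And>n. dv (a + tho n) (fps_nth h n)"
  shows "dv (Suc a + the5 r) (fps_nth (uop res0 h) r)"
proof (rule dv_uop[OF assms])
  fix n r :: nat assume n: "n \<le> 5 * r + 4"
  define k where "k = nat ((5 * int r - (int n - 4) + 5) div 6)"
  show "dv (if n = 5 * r + 4 then 0 else max 1 k) (fps_nth (pw res0 fps_X n) r)"
    using wt_pw_res0[of n] dv_pw_res0[of n r] wt_imp_integral[OF wt_pw_res0[of n], of r]
    unfolding wt_def k_def max_def by auto
  show "the5 r + 1 \<le> tho n + (if n = 5 * r + 4 then 0 else max 1 k)"
  proof (cases "n = 5 * r + 4")
    case True
    then show ?thesis unfolding the5_def tho_def by simp
  next
    case False
    define K where "K = max 1 k"
    have "6 * k + 5 \<ge> 5 * r + 9 - n" using n unfolding k_def by linarith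
    then have "6 * K + n \<ge> 5 * r + 4" "K \<ge> 1" unfolding K_def by linarith+
    then have "the5 r + 1 \<le> tho n + K" unfolding the5_def tho_def by linarith
    then show ?thesis using False by (simp add: K_def)
  qed
qed

text \<open>The entries prime to 5 now lie at n = 5r + 1 and n = 5r + 2. Since \<open>the5\<close>
  rounds n / 5 up, it equals r + 1 at both, which covers \<open>tho r + 1\<close>.\<close>

lemma dv_uop_res1:
  assumes "\<And>n. dv (a + the5 n) (fps_nth h n)"
  shows "dv (Suc a + tho r) (fps_nth (uop res1 h) r)"
proof (rule dv_uop[OF assms])
  fix n r :: nat assume n: "n \<le> 5 * r + 4"
  define k where "k = nat ((5 * int r - (int n - 1) + 5) div 6)"
  show "dv (if n = 5 * r + 1 \<or> n = 5 * r + 2 then 0 else max 1 k) (fps_nth (pw res1 fps_X n) r)"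
    using wt_pw_res1[of n] dv_pw_res1[of n r] wt_imp_integral[OF wt_pw_res1[of n], of r]
    unfolding wt_def k_def max_def by auto
  show "tho r + 1 \<le> the5 n + (if n = 5 * r + 1 \<or> n = 5 * r + 2 then 0 else max 1 k)"
  proof (cases "n = 5 * r + 1 \<or> n = 5 * r + 2")
    case True
    then show ?thesis unfolding the5_def tho_def by auto
  next
    case False
    define K where "K = max 1 k"
    have "6 * k + 5 \<ge> 5 * r + 6 - n" using n unfolding k_def by linarith
    then have "6 * K + n \<ge> 5 * r + 1" "K \<ge> 1" unfolding K_def by linarith+
    then have "tho r + 1 \<le> the5 n + K" unfolding the5_def tho_def by linarith
    then show ?thesis using False by (simp add: K_def)
  qed
qed

section \<open>The series H and their integral numerators\<close>

definition gr :: "complex fps \<Rightarrow> bool" where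
  "gr f \<longleftrightarrow> (\<forall>n. dv n (fps_nth f n))"

lemma gr_mult:
  assumes "gr f" "gr g" shows "gr (f * g)"
  unfolding gr_def fps_mult_nth
proof (intro allI dv_sum)
  fix n i :: nat assume "i \<in> {0..n}"
  then show "dv n (fps_nth f i * fps_nth g (n - i))"
    using dv_mult[of i "fps_nth f i" "n - i" "fps_nth g (n - i)"] assms by (simp add: gr_def)
qed

lemma inverse_zz_nth: "fps_nth (inverse zz) n = (- 5) ^ n"
proof -
  have "zz * Abs_fps (\<lambda>n. (- 5) ^ n) = 1"
  proof (rule fps_ext)
    fix n show "fps_nth (zz * Abs_fps (\<lambda>n. (- 5) ^ n)) n = fps_nth 1 n"
      by (cases n) (auto simp: zz_def distrib_right numeral_fps_const mult.assoc)
  qed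
  then have "inverse zz = Abs_fps (\<lambda>n. (- 5) ^ n)"
    using fps_inverse_unique by blast
  then show ?thesis by simp
qed

lemma gr_inverse_zz: "gr (inverse zz)"
  unfolding gr_def inverse_zz_nth dv_def
proof
  fix n show "\<exists>i. (- 5) ^ n = complex_of_int (5 ^ n * i)"
    by (rule exI[of _ "(- 1) ^ n"]) (simp flip: power_mult_distrib)
qed

lemma gr_power: "gr f \<Longrightarrow> gr (f ^ k)"
proof (induction k)
  case 0
  show ?case by (auto simp: gr_def fps_one_nth dv_1)
qed (auto intro: gr_mult)

text \<open>\<open>Hq a\<close> belongs to alpha = a + 1, hence even a, that is odd alpha, is
  followed by \<open>res0\<close>. The initial value is the sum over the five roots computed in
  \<open>eventually_sum_initial\<close>.\<close>

primrec Hq :: "nat \<Rightarrow> complex fps" where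
  "Hq 0 = 5 * ((24 + 265 * fps_X + 1350 * fps_X ^ 2 + 2500 * fps_X ^ 3) * inverse zz ^ 3)"
| "Hq (Suc a) = uop (if even a then res0 else res1) (Hq a)"

text \<open>\<open>gr\<close> singles out the integral power series in 5X. As
  \<open>inverse zz\<close> is one too, the initial series starts with more divisibility than
  \<open>tho\<close> asks for.\<close>

lemma gr_initial: "gr (24 + 265 * fps_X + 1350 * fps_X ^ 2 + 2500 * fps_X ^ 3)"
  unfolding gr_def
proof
  fix n :: nat
  consider "n = 0" | "n = 1" | "n = 2" | "n = 3" | "n > 3" by linarith
  then show "dv n (fps_nth (24 + 265 * fps_X + 1350 * fps_X ^ 2 + 2500 * fps_X ^ 3) n)"
    by cases (auto simp: numeral_fps_const fps_X_power_nth intro!: dv_numeral)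
qed

lemma dv_Hq: "dv (Suc a + (if even a then tho n else the5 n)) (fps_nth (Hq a) n)"
proof (induction a arbitrary: n)
  case 0
  have "dv n (fps_nth ((24 + 265 * fps_X + 1350 * fps_X ^ 2 + 2500 * fps_X ^ 3) * inverse zz ^ 3) n)"
    using gr_mult[OF gr_initial gr_power[OF gr_inverse_zz, of 3]] by (simp add: gr_def)
  then have "dv (1 + n) (5 * fps_nth ((24 + 265 * fps_X + 1350 * fps_X ^ 2 + 2500 * fps_X ^ 3) * inverse zz ^ 3) n)"
    by (intro dv_mult dv_numeral) auto
  then have "dv (1 + tho n) (5 * fps_nth ((24 + 265 * fps_X + 1350 * fps_X ^ 2 + 2500 * fps_X ^ 3) * inverse zz ^ 3) n)"
    by (rule dv_mono) (simp add: tho_def)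
  then show ?case by (simp add: numeral_fps_const[of "num.Bit1 (num.Bit0 num.One)"])
next
  case (Suc a)
  show ?case
  proof (cases "even a")
    case True
    then show ?thesis using dv_uop_res0[of "Suc a" "Hq a" n] Suc.IH by simp
  next
    case False
    then show ?thesis using dv_uop_res1[of "Suc a" "Hq a" n] Suc.IH by simp
  qed
qed

text \<open>The powers of 5 are alternately 1 and 5 modulo 12. Multiplication by five therefore
  carries 0 or 2 into the quotient, and the final + 1 turns this into 1 or 3.\<close>

lemma psi_Suc: "psi (Suc (Suc a)) = 5 * (psi (Suc a) - 1) + (if even a then 1 else 3)"
proof -
  have ex: "\<exists>j. (5::nat) ^ (2 * k) = 12 * j + 1" for k
  proof (induction k)
    case (Suc k)
    then obtain j where "(5::nat) ^ (2 * k) = 12 * j + 1" by blast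
    then have "(5::nat) ^ (2 * Suc k) = 12 * (25 * j + 2) + 1" by simp
    then show ?case by blast
  qed simp
  show ?thesis
  proof (cases "even a")
    case True
    then obtain k where "a = 2 * k" by (elim evenE)
    moreover obtain j where "(5::nat) ^ (2 * k) = 12 * j + 1" using ex by blast
    moreover have "(125 + 1500 * j) div 12 = 125 * j + 10" "(25 + 300 * j) div 12 = 25 * j + 2"
      by (rule div_nat_eqI; simp)+
    ultimately show ?thesis by (simp add: psi_def)
  next
    case False
    then obtain k where "a = 2 * k + 1" by (elim oddE)
    moreover obtain j where "(5::nat) ^ (2 * k) = 12 * j + 1" using ex by blast
    moreover have "(625 + 7500 * j) div 12 = 625 * j + 52" "(125 + 1500 * j) div 12 = 125 * j + 10"
      by (rule div_nat_eqI; simp)+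
    ultimately show ?thesis by (simp add: psi_def)
  qed
qed

lemma Pol_Hq: "Pol (zz ^ psi (Suc a) * Hq a)"
proof (induction a)
  case 0
  have nz: "fps_nth zz 0 \<noteq> 0" by (simp add: zz_def)
  have "zz ^ 3 * inverse zz ^ 3 = 1"
    by (simp flip: power_mult_distrib add: inverse_mult_eq_1'[OF nz])
  moreover have "zz ^ 3 * Hq 0 = 5 * (24 + 265 * fps_X + 1350 * fps_X ^ 2 + 2500 * fps_X ^ 3) * (zz ^ 3 * inverse zz ^ 3)"
    by (simp only: Hq.simps mult_ac)
  ultimately have "zz ^ 3 * Hq 0 = 5 * (24 + 265 * fps_X + 1350 * fps_X ^ 2 + 2500 * fps_X ^ 3)"
    by simp
  moreover have "psi (Suc 0) = 3" by (simp add: psi_def)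
  ultimately show ?case by (simp only:) (intro Pol_intros)
next
  case (Suc a)
  have s: "psi (Suc a) = Suc (psi (Suc a) - 1)" by (simp add: psi_def)
  have IH: "Pol (zz ^ Suc (psi (Suc a) - 1) * Hq a)" using Suc s by simp
  show ?case
  proof (cases "even a")
    case True
    have "Pol (zz ^ 1 * uop res0 (inverse zz))" unfolding power_one_right uop_res0_inverse_zz by (rule Pol_intros)
    from Pol_uop[where c = res0, OF Pol_res0 this IH] show ?thesis using True by (simp add: psi_Suc)
  next
    case False
    have "Pol (zz ^ 3 * uop res1 (inverse zz))" unfolding uop_res1_inverse_zz by (intro Pol_intros)
    from Pol_uop[where c = res1, OF Pol_res1 this IH] show ?thesis using False by (simp add: psi_Suc)
  qed
qed

lemma dv_mult_fps:
  assumes "\<And>n. dv j (fps_nth f n)" "\<And>n. dv k (fps_nth g n)"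
  shows "dv (j + k) (fps_nth (f * g) n)"
  unfolding fps_mult_nth by (intro dv_sum dv_mult assms)

lemma dv_power_fps: "(\<And>n. dv 0 (fps_nth f n)) \<Longrightarrow> dv 0 (fps_nth (f ^ k) n)"
proof (induction k arbitrary: n)
  case 0
  then show ?case by (simp add: fps_one_nth dv_1)
next
  case (Suc k)
  then show ?case using dv_mult_fps[of 0 f 0 "f ^ k"] by simp
qed

text \<open>Here the two tracks meet: \<open>Pol_Hq\<close> makes the product a polynomial and
  \<open>dv_Hq\<close> makes its coefficients integers divisible by the power of 5. The factor X(1 +
  4X) is D y / F.\<close>

lemma int_poly_Hq:
  "\<exists>P :: int poly. fps_X * (1 + 4 * fps_X) * zz ^ psi (Suc a) * Hq a = fps_const (5 ^ Suc a) * fps_of_poly (map_poly of_int P)"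
proof -
  have "Pol (fps_X * (1 + 4 * fps_X) * (zz ^ psi (Suc a) * Hq a))"
    by (intro Pol_mult Pol_Hq Pol_intros)
  then obtain p where p: "fps_X * (1 + 4 * fps_X) * (zz ^ psi (Suc a) * Hq a) = fps_of_poly p"
    by (auto simp: Pol_def)
  have "dv (0 + (0 + Suc a)) (fps_nth (fps_X * (1 + 4 * fps_X) * (zz ^ psi (Suc a) * Hq a)) n)" for n
  proof (intro dv_mult_fps dv_power_fps)
    show "dv 0 (fps_nth (fps_X * (1 + 4 * fps_X)) n)" for n
      using dv_mult_fps[of 0 fps_X 0 "1 + 4 * fps_X" n]
      by (auto simp: fps_one_nth fps_X_nth dv_1 numeral_fps_const dv_numeral intro!: dv_add)
    show "dv 0 (fps_nth zz n)" for n
      by (auto simp: zz_def fps_one_nth fps_X_nth dv_1 numeral_fps_const dv_numeral intro!: dv_add)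
    show "dv (Suc a) (fps_nth (Hq a) n)" for n
      by (rule dv_mono[OF dv_Hq]) simp
  qed
  then have "dv (Suc a) (coeff p n)" for n unfolding p by simp
  then obtain i where i: "\<And>n. coeff p n = of_int (5 ^ Suc a * i n)"
    unfolding dv_def by metis
  \<comment> \<open>The quotients i n vanish for large n because the coefficients of p do, so they
    form a polynomial.\<close>
  define P where "P = Abs_poly i"
  have "\<forall>\<^sub>\<infinity>n. i n = 0"
    using MOST_coeff_eq_0[of p] by (rule MOST_mono) (simp add: i)
  then have "coeff P n = i n" for n by (simp add: P_def Abs_poly_inverse)
  then have "p = smult (5 ^ Suc a) (map_poly of_int P)"
    by (intro poly_eqI) (simp add: i coeff_map_poly)
  then show ?thesis
    using p by (intro exI[of _ P]) (simp add: mult.assoc fps_of_poly_smult)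
qed

section \<open>Every fifth coefficient\<close>

definition usec :: "complex fps \<Rightarrow> complex fps" where
  "usec f = Abs_fps (\<lambda>n. fps_nth f (5 * n))"

lemma usec_nth [simp]: "fps_nth (usec f) n = fps_nth f (5 * n)"
  by (simp add: usec_def)

lemma usec_add: "usec (f + g) = usec f + usec g"
  by (rule fps_ext) simp

lemma usec_cmult: "usec (fps_const a * f) = fps_const a * usec f"
  by (rule fps_ext) simp

lemma usec_sum: "usec (\<Sum>i\<in>A. f i) = (\<Sum>i\<in>A. usec (f i))"
  by (rule fps_ext) (simp add: fps_sum_nth)

lemma fps_compose_X_power_nth:
  fixes f :: "complex fps"
  assumes "k > 0"
  shows "fps_nth (f oo fps_X ^ k) n = (if k dvd n then fps_nth f (n div k) else 0)"
proof -
  have "fps_nth (f oo fps_X ^ k) n = (\<Sum>i=0..n. if n = k * i then fps_nth f i else 0)"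
    unfolding fps_compose_nth power_mult[symmetric] fps_X_power_nth by (intro sum.cong) auto
  also have "\<dots> = (if k dvd n then fps_nth f (n div k) else 0)"
  proof (cases "k dvd n")
    case True
    then obtain m where m: "n = k * m" by auto
    have "(\<Sum>i=0..n. if n = k * i then fps_nth f i else 0) = (\<Sum>i=0..n. if m = i then fps_nth f i else 0)"
      using assms m by (intro sum.cong) auto
    then show ?thesis using assms m by simp
  next
    case False
    then show ?thesis by (auto intro!: sum.neutral)
  qed
  finally show ?thesis .
qed

text \<open>The projection formula for U: a series in q^5 can be taken out and loses its fifth
  power. It moves the eta factors through U.\<close>

lemma usec_compose_mult: "usec ((f oo fps_X ^ 5) * g) = f * usec g"
proof (rule fps_ext)
  fix n
  have "fps_nth (usec ((f oo fps_X ^ 5) * g)) n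
      = (\<Sum>i=0..5 * n. (if 5 dvd i then fps_nth f (i div 5) else 0) * fps_nth g (5 * n - i))"
    by (simp add: fps_mult_nth fps_compose_X_power_nth)
  also have "\<dots> = (\<Sum>i\<in>(\<lambda>i. 5 * i) ` {0..n}. (if 5 dvd i then fps_nth f (i div 5) else 0) * fps_nth g (5 * n - i))"
    by (rule sum.mono_neutral_right) (auto simp: image_iff elim!: dvdE)
  also have "\<dots> = (\<Sum>i=0..n. fps_nth f i * fps_nth g (5 * n - 5 * i))"
    by (subst sum.reindex) (auto simp: inj_on_def)
  finally show "fps_nth (usec ((f oo fps_X ^ 5) * g)) n = fps_nth (f * usec g) n"
    by (simp add: fps_mult_nth diff_mult_distrib2)
qed

text \<open>Extends the formula for the monomials Y^n to all power series in Y. Coefficient by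
  coefficient only finitely many monomials matter, on either side.\<close>

lemma usec_uop:
  assumes Y0: "fps_nth Y 0 = 0"
    and base: "\<And>n. usec (Zf * Y ^ n * Df) = (pw c fps_X n oo Y) * Df"
  shows "usec (Zf * (h oo Y) * Df) = (uop c h oo Y) * Df"
proof (rule fps_ext)
  fix N :: nat
  \<comment> \<open>Large enough for both sides: Y^M has order above 5 N, so it cannot affect
    coefficient 5 N before U is applied, and rows from M on exceed 5 r + 4 for every r up to
    N.\<close>
  define M where "M = 5 * N + 5"
  define h1 where "h1 = (\<Sum>i<M. fps_const (fps_nth h i) * fps_X ^ i)"
  define h2 where "h2 = fps_shift M h"
  have h: "h = h1 + fps_X ^ M * h2"
  proof (rule fps_ext)
    fix n
    have "fps_nth h1 n = (if n < M then fps_nth h n else 0)"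
      unfolding h1_def fps_sum_nth by (simp add: fps_X_power_nth if_distrib[of "\<lambda>x. _ * x"] cong: if_cong)
    then show "fps_nth h n = fps_nth (h1 + fps_X ^ M * h2) n"
      by (simp add: h2_def fps_X_power_mult_nth)
  qed
  have c1: "(h oo Y) = (\<Sum>i<M. fps_const (fps_nth h i) * Y ^ i) + Y ^ M * (h2 oo Y)"
  proof -
    have "(h oo Y) = (h1 oo Y) + (fps_X ^ M oo Y) * (h2 oo Y)"
      by (subst h) (simp add: fps_compose_add_distrib fps_compose_mult_distrib[OF Y0])
    moreover have "fps_X ^ M oo Y = Y ^ M"
      by (simp add: fps_compose_power[OF Y0, symmetric] Y0)
    moreover have "h1 oo Y = (\<Sum>i<M. fps_const (fps_nth h i) * Y ^ i)"
      unfolding h1_def fps_compose_sum_distrib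
      by (intro sum.cong refl) (simp add: fps_compose_mult_distrib[OF Y0] fps_compose_power[OF Y0, symmetric] Y0)
    ultimately show ?thesis by simp
  qed
  have vanish: "fps_nth (Y ^ m * g) n = 0" if "n < m" for m n g
  proof -
    have "Y = fps_X * fps_shift 1 Y"
    proof (rule fps_ext)
      fix n show "fps_nth Y n = fps_nth (fps_X * fps_shift 1 Y) n" using Y0 by (cases n) simp_all
    qed
    then obtain S where Y: "Y = fps_X * S" by blast
    have "Y ^ m * g = fps_X ^ m * (S ^ m * g)" unfolding Y by (simp only: power_mult_distrib mult.assoc)
    then show ?thesis using that by (simp only: fps_X_power_mult_nth if_True)
  qed
  have lhs: "fps_nth (usec (Zf * (h oo Y) * Df)) N
      = fps_nth (\<Sum>i<M. fps_const (fps_nth h i) * ((pw c fps_X i oo Y) * Df)) N"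
  proof -
    have "Zf * (h oo Y) * Df = (\<Sum>i<M. fps_const (fps_nth h i) * (Zf * Y ^ i * Df)) + Y ^ M * (Zf * (h2 oo Y) * Df)"
      unfolding c1 by (simp only: distrib_left distrib_right sum_distrib_left sum_distrib_right mult_ac)
    then have "usec (Zf * (h oo Y) * Df) = (\<Sum>i<M. fps_const (fps_nth h i) * ((pw c fps_X i oo Y) * Df))
        + usec (Y ^ M * (Zf * (h2 oo Y) * Df))"
      by (simp only: usec_add usec_sum usec_cmult base)
    moreover have "fps_nth (usec (Y ^ M * (Zf * (h2 oo Y) * Df))) N = 0"
      unfolding usec_nth by (rule vanish) (simp add: M_def)
    ultimately show ?thesis by simp
  qed
  have "fps_nth (uop c (fps_X ^ M * h2)) r = 0" if "r < Suc N" for r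
    unfolding uop_def fps_nth_Abs_fps fps_X_power_mult_nth using that
    by (intro sum.neutral) (auto simp: M_def)
  then have "uop c (fps_X ^ M * h2) = fps_X ^ Suc N * fps_shift (Suc N) (uop c (fps_X ^ M * h2))"
    by (intro fps_ext) (simp only: fps_X_power_mult_nth fps_shift_nth split: if_split, simp)
  then obtain w where w: "uop c (fps_X ^ M * h2) = fps_X ^ Suc N * w" by blast
  have "uop c h = uop c h1 + uop c (fps_X ^ M * h2)"
    by (subst h) (rule uop_add)
  then have u: "uop c h = (\<Sum>i<M. fps_const (fps_nth h i) * pw c fps_X i) + fps_X ^ Suc N * w"
    unfolding w h1_def uop_sum uop_cmult uop_X_power .
  have XN: "fps_X ^ Suc N oo Y = Y ^ Suc N"
    using fps_compose_power[OF Y0, of fps_X "Suc N"] Y0 by (simp del: power_Suc)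
  have "(uop c h oo Y) = (\<Sum>i<M. fps_const (fps_nth h i) * (pw c fps_X i oo Y)) + Y ^ Suc N * (w oo Y)"
    unfolding u
    by (simp only: fps_compose_add_distrib fps_compose_mult_distrib[OF Y0] fps_compose_sum_distrib
        fps_const_compose XN)
  then have "(uop c h oo Y) * Df = (\<Sum>i<M. fps_const (fps_nth h i) * ((pw c fps_X i oo Y) * Df)) + Y ^ Suc N * ((w oo Y) * Df)"
    by (simp only: distrib_left distrib_right sum_distrib_left sum_distrib_right mult_ac)
  then show "fps_nth (usec (Zf * (h oo Y) * Df)) N = fps_nth ((uop c h oo Y) * Df) N"
    unfolding lhs using vanish[of N "Suc N" "(w oo Y) * Df"] by (simp only: fps_add_nth lessI add_0_right)
qed

section \<open>Theta functions and the five-dissection\<close>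

definition pp :: "complex \<Rightarrow> complex" where
  "pp z = (\<Prod>m. 1 - z ^ Suc m)"

definition qf :: "complex \<Rightarrow> nat \<Rightarrow> complex" where
  "qf x n = (\<Prod>m<n. 1 - x ^ Suc m)"

definition tri :: "nat \<Rightarrow> nat" where "tri n = n * (n + 1) div 2"

lemma tri_0 [simp]: "tri 0 = 0" and tri_Suc [simp]: "tri (Suc n) = tri n + Suc n"
  by (simp_all add: tri_def)

lemma two_tri: "2 * tri n = n * (n + 1)"
  by (simp add: tri_def)

text \<open>The two-sided series of z^n x^(n(n+1)/2) over all integers n; the index -(n + 1) has the
  same triangular exponent as n.\<close>

definition theta :: "complex \<Rightarrow> complex \<Rightarrow> complex" where
  "theta z x = (\<Sum>n. z ^ n * x ^ tri n) + (\<Sum>n. (1 / z) ^ Suc n * x ^ tri n)"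

lemma pp_power: "pp (z ^ k) = (\<Prod>m. 1 - z ^ (k * Suc m))"
  by (simp only: pp_def power_mult)

lemma norm_power_less_1: "norm (z::complex) < 1 \<Longrightarrow> k > 0 \<Longrightarrow> norm (z ^ k) < 1"
  by (simp add: norm_power power_less_one_iff)

lemma qf_tendsto: "norm x < 1 \<Longrightarrow> qf x \<longlonglongrightarrow> pp x"
  using has_prod_1_minus_power(2)[of x 1] unfolding qf_def[abs_def] pp_def by simp

lemma pp_nonzero: "norm x < 1 \<Longrightarrow> pp x \<noteq> 0"
  using has_prod_1_minus_power(3)[of x 1] unfolding pp_def by simp

lemma qf_nonzero: "norm x < 1 \<Longrightarrow> qf x n \<noteq> 0"
  unfolding qf_def by (auto dest: power_neq_1_of_norm_less_1[of x "Suc _"] simp del: power_Suc)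

lemma qf_Suc: "qf x (Suc n) = qf x n * (1 - x ^ Suc n)"
  by (simp add: qf_def)

lemma sum_atMost_Suc_split:
  "(\<Sum>j\<le>Suc M. f j) = f 0 + (\<Sum>j<M. f (Suc j)) + (f (Suc M) :: complex)"
  by (induction M) auto

text \<open>The finite q-binomial theorem; \<open>tri j - j\<close> is j(j-1)/2 and the quotient of
  \<open>qf\<close> is a Gaussian binomial coefficient.\<close>

lemma q_binomial:
  assumes x: "norm x < 1"
  shows "(\<Prod>k<M. 1 + t * x ^ k) = (\<Sum>j\<le>M. x ^ (tri j - j) * t ^ j * (qf x M / (qf x j * qf x (M - j))))"
proof (induction M)
  case 0
  show ?case by (simp add: qf_def)
next
  case (Suc M)
  note nz = qf_nonzero[OF x]
  define B where "B M j = qf x M / (qf x j * qf x (M - j))" for M j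
  define a where "a j = x ^ (tri j - j) * t ^ j" for j
  have a_Suc: "a (Suc j) = a j * t * x ^ j" for j
  proof -
    have "tri j \<ge> j" by (induction j) auto
    then show ?thesis by (simp add: a_def mult_ac flip: power_add)
  qed
  \<comment> \<open>The q-Pascal rule.\<close>
  have B_Suc: "B (Suc M) (Suc j) = B M (Suc j) + x ^ (M - j) * B M j" if "j < M" for j
  proof -
    obtain d where d: "M = Suc (j + d)" using \<open>j < M\<close> by (auto dest: less_imp_Suc_add)
    have "Suc M - Suc j = Suc d" "M - Suc j = d" "M - j = Suc d" using d by auto
    then have "B (Suc M) (Suc j) = qf x M * (1 - x ^ Suc M) / (qf x j * (1 - x ^ Suc j) * (qf x d * (1 - x ^ Suc d)))"
      "B M (Suc j) = qf x M / (qf x j * (1 - x ^ Suc j) * qf x d)"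
      "B M j = qf x M / (qf x j * (qf x d * (1 - x ^ Suc d)))"
      by (simp_all only: B_def qf_Suc)
    moreover have "x ^ Suc M = x ^ Suc j * x ^ Suc d" using d by (simp add: power_add)
    moreover have "1 - x ^ Suc j \<noteq> 0" "1 - x ^ Suc d \<noteq> 0"
      using power_neq_1_of_norm_less_1[OF x] by blast+
    ultimately show ?thesis using nz \<open>M - j = Suc d\<close>
      by (simp only:) (simp add: divide_simps del: power_Suc, simp add: algebra_simps)
  qed
  have B0: "B M 0 = 1" "B M M = 1" for M using nz by (simp_all add: B_def qf_def)
  have "(\<Prod>k<Suc M. 1 + t * x ^ k) = (\<Sum>j\<le>M. a j * B M j) * (1 + t * x ^ M)"
    using Suc by (simp add: a_def B_def)
  also have "\<dots> = (\<Sum>j\<le>M. a j * B M j) + (\<Sum>j\<le>M. a j * t * x ^ M * B M j)"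
    unfolding distrib_left mult_1_right sum_distrib_right by (simp add: mult_ac)
  also have "(\<Sum>j\<le>M. a j * t * x ^ M * B M j) = (\<Sum>j\<le>M. a (Suc j) * x ^ (M - j) * B M j)"
  proof (intro sum.cong refl)
    fix j assume "j \<in> {..M}"
    then have "x ^ M = x ^ j * x ^ (M - j)" by (simp flip: power_add)
    then show "a j * t * x ^ M * B M j = a (Suc j) * x ^ (M - j) * B M j" by (simp add: a_Suc)
  qed
  also have "(\<Sum>j\<le>M. a (Suc j) * x ^ (M - j) * B M j) = (\<Sum>j<M. a (Suc j) * x ^ (M - j) * B M j) + a (Suc M)"
    by (simp add: B0 flip: lessThan_Suc_atMost)
  also have "(\<Sum>j\<le>M. a j * B M j) = a 0 + (\<Sum>j<M. a (Suc j) * B M (Suc j))"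
    by (simp add: B0 sum.lessThan_Suc_shift del: sum.lessThan_Suc flip: lessThan_Suc_atMost)
  also have "a 0 + (\<Sum>j<M. a (Suc j) * B M (Suc j)) + ((\<Sum>j<M. a (Suc j) * x ^ (M - j) * B M j) + a (Suc M))
      = a 0 + (\<Sum>j<M. a (Suc j) * (B M (Suc j) + x ^ (M - j) * B M j)) + a (Suc M)"
    by (simp add: sum.distrib distrib_left mult.assoc)
  also have "\<dots> = a 0 + (\<Sum>j<M. a (Suc j) * B (Suc M) (Suc j)) + a (Suc M)"
    by (simp add: B_Suc)
  also have "\<dots> = (\<Sum>j\<le>Suc M. a j * B (Suc M) j)"
    unfolding sum_atMost_Suc_split by (simp add: B0)
  finally show ?case by (simp add: a_def B_def)
qed

lemma summable_theta:
  assumes x: "norm (x::complex) < 1"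
  shows "summable (\<lambda>n. norm (z ^ n * x ^ tri n))"
proof -
  have "(\<lambda>n. norm z * norm x ^ Suc n) \<longlonglongrightarrow> norm z * 0"
    by (rule tendsto_mult[OF tendsto_const LIMSEQ_Suc[OF LIMSEQ_power_zero]]) (use x in simp)
  then have "eventually (\<lambda>n. norm z * norm x ^ Suc n < 1 / 2) sequentially"
    using order_tendstoD(2)[OF \<open>_ \<longlonglongrightarrow> _\<close>, of "1 / 2"] by (simp del: power_Suc)
  then obtain N where N: "\<And>n. n \<ge> N \<Longrightarrow> norm z * norm x ^ Suc n < 1 / 2"
    by (auto simp: eventually_sequentially)
  show ?thesis
  proof (rule summable_ratio_test[of "1 / 2" N])
    fix n assume n: "n \<ge> N"
    have "norm (norm (z ^ Suc n * x ^ tri (Suc n))) = (norm z * norm x ^ Suc n) * norm (z ^ n * x ^ tri n)"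
      by (simp add: norm_mult norm_power power_add mult_ac)
    also have "\<dots> \<le> 1 / 2 * norm (z ^ n * x ^ tri n)"
      using N[OF n] by (intro mult_right_mono) auto
    finally show "norm (norm (z ^ Suc n * x ^ tri (Suc n))) \<le> 1 / 2 * norm (norm (z ^ n * x ^ tri n))" by simp
  qed simp
qed

lemma summable_theta_Suc:
  assumes x: "norm (x::complex) < 1"
  shows "summable (\<lambda>n. norm (z ^ Suc n * x ^ tri n))"
  using summable_mult[OF summable_theta[OF x, of z], of "norm z"] by (simp add: norm_mult mult_ac)

text \<open>The q-binomial theorem with 2N factors, centred at the middle index. The summation index
  j becomes N + n or N - Suc n, which separates the two halves of the theta series.\<close>

lemma jacobi_finite:
  assumes x: "norm x < 1" "x \<noteq> 0" and z: "z \<noteq> 0"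
  shows "(\<Prod>k<N. 1 + z * x ^ Suc k) * (\<Prod>k<N. 1 + (1 / z) * x ^ k)
    = (\<Sum>n\<le>N. z ^ n * x ^ tri n * (qf x (2 * N) / (qf x (N + n) * qf x (N - n))))
    + (\<Sum>n<N. (1 / z) ^ Suc n * x ^ tri n * (qf x (2 * N) / (qf x (N - Suc n) * qf x (N + Suc n))))"
proof -
  define B where "B j = qf x (2 * N) / (qf x j * qf x (2 * N - j))" for j
  \<comment> \<open>With this t the factors from N on are 1 + z x^(k+1). Those below N are 1 + z /
    x^k in reverse order, and become 1 + x^k / z once z / x^k is taken out.\<close>
  define t where "t = z * x / x ^ N"
  have tri_ge: "tri j \<ge> j" for j by (induction j) auto
  have P1: "(\<Prod>k<2 * N. 1 + t * x ^ k) = (\<Prod>k<N. 1 + t * x ^ k) * (\<Prod>k<N. 1 + z * x ^ Suc k)"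
  proof -
    have "(\<Prod>k<N + M. 1 + t * x ^ k) = (\<Prod>k<N. 1 + t * x ^ k) * (\<Prod>k<M. 1 + t * x ^ (N + k))" for M
      by (induction M) (simp_all add: mult.assoc)
    moreover have "t * x ^ (N + k) = z * x ^ Suc k" for k
      using x by (simp add: t_def power_add)
    ultimately show ?thesis by (simp only: mult_2)
  qed
  have P2: "(\<Prod>k<N. 1 + t * x ^ k) = (\<Prod>k<N. z / x ^ k) * (\<Prod>k<N. 1 + (1 / z) * x ^ k)"
  proof -
    have "(\<Prod>k<N. 1 + t * x ^ k) = (\<Prod>k<N. 1 + t * x ^ (N - Suc k))"
      by (rule prod.nat_diff_reindex[symmetric])
    also have "\<dots> = (\<Prod>k<N. (z / x ^ k) * (1 + (1 / z) * x ^ k))"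
    proof (rule prod.cong)
      fix k assume "k \<in> {..<N}"
      then obtain d where d: "N = Suc (k + d)" by (auto dest: less_imp_Suc_add)
      show "1 + t * x ^ (N - Suc k) = (z / x ^ k) * (1 + (1 / z) * x ^ k)"
        using x z by (simp add: t_def d power_add field_simps)
    qed simp
    finally show ?thesis by (simp only: prod.distrib)
  qed
  have P3: "(\<Prod>k<N. z / x ^ k) = z ^ N * x ^ N / x ^ tri N"
    by (induction N) (use x in \<open>simp_all add: field_simps power_add\<close>)
  have "(\<Prod>k<N. 1 + z * x ^ Suc k) * (\<Prod>k<N. 1 + (1 / z) * x ^ k)
      = (\<Prod>k<2 * N. 1 + t * x ^ k) * (x ^ tri N / (z ^ N * x ^ N))"
    unfolding P1 P2 P3 using x z by (simp add: field_simps)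
  also have "\<dots> = (\<Sum>j\<le>2 * N. x ^ (tri j - j) * t ^ j * B j * (x ^ tri N / (z ^ N * x ^ N)))"
    unfolding q_binomial[OF x(1)] B_def by (simp only: sum_distrib_right)
  also have "{..2 * N} = (\<lambda>n. N + n) ` {..N} \<union> (\<lambda>n. N - Suc n) ` {..<N}"
  proof (intro equalityI subsetI)
    fix j assume j: "j \<in> {..2 * N}"
    show "j \<in> (\<lambda>n. N + n) ` {..N} \<union> (\<lambda>n. N - Suc n) ` {..<N}"
    proof (cases "j \<ge> N")
      case True
      then show ?thesis using j by (intro UnI1 image_eqI[of _ _ "j - N"]) auto
    next
      case False
      then show ?thesis by (intro UnI2 image_eqI[of _ _ "N - Suc j"]) auto
    qed
  qed auto
  also have "(\<Sum>j\<in>(\<lambda>n. N + n) ` {..N} \<union> (\<lambda>n. N - Suc n) ` {..<N}. x ^ (tri j - j) * t ^ j * B j * (x ^ tri N / (z ^ N * x ^ N)))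
    = (\<Sum>j\<in>(\<lambda>n. N + n) ` {..N}. x ^ (tri j - j) * t ^ j * B j * (x ^ tri N / (z ^ N * x ^ N)))
    + (\<Sum>j\<in>(\<lambda>n. N - Suc n) ` {..<N}. x ^ (tri j - j) * t ^ j * B j * (x ^ tri N / (z ^ N * x ^ N)))"
    by (intro sum.union_disjoint) auto
  also have "(\<Sum>j\<in>(\<lambda>n. N + n) ` {..N}. x ^ (tri j - j) * t ^ j * B j * (x ^ tri N / (z ^ N * x ^ N)))
    = (\<Sum>n\<le>N. z ^ n * x ^ tri n * B (N + n))"
  proof (subst sum.reindex, simp, rule sum.cong)
    fix n
    have e: "tri (N + n) + tri N = tri n + N * (N + n) + N"
      using two_tri[of N] two_tri[of n] two_tri[of "N + n"] by (simp add: algebra_simps)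
    have t: "t ^ (N + n) = z ^ N * z ^ n * x ^ (N + n) / x ^ (N * (N + n))"
      by (simp only: t_def power_divide power_mult_distrib power_mult[symmetric] power_add[of z])
    have frac: "X1 * (zN * zn * Xa / Xb) * (T / (zN * XN)) = zn * (X1 * Xa * T) / (Xb * XN)"
      if "zN \<noteq> 0" for X1 zN zn Xa Xb T XN :: complex
      using that by simp
    have "x ^ (tri (N + n) - (N + n)) * t ^ (N + n) * (x ^ tri N / (z ^ N * x ^ N))
      = z ^ n * (x ^ (tri (N + n) - (N + n)) * x ^ (N + n) * x ^ tri N) / (x ^ (N * (N + n)) * x ^ N)"
      unfolding t by (rule frac) (use z in simp)
    also have "x ^ (tri (N + n) - (N + n)) * x ^ (N + n) * x ^ tri N = x ^ tri n * (x ^ (N * (N + n)) * x ^ N)"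
    proof -
      have "x ^ (tri (N + n) - (N + n)) * x ^ (N + n) = x ^ tri (N + n)"
        using tri_ge[of "N + n"] by (simp flip: power_add)
      then show ?thesis by (simp only: e mult.assoc add.assoc flip: power_add)
    qed
    finally have eq: "x ^ (tri (N + n) - (N + n)) * t ^ (N + n) * (x ^ tri N / (z ^ N * x ^ N)) = z ^ n * x ^ tri n"
      using x by simp
    have "((\<lambda>j. x ^ (tri j - j) * t ^ j * B j * (x ^ tri N / (z ^ N * x ^ N))) \<circ> (\<lambda>n. N + n)) n
      = x ^ (tri (N + n) - (N + n)) * t ^ (N + n) * (x ^ tri N / (z ^ N * x ^ N)) * B (N + n)"
      by (simp only: o_apply mult_ac)
    then show "((\<lambda>j. x ^ (tri j - j) * t ^ j * B j * (x ^ tri N / (z ^ N * x ^ N))) \<circ> (\<lambda>n. N + n)) n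
      = z ^ n * x ^ tri n * B (N + n)"
      by (simp only: eq)
  qed simp
  also have "(\<Sum>j\<in>(\<lambda>n. N - Suc n) ` {..<N}. x ^ (tri j - j) * t ^ j * B j * (x ^ tri N / (z ^ N * x ^ N)))
    = (\<Sum>n<N. (1 / z) ^ Suc n * x ^ tri n * B (N - Suc n))"
  proof (subst sum.reindex)
    show "inj_on (\<lambda>n. N - Suc n) {..<N}" by (auto simp: inj_on_def)
    show "(\<Sum>n<N. ((\<lambda>j. x ^ (tri j - j) * t ^ j * B j * (x ^ tri N / (z ^ N * x ^ N))) \<circ> (\<lambda>n. N - Suc n)) n)
      = (\<Sum>n<N. (1 / z) ^ Suc n * x ^ tri n * B (N - Suc n))"
    proof (rule sum.cong)
      fix n assume "n \<in> {..<N}"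
      then obtain j where j: "N = j + Suc n" by (auto dest!: less_imp_Suc_add simp: add.commute)
      have e: "tri j + tri N = tri n + N * j + N"
        using two_tri[of j] two_tri[of n] two_tri[of N] unfolding j by (simp add: algebra_simps)
      have "x ^ (tri j - j) * t ^ j * (x ^ tri N / (z ^ N * x ^ N))
        = (z ^ j / z ^ N) * (x ^ (tri j - j) * x ^ j * x ^ tri N) / (x ^ (N * j) * x ^ N)"
        by (simp add: t_def power_divide power_mult_distrib power_mult[symmetric] mult_ac)
      also have "x ^ (tri j - j) * x ^ j * x ^ tri N = x ^ tri n * (x ^ (N * j) * x ^ N)"
      proof -
        have "x ^ (tri j - j) * x ^ j = x ^ tri j"
          using tri_ge[of j] by (simp flip: power_add)
        then show ?thesis by (simp only: e mult.assoc add.assoc flip: power_add)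
      qed
      also have "z ^ j / z ^ N = (1 / z) ^ Suc n"
        unfolding j using z by (simp add: power_add power_divide field_simps)
      finally have eq: "x ^ (tri j - j) * t ^ j * (x ^ tri N / (z ^ N * x ^ N)) = (1 / z) ^ Suc n * x ^ tri n"
        using x by simp
      have "N - Suc n = j" using j by simp
      then have "((\<lambda>j. x ^ (tri j - j) * t ^ j * B j * (x ^ tri N / (z ^ N * x ^ N))) \<circ> (\<lambda>n. N - Suc n)) n
        = x ^ (tri j - j) * t ^ j * (x ^ tri N / (z ^ N * x ^ N)) * B (N - Suc n)"
        by (simp only: o_apply mult_ac)
      then show "((\<lambda>j. x ^ (tri j - j) * t ^ j * B j * (x ^ tri N / (z ^ N * x ^ N))) \<circ> (\<lambda>n. N - Suc n)) n
        = (1 / z) ^ Suc n * x ^ tri n * B (N - Suc n)"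
        by (simp only: eq)
    qed simp
  qed
  also have "(\<Sum>n\<le>N. z ^ n * x ^ tri n * B (N + n)) = (\<Sum>n\<le>N. z ^ n * x ^ tri n * (qf x (2 * N) / (qf x (N + n) * qf x (N - n))))"
    by (intro sum.cong) (auto simp: B_def)
  also have "(\<Sum>n<N. (1 / z) ^ Suc n * x ^ tri n * B (N - Suc n))
    = (\<Sum>n<N. (1 / z) ^ Suc n * x ^ tri n * (qf x (2 * N) / (qf x (N - Suc n) * qf x (N + Suc n))))"
  proof (intro sum.cong refl)
    fix n assume "n \<in> {..<N}"
    then have "2 * N - (N - Suc n) = N + Suc n" by auto
    then show "(1 / z) ^ Suc n * x ^ tri n * B (N - Suc n)
      = (1 / z) ^ Suc n * x ^ tri n * (qf x (2 * N) / (qf x (N - Suc n) * qf x (N + Suc n)))"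
      by (simp only: B_def)
  qed
  finally show ?thesis .
qed

definition pf :: "complex \<Rightarrow> complex \<Rightarrow> complex" where
  "pf t x = (\<Prod>k. 1 + t * x ^ k)"

lemma pf_tendsto:
  assumes x: "norm x < 1"
  shows "(\<lambda>N. \<Prod>k<N. 1 + t * x ^ k) \<longlonglongrightarrow> pf t x"
proof -
  have "summable (\<lambda>k. norm (t * x ^ k))"
    using x by (simp add: norm_mult norm_power summable_mult)
  then have "convergent_prod (\<lambda>k. 1 + t * x ^ k)"
    by (intro abs_convergent_prod_imp_convergent_prod summable_imp_abs_convergent_prod) simp
  then show ?thesis
    using convergent_prod_LIMSEQ unfolding pf_def by (subst LIMSEQ_lessThan_iff_atMost)
qed

text \<open>Provides the uniform majorant for Tannery's theorem: \<open>qf x\<close> converges to a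
  nonzero limit, so it and its inverse are bounded.\<close>

lemma qf_bound:
  assumes x: "norm x < 1"
  obtains K where "\<And>m n k. norm (qf x m / (qf x n * qf x k)) \<le> K"
proof -
  note lim = qf_tendsto[OF x]
  have "Bseq (qf x)" "Bseq (\<lambda>n. inverse (qf x n))"
    using convergent_imp_Bseq[OF convergentI[OF lim]]
      convergent_imp_Bseq[OF convergentI[OF tendsto_inverse[OF lim pp_nonzero[OF x]]]] by simp_all
  then obtain A B where A: "A > 0" "\<And>n. norm (qf x n) \<le> A" and B: "B > 0" "\<And>n. norm (inverse (qf x n)) \<le> B"
    by (auto elim!: BseqE)
  have "norm (qf x m / (qf x n * qf x k)) \<le> A * (B * B)" for m n k
  proof -
    have "norm (qf x m / (qf x n * qf x k)) = norm (qf x m) * (norm (inverse (qf x n)) * norm (inverse (qf x k)))"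
      by (simp add: norm_mult norm_divide norm_inverse divide_inverse)
    also have "\<dots> \<le> A * (B * B)" using A B by (intro mult_mono) (auto simp: less_imp_le)
    finally show ?thesis .
  qed
  then show ?thesis by (rule that)
qed

lemma jacobi_triple:
  assumes x: "norm x < 1" "x \<noteq> 0" and z: "z \<noteq> 0"
  shows "pp x * pf (z * x) x * pf (1 / z) x = theta z x"
proof -
  note lim = qf_tendsto[OF x(1)] and nz = pp_nonzero[OF x(1)]
  obtain K where K: "\<And>m n k. norm (qf x m / (qf x n * qf x k)) \<le> K" using qf_bound[OF x(1)] by blast
  have K0: "K \<ge> 0" using K[of 0 0 0] norm_ge_zero order_trans by blast
  \<comment> \<open>One statement for both half sums: terms beyond the cutoff f N are set to 0, and
    each Gaussian binomial tends to pp / (pp pp).\<close>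
  have half: "(\<lambda>N. \<Sum>n<f N. u n * (qf x (2 * N) / (qf x (g n N) * qf x (h n N)))) \<longlonglongrightarrow> (\<Sum>n. u n * (1 / pp x))"
    if u: "summable (\<lambda>n. norm (u n))" and f: "filterlim f at_top sequentially"
      and g: "\<And>n. filterlim (g n) at_top sequentially" and h: "\<And>n. filterlim (h n) at_top sequentially"
    for u :: "nat \<Rightarrow> complex" and f :: "nat \<Rightarrow> nat" and g h :: "nat \<Rightarrow> nat \<Rightarrow> nat"
  proof -
    define a where "a n N = (if n < f N then u n * (qf x (2 * N) / (qf x (g n N) * qf x (h n N))) else 0)" for n N
    have "(\<lambda>N. a n N) \<longlonglongrightarrow> u n * (1 / pp x)" for n
    proof -
      have "(\<lambda>N. u n * (qf x (2 * N) / (qf x (g n N) * qf x (h n N)))) \<longlonglongrightarrow> u n * (pp x / (pp x * pp x))"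
        by (intro tendsto_mult tendsto_divide tendsto_const filterlim_compose[OF lim] g h mult_nat_left_at_top)
           (use nz in auto)
      moreover have "eventually (\<lambda>N. a n N = u n * (qf x (2 * N) / (qf x (g n N) * qf x (h n N)))) sequentially"
        using filterlim_at_top[THEN iffD1, OF f, rule_format, of "Suc n"] by eventually_elim (simp add: a_def)
      ultimately show ?thesis using nz by (simp add: tendsto_cong)
    qed
    moreover have "norm (a n N) \<le> K * norm (u n)" for n N
    proof -
      have "norm (u n * (qf x (2 * N) / (qf x (g n N) * qf x (h n N)))) \<le> norm (u n) * K"
        unfolding norm_mult[of "u n"] by (intro mult_left_mono K) simp
      then show ?thesis using K0 by (simp only: a_def mult.commute split: if_split) simp
    qed
    ultimately have "(\<lambda>N. suminf (\<lambda>n. a n N)) \<longlonglongrightarrow> (\<Sum>n. u n * (1 / pp x))"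
      by (intro tannerys_theorem[where M = "\<lambda>n. K * norm (u n)", THEN conjunct2, THEN conjunct2] always_eventually summable_mult u) auto
    moreover have "suminf (\<lambda>n. a n N) = (\<Sum>n<f N. u n * (qf x (2 * N) / (qf x (g n N) * qf x (h n N))))" for N
    proof -
      have "suminf (\<lambda>n. a n N) = (\<Sum>n<f N. a n N)"
        by (rule suminf_finite) (auto simp: a_def)
      then show ?thesis by (simp add: a_def)
    qed
    ultimately show ?thesis by simp
  qed
  have "(\<lambda>N. (\<Sum>n<Suc N. z ^ n * x ^ tri n * (qf x (2 * N) / (qf x (N + n) * qf x (N - n))))
      + (\<Sum>n<N. (1 / z) ^ Suc n * x ^ tri n * (qf x (2 * N) / (qf x (N - Suc n) * qf x (N + Suc n)))))
      \<longlonglongrightarrow> (\<Sum>n. z ^ n * x ^ tri n * (1 / pp x)) + (\<Sum>n. (1 / z) ^ Suc n * x ^ tri n * (1 / pp x))"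
    by (intro tendsto_add half summable_theta summable_theta_Suc x filterlim_Suc filterlim_ident
        filterlim_add_const_nat_at_top filterlim_minus_const_nat_at_top)
  moreover have "(\<Sum>n. z ^ n * x ^ tri n * (1 / pp x)) + (\<Sum>n. (1 / z) ^ Suc n * x ^ tri n * (1 / pp x)) = theta z x * (1 / pp x)"
    unfolding theta_def distrib_right
    by (intro arg_cong2[where f = "(+)"] suminf_mult2[symmetric] summable_norm_cancel[OF summable_theta]
        summable_norm_cancel[OF summable_theta_Suc] x)
  ultimately have "(\<lambda>N. (\<Prod>k<N. 1 + z * x ^ Suc k) * (\<Prod>k<N. 1 + (1 / z) * x ^ k)) \<longlonglongrightarrow> theta z x * (1 / pp x)"
    unfolding jacobi_finite[OF x z] by (simp only: lessThan_Suc_atMost)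
  moreover have "(\<lambda>N. (\<Prod>k<N. 1 + z * x ^ Suc k) * (\<Prod>k<N. 1 + (1 / z) * x ^ k)) \<longlonglongrightarrow> pf (z * x) x * pf (1 / z) x"
    using tendsto_mult[OF pf_tendsto[OF x(1), of "z * x"] pf_tendsto[OF x(1), of "1 / z"]] by (simp add: mult.assoc)
  ultimately have "pf (z * x) x * pf (1 / z) x = theta z x * (1 / pp x)"
    using LIMSEQ_unique by blast
  then show ?thesis using nz by (simp add: field_simps)
qed

lemma suminf_split_5:
  fixes f :: "nat \<Rightarrow> complex"
  assumes f: "summable (\<lambda>n. norm (f n))"
  shows "(\<Sum>n. f n) = (\<Sum>r<5. \<Sum>m. f (5 * m + r))"
proof -
  have s: "summable (\<lambda>m. f (5 * m + r))" for r
  proof -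
    have "summable ((\<lambda>n. norm (f n)) \<circ> (\<lambda>m. 5 * m + r))"
      by (rule summable_reindex[OF f]) (auto intro: injI)
    then show ?thesis by (intro summable_norm_cancel[of "\<lambda>m. f (5 * m + r)"]) (simp add: o_def)
  qed
  have "(\<lambda>m. sum f {m * 5..<m * 5 + 5}) sums suminf f"
    by (rule sums_group) (use f in \<open>auto intro: summable_sums summable_norm_cancel\<close>)
  moreover have "sum f {m * 5..<m * 5 + 5} = (\<Sum>r<5. f (5 * m + r))" for m
    using sum.shift_bounds_nat_ivl[of f 0 "m * 5" 5] by (simp add: add.commute mult.commute atLeast0LessThan)
  ultimately have "(\<lambda>m. \<Sum>r<5. f (5 * m + r)) sums suminf f" by simp
  then have "suminf f = (\<Sum>m. \<Sum>r<5. f (5 * m + r))" by (simp add: sums_iff)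
  also have "\<dots> = (\<Sum>r<5. \<Sum>m. f (5 * m + r))" by (rule suminf_sum) (rule s)
  finally show ?thesis .
qed

text \<open>The reflection n to -1 - n of the two-sided index exchanges the two halves.\<close>

lemma theta_inverse: "z \<noteq> 0 \<Longrightarrow> norm x < 1 \<Longrightarrow> theta z x = theta (1 / z) x / z"
  unfolding theta_def
  using suminf_divide[OF summable_norm_cancel[OF summable_theta[of x "1 / z"]], of z]
    suminf_divide[OF summable_norm_cancel[OF summable_theta_Suc[of x z]], of z]
  by (simp add: add_divide_distrib mult_ac)

text \<open>Sorts the two-sided index by its residue r modulo 5. On the negative half the class r
  appears as \<open>Suc (5 * m + (4 - r))\<close>, because -(5m + 5 - r) = -5(m + 1) + r.\<close>

lemma theta_split_5:
  assumes x: "norm x < 1" "x \<noteq> 0" and z: "z \<noteq> 0"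
  shows "theta z x = (\<Sum>r<5. z ^ r * x ^ tri r * theta (z ^ 5 * x ^ (5 * r) / x ^ 10) (x ^ 25))"
proof -
  have x25: "norm (x ^ 25) < 1" using norm_power_less_1[OF x(1)] by simp
  have t1: "z ^ (5 * m + r) * x ^ tri (5 * m + r) = z ^ r * x ^ tri r * ((z ^ 5 * x ^ (5 * r) / x ^ 10) ^ m * (x ^ 25) ^ tri m)" for m r
  proof -
    have e: "tri (5 * m + r) + 10 * m = tri r + 5 * r * m + 25 * tri m"
      using two_tri[of "5 * m + r"] two_tri[of m] two_tri[of r] by (simp add: algebra_simps)
    have "x ^ tri (5 * m + r) * x ^ (10 * m) = x ^ tri r * x ^ (5 * r * m) * x ^ (25 * tri m)"
      by (simp only: e flip: power_add)
    then show ?thesis using x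
      by (simp add: power_divide power_mult_distrib power_add power_mult[symmetric] field_simps)
  qed
  have t2: "(1 / z) ^ Suc (5 * m + (4 - r)) * x ^ tri (5 * m + (4 - r))
      = z ^ r * x ^ tri r * ((1 / (z ^ 5 * x ^ (5 * r) / x ^ 10)) ^ Suc m * (x ^ 25) ^ tri m)" if "r < 5" for m r
  proof -
    obtain d where d: "r + d = 4" using \<open>r < 5\<close> by (metis add.commute le_add_diff_inverse2 less_Suc_eq_le eval_nat_numeral(3))
    then have d': "4 - r = d" by simp
    have e: "tri (5 * m + d) + 5 * r * Suc m = tri r + 10 * Suc m + 25 * tri m"
    proof -
      have "r = 4 - d" "d \<le> 4" using d by auto
      then have "d = 0 \<and> r = 4 \<or> d = 1 \<and> r = 3 \<or> d = 2 \<and> r = 2 \<or> d = 3 \<and> r = 1 \<or> d = 4 \<and> r = 0" by linarith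
      then have "2 * (tri (5 * m + d) + 5 * r * Suc m) = 2 * (tri r + 10 * Suc m + 25 * tri m)"
        using two_tri[of "5 * m + d"] two_tri[of m] two_tri[of r] by (auto simp: algebra_simps)
      then show ?thesis by simp
    qed
    have A: "x ^ tri (5 * m + d) * x ^ (5 * r * Suc m) = x ^ tri r * x ^ (10 * Suc m) * x ^ (25 * tri m)"
      by (simp only: e flip: power_add)
    have "5 * Suc m = Suc (5 * m + d) + r" using d by simp
    then have B: "z ^ (5 * Suc m) = z ^ Suc (5 * m + d) * z ^ r" by (simp only: power_add)
    have C: "(1 / (z ^ 5 * x ^ (5 * r) / x ^ 10)) ^ Suc m = x ^ (10 * Suc m) / (z ^ (5 * Suc m) * x ^ (5 * r * Suc m))"
      by (simp only: power_divide power_mult_distrib power_mult power_one divide_divide_eq_right mult_1)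
    have gen: "1 / Z1 * T = Zr * tr * (X10 / (Zs * R) * X25)"
      if "Zs = Z1 * Zr" "T * R = tr * X10 * X25" "Z1 \<noteq> 0" "Zr \<noteq> 0" "R \<noteq> 0" for Z1 T Zr tr X10 Zs R X25 :: complex
      using that by (simp add: field_simps)
    show ?thesis unfolding d' C unfolding power_one_over power_mult[symmetric, of x 25]
      by (rule gen[OF B A]) (use x z in simp_all)
  qed
  have "theta z x = (\<Sum>r<5. \<Sum>m. z ^ (5 * m + r) * x ^ tri (5 * m + r)) + (\<Sum>r<5. \<Sum>m. (1 / z) ^ Suc (5 * m + r) * x ^ tri (5 * m + r))"
    unfolding theta_def by (intro arg_cong2[where f = "(+)"] suminf_split_5 summable_theta summable_theta_Suc x)
  also have "(\<Sum>r<5. \<Sum>m. (1 / z) ^ Suc (5 * m + r) * x ^ tri (5 * m + r)) = (\<Sum>r<5. \<Sum>m. (1 / z) ^ Suc (5 * m + (4 - r)) * x ^ tri (5 * m + (4 - r)))"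
    using sum.nat_diff_reindex[of "\<lambda>r. \<Sum>m. (1 / z) ^ Suc (5 * m + r) * x ^ tri (5 * m + r)" 5] by simp
  also have "(\<Sum>r<5. \<Sum>m. z ^ (5 * m + r) * x ^ tri (5 * m + r)) + \<dots>
     = (\<Sum>r<5. z ^ r * x ^ tri r * theta (z ^ 5 * x ^ (5 * r) / x ^ 10) (x ^ 25))"
    unfolding sum.distrib[symmetric]
  proof (rule sum.cong)
    fix r :: nat assume r: "r \<in> {..<5}"
    then show "(\<Sum>m. z ^ (5 * m + r) * x ^ tri (5 * m + r)) + (\<Sum>m. (1 / z) ^ Suc (5 * m + (4 - r)) * x ^ tri (5 * m + (4 - r)))
      = z ^ r * x ^ tri r * theta (z ^ 5 * x ^ (5 * r) / x ^ 10) (x ^ 25)"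
      unfolding theta_def distrib_left
      by (simp only: t1 t2 lessThan_iff suminf_mult[OF summable_norm_cancel[OF summable_theta[OF x25]]]
          suminf_mult[OF summable_norm_cancel[OF summable_theta_Suc[OF x25]]])
  qed simp
  finally show ?thesis .
qed

section \<open>Product evaluations of special theta values\<close>

lemma pf_minus_eq_pp: "pf (- x) x = pp x"
  unfolding pf_def pp_def by simp

lemma pf_group:
  assumes x: "norm x < 1" and k: "k > 0"
  shows "pf t x = (\<Prod>i<k. pf (t * x ^ i) (x ^ k))"
proof -
  have "(\<lambda>N. \<Prod>m<N * k. 1 + t * x ^ m) \<longlonglongrightarrow> pf t x"
    using filterlim_compose[OF pf_tendsto[OF x, of t] mult_nat_right_at_top[OF k]] by simp
  moreover have "(\<Prod>m<N * k. 1 + t * x ^ m) = (\<Prod>i<k. \<Prod>m<N. 1 + (t * x ^ i) * (x ^ k) ^ m)" for N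
  proof -
    have "(\<Prod>m<N * k. 1 + t * x ^ m) = (\<Prod>m<N. prod (\<lambda>m. 1 + t * x ^ m) {m * k..<m * k + k})"
      by (rule prod.nat_group[symmetric])
    also have "\<dots> = (\<Prod>m<N. \<Prod>i<k. 1 + (t * x ^ i) * (x ^ k) ^ m)"
    proof (rule prod.cong)
      fix m
      have "prod (\<lambda>m. 1 + t * x ^ m) {m * k..<m * k + k} = (\<Prod>i=0..<k. 1 + t * x ^ (i + m * k))"
        using prod.shift_bounds_nat_ivl[of "\<lambda>m. 1 + t * x ^ m" 0 "m * k" k] by (simp add: add.commute)
      also have "\<dots> = (\<Prod>i<k. 1 + (t * x ^ i) * (x ^ k) ^ m)"
        by (intro prod.cong) (auto simp: power_add power_mult[symmetric] mult_ac)
      finally show "prod (\<lambda>m. 1 + t * x ^ m) {m * k..<m * k + k} = (\<Prod>i<k. 1 + (t * x ^ i) * (x ^ k) ^ m)" .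
    qed simp
    also have "\<dots> = (\<Prod>i<k. \<Prod>m<N. 1 + (t * x ^ i) * (x ^ k) ^ m)" by (rule prod.swap)
    finally show ?thesis .
  qed
  moreover have "(\<lambda>N. \<Prod>i<k. \<Prod>m<N. 1 + (t * x ^ i) * (x ^ k) ^ m) \<longlonglongrightarrow> (\<Prod>i<k. pf (t * x ^ i) (x ^ k))"
    by (intro tendsto_prod pf_tendsto norm_power_less_1 x k)
  ultimately show ?thesis using LIMSEQ_unique by simp
qed

lemma pf_first:
  assumes x: "norm x < 1" shows "pf t x = (1 + t) * pf (t * x) x"
proof -
  have "(\<lambda>N. (1 + t) * (\<Prod>k<N. 1 + t * x * x ^ k)) \<longlonglongrightarrow> (1 + t) * pf (t * x) x"
    by (intro tendsto_mult tendsto_const pf_tendsto x)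
  moreover have "(1 + t) * (\<Prod>k<N. 1 + t * x * x ^ k) = (\<Prod>k<Suc N. 1 + t * x ^ k)" for N
    by (simp add: prod.lessThan_Suc_shift mult.assoc del: prod.lessThan_Suc)
  ultimately have "(\<lambda>N. \<Prod>k<Suc N. 1 + t * x ^ k) \<longlonglongrightarrow> (1 + t) * pf (t * x) x" by simp
  then show ?thesis using LIMSEQ_Suc[OF pf_tendsto[OF x, of t]] LIMSEQ_unique by blast
qed

lemma pf_mult_minus:
  assumes x: "norm x < 1" shows "pf t x * pf (- t) x = pf (- (t ^ 2)) (x ^ 2)"
proof -
  have "(\<lambda>N. (\<Prod>k<N. 1 + t * x ^ k) * (\<Prod>k<N. 1 + (- t) * x ^ k)) \<longlonglongrightarrow> pf t x * pf (- t) x"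
    by (intro tendsto_mult pf_tendsto x)
  moreover have "(\<Prod>k<N. 1 + t * x ^ k) * (\<Prod>k<N. 1 + (- t) * x ^ k) = (\<Prod>k<N. 1 + (- (t ^ 2)) * (x ^ 2) ^ k)" for N
    unfolding prod.distrib[symmetric]
    by (intro prod.cong) (auto simp: algebra_simps power2_eq_square power_mult_distrib)
  ultimately show ?thesis
    using pf_tendsto[of "x ^ 2" "- (t ^ 2)"] norm_power_less_1[OF x, of 2] LIMSEQ_unique by fastforce
qed

lemma pf_pp: assumes x: "norm x < 1" shows "pf x x * pp x = pp (x ^ 2)"
  using pf_mult_minus[OF x, of x] by (simp add: pf_minus_eq_pp)

text \<open>Euler's pentagonal number theorem: the three factors of the triple product are the
  residue classes modulo 3 of \<open>pp q\<close>.\<close>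

lemma theta_pentagonal:
  assumes q: "norm q < 1" "q \<noteq> 0"
  shows "theta (- (1 / q)) (q ^ 3) = pp q"
proof -
  have q3: "norm (q ^ 3) < 1" using norm_power_less_1[OF q(1)] by simp
  have "theta (- (1 / q)) (q ^ 3) = pp (q ^ 3) * pf (- (1 / q) * q ^ 3) (q ^ 3) * pf (1 / (- (1 / q))) (q ^ 3)"
    by (rule jacobi_triple[symmetric]) (use q q3 in auto)
  also have "- (1 / q) * q ^ 3 = - q * q ^ 1" using q by (simp add: power3_eq_cube)
  also have "1 / (- (1 / q)) = - q * q ^ 0" using q by simp
  also have "pp (q ^ 3) = pf (- q * q ^ 2) (q ^ 3)"
    using pf_minus_eq_pp[of "q ^ 3"] by (simp add: power_Suc[symmetric] del: power_Suc)
  also have "pf (- q * q ^ 2) (q ^ 3) * pf (- q * q ^ 1) (q ^ 3) * pf (- q * q ^ 0) (q ^ 3) = (\<Prod>i<3. pf (- q * q ^ i) (q ^ 3))"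
    by (simp add: eval_nat_numeral mult_ac)
  also have "\<dots> = pf (- q) q" by (rule pf_group[OF q(1), symmetric]) simp
  finally show ?thesis by (simp only: pf_minus_eq_pp)
qed

text \<open>Gauss's product for the triangular numbers; the factor 2 arises because both halves of
  the series coincide at z = 1.\<close>

lemma theta_1:
  assumes q: "norm q < 1" "q \<noteq> 0"
  shows "theta 1 q = 2 * pp (q ^ 2) ^ 2 / pp q"
proof -
  have "theta 1 q = pp q * pf q q * pf 1 q"
    using jacobi_triple[OF q, of 1] by simp
  also have "pf 1 q = 2 * pf q q" using pf_first[OF q(1), of 1] by simp
  finally have "theta 1 q * pp q = 2 * (pf q q * pp q) ^ 2" by (simp add: power2_eq_square)
  then show ?thesis unfolding pf_pp[OF q(1)] using pp_nonzero[OF q(1)] by (simp add: field_simps)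
qed

text \<open>The first theta function contains the residue classes 2 and 3 modulo 5 of the product
  \<open>pf Q Q\<close>, the second one the classes 1 and 4; together only the multiples of 5 are
  missing.\<close>

lemma theta_product:
  assumes Q: "norm Q < 1" "Q \<noteq> 0"
  shows "theta (1 / Q ^ 2) (Q ^ 5) * theta (1 / Q) (Q ^ 5) = pp (Q ^ 5) ^ 3 * pp (Q ^ 2) / (pp Q * pp (Q ^ 10))"
proof -
  have Q5: "norm (Q ^ 5) < 1" using norm_power_less_1[OF Q(1)] by simp
  note nz = pp_nonzero[OF Q(1)] pp_nonzero[OF Q5] pp_nonzero[OF norm_power_less_1[OF Q5, of 2]]
  have "theta (1 / Q ^ 2) (Q ^ 5) = pp (Q ^ 5) * pf (1 / Q ^ 2 * Q ^ 5) (Q ^ 5) * pf (1 / (1 / Q ^ 2)) (Q ^ 5)"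
    by (rule jacobi_triple[symmetric]) (use Q Q5 in auto)
  also have "1 / Q ^ 2 * Q ^ 5 = Q * Q ^ 2" using Q by (simp add: eval_nat_numeral)
  also have "1 / (1 / Q ^ 2) = Q * Q ^ 1" by (simp add: power2_eq_square)
  finally have 1: "theta (1 / Q ^ 2) (Q ^ 5) = pp (Q ^ 5) * pf (Q * Q ^ 2) (Q ^ 5) * pf (Q * Q ^ 1) (Q ^ 5)" .
  have "theta (1 / Q) (Q ^ 5) = pp (Q ^ 5) * pf (1 / Q * Q ^ 5) (Q ^ 5) * pf (1 / (1 / Q)) (Q ^ 5)"
    by (rule jacobi_triple[symmetric]) (use Q Q5 in auto)
  also have "1 / Q * Q ^ 5 = Q * Q ^ 3" using Q by (simp add: eval_nat_numeral)
  also have "1 / (1 / Q) = Q * Q ^ 0" by simp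
  finally have 2: "theta (1 / Q) (Q ^ 5) = pp (Q ^ 5) * pf (Q * Q ^ 3) (Q ^ 5) * pf (Q * Q ^ 0) (Q ^ 5)" .
  have "pf Q Q = (\<Prod>i<5. pf (Q * Q ^ i) (Q ^ 5))" by (rule pf_group[OF Q(1)]) simp
  also have "\<dots> = pf (Q * Q ^ 0) (Q ^ 5) * pf (Q * Q ^ 1) (Q ^ 5) * pf (Q * Q ^ 2) (Q ^ 5) * pf (Q * Q ^ 3) (Q ^ 5) * pf (Q * Q ^ 4) (Q ^ 5)"
    by (simp add: eval_nat_numeral mult_ac)
  also have "Q * Q ^ 4 = Q ^ 5" by (simp add: eval_nat_numeral)
  finally have 3: "pf Q Q = pf (Q * Q ^ 0) (Q ^ 5) * pf (Q * Q ^ 1) (Q ^ 5) * pf (Q * Q ^ 2) (Q ^ 5) * pf (Q * Q ^ 3) (Q ^ 5) * pf (Q ^ 5) (Q ^ 5)" .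
  have 4: "pf (Q ^ 5) (Q ^ 5) * pp (Q ^ 5) = pp (Q ^ 10)" using pf_pp[OF Q5] by (simp flip: power_mult)
  have 5: "pf Q Q * pp Q = pp (Q ^ 2)" by (rule pf_pp[OF Q(1)])
  have "theta (1 / Q ^ 2) (Q ^ 5) * theta (1 / Q) (Q ^ 5) * (pp Q * pp (Q ^ 10)) = pp (Q ^ 5) ^ 3 * (pf Q Q * pp Q)"
    unfolding 1 2 3 4[symmetric] by (simp add: eval_nat_numeral mult_ac)
  then show ?thesis unfolding 5 using nz by (simp add: field_simps flip: power_mult)
qed

section \<open>The five-dissections and the Rogers-Ramanujan fraction\<close>

definition AA :: "complex \<Rightarrow> complex" where
  "AA Q = theta (- (1 / Q ^ 7)) (Q ^ 15) - Q ^ 3 * theta (- (Q ^ 2)) (Q ^ 15)"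

definition BB :: "complex \<Rightarrow> complex" where
  "BB Q = Q * theta (- (1 / Q)) (Q ^ 15) - theta (- (1 / Q ^ 4)) (Q ^ 15)"

text \<open>Pentagonal exponents are 0, 1 or 2 modulo 5: \<open>AA\<close> and \<open>BB\<close>
  collect the classes 0 and 2, two theta functions each, and the remaining one is again pentagonal,
  in q^25.\<close>

lemma pp_dissect:
  assumes q: "norm q < 1" "q \<noteq> 0"
  shows "pp q = AA (q ^ 5) - q * pp (q ^ 25) + q ^ 2 * BB (q ^ 5)"
proof -
  have q3: "norm (q ^ 3) < 1" "q ^ 3 \<noteq> 0" using norm_power_less_1[OF q(1)] q by simp_all
  have q25: "norm (q ^ 25) < 1" "q ^ 25 \<noteq> 0" using norm_power_less_1[OF q(1)] q by simp_all
  have q75: "norm (q ^ 75) < 1" "q ^ 75 \<noteq> 0" using norm_power_less_1[OF q(1)] q by simp_all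
  have e: "(- (1 / q)) ^ 5 * (q ^ 3) ^ (5 * r) / (q ^ 3) ^ 10 = - (q ^ (15 * r) / q ^ 35)" for r
    using q by (simp add: power_divide power_mult[symmetric] field_simps flip: power_add)
  have p: "(q ^ 5) ^ 15 = q ^ 75" "(q ^ 3) ^ 25 = q ^ 75" "(q ^ 25) ^ 3 = q ^ 75" "(q ^ 5) ^ 7 = q ^ 35" "(q ^
      5) ^ 4 = q ^ 20" "(q ^ 5) ^ 2 = q ^ 10" "(q ^ 5) ^ 3 = q ^ 15"
    by (simp_all flip: power_mult)
  have d: "q ^ 15 / q ^ 35 = 1 / q ^ 20" "q ^ 30 / q ^ 35 = 1 / q ^ 5" "q ^ 45 / q ^ 35 = q ^ 10" "q ^ 60 / q ^ 35 = q ^ 25"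
    using q power_add[of q 15 20] power_add[of q 30 5] power_add[of q 35 10] power_add[of q 35 25] by (simp_all add: field_simps)
  have t: "tri 0 = 0" "tri 1 = 1" "tri 2 = 3" "tri 3 = 6" "tri 4 = 10" by (simp_all add: tri_def)
  have c: "(- (1 / q)) ^ 1 * (q ^ 3) ^ 1 = - (q ^ 2)" "(- (1 / q)) ^ 2 * (q ^ 3) ^ 3 = q ^ 7"
    "(- (1 / q)) ^ 3 * (q ^ 3) ^ 6 = - (q ^ 15)" "(- (1 / q)) ^ 4 * (q ^ 3) ^ 10 = q ^ 26"
    using q by (simp_all add: power_divide field_simps flip: power_add power_mult power_Suc)
  have last: "theta (- (q ^ 25)) (q ^ 75) = - (pp (q ^ 25) / q ^ 25)"
    using theta_inverse[of "- (q ^ 25)" "q ^ 75"] theta_pentagonal[OF q25] q q75 by (simp add: p)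
  have "pp q = theta (- (1 / q)) (q ^ 3)" by (rule theta_pentagonal[OF q, symmetric])
  also have "\<dots> = theta (- (1 / q ^ 35)) (q ^ 75) + - (q ^ 2) * theta (- (1 / q ^ 20)) (q ^ 75) + q ^ 7 * theta (- (1 / q ^ 5)) (q ^ 75)
      + - (q ^ 15) * theta (- (q ^ 10)) (q ^ 75) + q ^ 26 * theta (- (q ^ 25)) (q ^ 75)"
    using q theta_split_5[OF q3, of "- (1 / q)"]
    unfolding sum_lessThan_5 t e p c[symmetric] d[symmetric] by simp
  also have "\<dots> = AA (q ^ 5) - q * pp (q ^ 25) + q ^ 2 * BB (q ^ 5)"
  proof -
    have "q ^ 26 * (pp (q ^ 25) / q ^ 25) = q * pp (q ^ 25)" using q by (simp add: eval_nat_numeral)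
    moreover have "q ^ 7 = q ^ 2 * q ^ 5" by (simp flip: power_add)
    ultimately show ?thesis unfolding last AA_def BB_def p by (simp add: algebra_simps)
  qed
  finally show ?thesis .
qed

text \<open>The left side is Ramanujan's psi function, not the exponent \<open>psi\<close>. By
  \<open>theta_inverse\<close> the residues r and 4 - r give equal contributions, so a factor 2
  cancels throughout.\<close>

lemma psi_dissect:
  assumes q: "norm q < 1" "q \<noteq> 0"
  shows "pp (q ^ 2) ^ 2 / pp q = theta (1 / (q ^ 5) ^ 2) ((q ^ 5) ^ 5) + q * theta (1 / q ^ 5) ((q ^ 5) ^ 5) + q ^ 3 * (pp (q ^ 50) ^ 2 / pp (q ^ 25))"
proof -
  have q25: "norm (q ^ 25) < 1" "q ^ 25 \<noteq> 0" using norm_power_less_1[OF q(1)] q by simp_all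
  have p: "(q ^ 5) ^ 5 = q ^ 25" "(q ^ 5) ^ 2 = q ^ 10" "(q ^ 25) ^ 2 = q ^ 50" by (simp_all flip: power_mult)
  have t: "tri 0 = 0" "tri 1 = 1" "tri 2 = 3" "tri 3 = 6" "tri 4 = 10" by (simp_all add: tri_def)
  have d: "q ^ 5 / q ^ 10 = 1 / q ^ 5" "q ^ 10 / q ^ 10 = 1" "q ^ 15 / q ^ 10 = q ^ 5" "q ^ 20 / q ^ 10 = q ^ 10"
    using q power_add[of q 5 5] power_add[of q 10 5] power_add[of q 10 10] by (simp_all add: field_simps)
  have "theta 1 q = theta (1 / q ^ 10) (q ^ 25) + q * theta (1 / q ^ 5) (q ^ 25) + q ^ 3 * theta 1 (q ^ 25)
      + q ^ 6 * theta (q ^ 5) (q ^ 25) + q ^ 10 * theta (q ^ 10) (q ^ 25)"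
  proof -
    have e: "1 ^ 5 * q ^ (5 * 0) / q ^ 10 = 1 / q ^ 10" "1 ^ 5 * q ^ (5 * 1) / q ^ 10 = 1 / q ^ 5" "1 ^ 5 * q ^ (5 * 2) / q ^ 10 = 1"
      "1 ^ 5 * q ^ (5 * 3) / q ^ 10 = q ^ 5" "1 ^ 5 * q ^ (5 * 4) / q ^ 10 = q ^ 10"
      using d by simp_all
    show ?thesis using theta_split_5[OF q, of 1] unfolding sum_lessThan_5 t e by simp
  qed
  moreover have "q ^ 10 * theta (q ^ 10) (q ^ 25) = theta (1 / q ^ 10) (q ^ 25)"
    using theta_inverse[of "q ^ 10" "q ^ 25"] q q25 by simp
  moreover have "q ^ 6 * theta (q ^ 5) (q ^ 25) = q * theta (1 / q ^ 5) (q ^ 25)"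
    using theta_inverse[of "q ^ 5" "q ^ 25"] q q25 by (simp add: eval_nat_numeral)
  ultimately have "2 * pp (q ^ 2) ^ 2 / pp q = 2 * theta (1 / q ^ 10) (q ^ 25) + 2 * (q * theta (1 / q ^ 5) (q ^ 25)) + q ^ 3 * (2 * pp (q ^ 50) ^ 2 / pp (q ^ 25))"
    unfolding theta_1[OF q] theta_1[OF q25] p by simp
  then have "2 * (pp (q ^ 2) ^ 2 / pp q) = 2 * (theta (1 / q ^ 10) (q ^ 25) + q * theta (1 / q ^ 5) (q ^ 25) + q ^ 3 * (pp (q ^ 50) ^ 2 / pp (q ^ 25)))"
    by (simp add: distrib_left mult_ac)
  then show ?thesis unfolding p by (simp only: mult_cancel_left) simp
qed

text \<open>A polynomial of degree at most 4 with five distinct zeros vanishes. This justifies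
  comparing the classes of a five-dissection at a fixed Q = X^5.\<close>

lemma roots_separate:
  fixes f :: "nat \<Rightarrow> complex"
  assumes Q: "Q \<noteq> 0" and eq: "\<And>X. X ^ 5 = Q \<Longrightarrow> (\<Sum>r<5. f r * X ^ r) = 0" and r: "r < 5"
  shows "f r = 0"
proof -
  define p where "p = (\<Sum>r<5. monom (f r) r)"
  have "degree p \<le> 4" unfolding p_def by (intro degree_sum_le) (auto intro: order_trans[OF degree_monom_le])
  moreover have "card {X. X ^ 5 = Q} = 5" using card_nth_roots[OF Q, of 5] by simp
  ultimately have "p = 0"
    by (intro poly_eqI_degree[of "{X. X ^ 5 = Q}"]) (auto simp: p_def poly_sum poly_monom eq)
  then have "coeff p r = 0" by simp
  then show ?thesis using r by (simp add: p_def coeff_sum)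
qed

text \<open>\<open>bb Q\<close> is \<open>r / Q\<^bsup>1/5\<^esup>\<close> for the Rogers-Ramanujan continued fraction \<open>r\<close>, and \<open>aa\<close> is its inverse.\<close>

definition aa :: "complex \<Rightarrow> complex" where "aa Q = AA Q / pp (Q ^ 5)"
definition bb :: "complex \<Rightarrow> complex" where "bb Q = - BB Q / pp (Q ^ 5)"

lemma pp_dissect':
  assumes X: "X ^ 5 = Q" "norm Q < 1" "Q \<noteq> 0"
  shows "pp X = pp (Q ^ 5) * (aa Q - X - X ^ 2 * bb Q)"
    and "pp (X ^ 2) = pp (Q ^ 10) * (aa (Q ^ 2) - X ^ 2 - X ^ 4 * bb (Q ^ 2))"
proof -
  have X': "norm X < 1" "X \<noteq> 0" using X by (auto simp: norm_power power_less_one_iff)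
  have X2: "norm (X ^ 2) < 1" "X ^ 2 \<noteq> 0" using norm_power_less_1[OF X'(1)] X' by simp_all
  have e: "X ^ 25 = Q ^ 5" "(X ^ 2) ^ 25 = Q ^ 10" "(X ^ 2) ^ 5 = Q ^ 2" "(Q ^ 2) ^ 5 = Q ^ 10" "(X ^ 2) ^ 2 = X ^ 4"
    unfolding X(1)[symmetric] by (simp_all flip: power_mult)
  have nz: "pp (Q ^ 5) \<noteq> 0" "pp (Q ^ 10) \<noteq> 0"
    using pp_nonzero norm_power_less_1[OF X(2)] by simp_all
  show "pp X = pp (Q ^ 5) * (aa Q - X - X ^ 2 * bb Q)"
    using pp_dissect[OF X'] nz(1) unfolding X(1) e
    by (simp add: aa_def bb_def right_diff_distrib distrib_left)
  show "pp (X ^ 2) = pp (Q ^ 10) * (aa (Q ^ 2) - X ^ 2 - X ^ 4 * bb (Q ^ 2))"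
    using pp_dissect[OF X2] nz(2) unfolding e
    by (simp add: aa_def bb_def e right_diff_distrib distrib_left)
qed

text \<open>For X^5 = Q both sides of \<open>pp (X^2)^2\<close> = \<open>pp X\<close> times psi(X)
  are dissected, and the five classes of exponents of X are compared. The class of X^4 states that
  \<open>aa\<close> and \<open>bb\<close> are inverse to each other.\<close>

lemma dissect_relations:
  assumes Q: "norm Q < 1" "Q \<noteq> 0"
  defines "P \<equiv> theta (1 / Q ^ 2) (Q ^ 5) * pp (Q ^ 5) / pp (Q ^ 10) ^ 2"
    and "R \<equiv> theta (1 / Q) (Q ^ 5) * pp (Q ^ 5) / pp (Q ^ 10) ^ 2"
  shows "aa (Q ^ 2) ^ 2 = aa Q * P - bb Q * Q" "2 * bb (Q ^ 2) * Q = aa Q * R - P"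
    "2 * aa (Q ^ 2) = R + bb Q * P" "bb (Q ^ 2) ^ 2 * Q = aa Q - bb Q * R" "aa (Q ^ 2) * bb (Q ^ 2) = 1"
proof -
  define f where "f r = [aa (Q ^ 2) ^ 2 - (aa Q * P - bb Q * Q), 2 * bb (Q ^ 2) * Q - (aa Q * R - P),
    R + bb Q * P - 2 * aa (Q ^ 2), bb (Q ^ 2) ^ 2 * Q - (aa Q - bb Q * R), 2 - 2 * (aa (Q ^ 2) * bb (Q ^ 2))] ! r" for r
  have nz: "pp (Q ^ 5) \<noteq> 0" "pp (Q ^ 10) \<noteq> 0"
    using pp_nonzero norm_power_less_1[OF Q(1)] by simp_all
  have S: "(\<Sum>r<5. f r * X ^ r) = 0" if X: "X ^ 5 = Q" for X
  proof -
    have X': "norm X < 1" "X \<noteq> 0" using X Q by (auto simp: norm_power power_less_one_iff)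
    have nzX: "pp X \<noteq> 0" using pp_nonzero X' by simp
    have e: "X ^ 25 = Q ^ 5" "X ^ 50 = Q ^ 10" unfolding X[symmetric] by (simp_all flip: power_mult)
    have "pp (X ^ 2) ^ 2 = pp X * (theta (1 / Q ^ 2) (Q ^ 5) + X * theta (1 / Q) (Q ^ 5) + X ^ 3 * (pp (Q ^ 10) ^ 2 / pp (Q ^ 5)))"
      using psi_dissect[OF X'] nzX unfolding X e by (simp add: field_simps)
    also have "theta (1 / Q ^ 2) (Q ^ 5) + X * theta (1 / Q) (Q ^ 5) + X ^ 3 * (pp (Q ^ 10) ^ 2 / pp (Q ^ 5))
        = pp (Q ^ 10) ^ 2 / pp (Q ^ 5) * (P + X * R + X ^ 3)"
      unfolding P_def R_def using nz by (simp add: field_simps)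
    finally have "(aa (Q ^ 2) - X ^ 2 - X ^ 4 * bb (Q ^ 2)) ^ 2 = (aa Q - X - X ^ 2 * bb Q) * (P + X * R + X ^ 3)"
      unfolding pp_dissect'[OF X Q] using nz by (simp add: power_mult_distrib power2_eq_square)
    moreover have "(\<Sum>r<5. f r * X ^ r) = (aa (Q ^ 2) - X ^ 2 - X ^ 4 * bb (Q ^ 2)) ^ 2 - (aa Q - X - X ^ 2 * bb Q) * (P + X * R + X ^ 3)"
      unfolding sum_lessThan_5 f_def X[symmetric] by (simp add: eval_nat_numeral algebra_simps)
    ultimately show ?thesis by simp
  qed
  have "f r = 0" if "r < 5" for r by (rule roots_separate[OF Q(2) S that])
  from this[of 0] this[of 1] this[of 2] this[of 3] this[of 4]
  show "aa (Q ^ 2) ^ 2 = aa Q * P - bb Q * Q" "2 * bb (Q ^ 2) * Q = aa Q * R - P"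
    "2 * aa (Q ^ 2) = R + bb Q * P" "bb (Q ^ 2) ^ 2 * Q = aa Q - bb Q * R" "aa (Q ^ 2) * bb (Q ^ 2) = 1"
    by (simp_all add: f_def eval_nat_numeral)
qed

lemma aa_bb: assumes Q: "norm Q < 1" "Q \<noteq> 0" shows "aa Q * bb Q = 1"
proof -
  \<comment> \<open>The relation was obtained at the argument Q^2, hence the square root.\<close>
  have "csqrt Q ^ 2 = Q" "norm (csqrt Q) < 1" "csqrt Q \<noteq> 0" using Q by (simp_all add: norm_csqrt)
  then show ?thesis using dissect_relations(5)[of "csqrt Q"] by simp
qed

section \<open>Eta quotients of level ten\<close>

text \<open>Ramanujan's parameter \<open>r(q) r(q\<^sup>2)\<^sup>2\<close>.\<close>

definition kk :: "complex \<Rightarrow> complex" where "kk Q = Q * bb Q * bb (Q ^ 2) ^ 2"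

text \<open>With b = \<open>bb Q\<close> and d = \<open>bb (Q^2)\<close>, the relations e1 and e4
  express P and R by b, d and Q. Then e3 becomes the first claim multiplied by d - b^2.\<close>

lemma kk_algebra:
  fixes Q b d P R :: complex
  assumes nz: "Q \<noteq> 0" "b \<noteq> 0" "d \<noteq> 0"
    and e1: "(1 / d) ^ 2 = 1 / b * P - b * Q" and e2: "2 * d * Q = 1 / b * R - P"
    and e3: "2 * (1 / d) = R + b * P" and e4: "d ^ 2 * Q = 1 / b - b * R"
  shows "d - b ^ 2 = Q * b * d ^ 2 * (d + b ^ 2)"
    and "P * R / Q = 1 / (Q * b * d ^ 2) - Q * b * d ^ 2"
proof -
  have P: "P = b / d ^ 2 + b ^ 2 * Q" using e1 nz by (simp add: field_simps power2_eq_square)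
  have R: "R = 1 / b ^ 2 - d ^ 2 * Q / b" using e4 nz by (simp add: field_simps power2_eq_square)
  \<comment> \<open>Cancelling d - b^2 is legitimate: otherwise e2 would force 4 Q b^2 = 0.\<close>
  have ne: "d \<noteq> b ^ 2"
  proof
    assume d: "d = b ^ 2"
    have "b * (b * (Q * 4)) = 0"
      using e2 nz unfolding P R d by (simp add: field_simps eval_nat_numeral)
    then show False using nz by simp
  qed
  have "(d - b ^ 2) * (d - b ^ 2) = (d - b ^ 2) * (Q * b * d ^ 2 * (d + b ^ 2))"
    using e3 nz unfolding P R by (simp add: field_simps eval_nat_numeral)
  then show "d - b ^ 2 = Q * b * d ^ 2 * (d + b ^ 2)" using ne by simp
  show "P * R / Q = 1 / (Q * b * d ^ 2) - Q * b * d ^ 2"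
    unfolding P R using nz by (simp add: field_simps eval_nat_numeral)
qed

lemma bb_nonzero: "norm Q < 1 \<Longrightarrow> Q \<noteq> 0 \<Longrightarrow> bb Q \<noteq> 0" and aa_eq:
    "norm Q < 1 \<Longrightarrow> Q \<noteq> 0 \<Longrightarrow> aa Q = 1 / bb Q"
proof -
  assume Q: "norm Q < 1" "Q \<noteq> 0"
  show b: "bb Q \<noteq> 0" using aa_bb[OF Q] by auto
  show "aa Q = 1 / bb Q" using aa_bb[OF Q] b by (simp add: eq_divide_eq)
qed

definition wprod :: "complex \<Rightarrow> complex" where
  "wprod Q = pp (Q ^ 2) * pp (Q ^ 5) ^ 5 / (Q * pp Q * pp (Q ^ 10) ^ 5)"

definition xprod :: "complex \<Rightarrow> complex" where
  "xprod Q = pp (Q ^ 2) ^ 4 * pp (Q ^ 5) ^ 2 / (Q * pp Q ^ 2 * pp (Q ^ 10) ^ 4)"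

definition yprod :: "complex \<Rightarrow> complex" where
  "yprod Q = Q * (pp (Q ^ 2) * pp (Q ^ 10) ^ 3 / (pp Q ^ 3 * pp (Q ^ 5)))"

lemma kk_relations:
  assumes Q: "norm Q < 1" "Q \<noteq> 0"
  shows "bb (Q ^ 2) - bb Q ^ 2 = kk Q * (bb (Q ^ 2) + bb Q ^ 2)"
    and "wprod Q = 1 / kk Q - kk Q"
proof -
  have Q2: "norm (Q ^ 2) < 1" "Q ^ 2 \<noteq> 0" using norm_power_less_1[OF Q(1)] Q by simp_all
  note rel = dissect_relations[OF Q, unfolded aa_eq[OF Q] aa_eq[OF Q2]]
  note alg = kk_algebra[OF Q(2) bb_nonzero[OF Q] bb_nonzero[OF Q2] rel(1-4)]
  show "bb (Q ^ 2) - bb Q ^ 2 = kk Q * (bb (Q ^ 2) + bb Q ^ 2)" unfolding kk_def by (rule alg(1))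
  have nz: "pp Q \<noteq> 0" "pp (Q ^ 5) \<noteq> 0" "pp (Q ^ 10) \<noteq> 0"
    using pp_nonzero norm_power_less_1[OF Q(1)] Q by simp_all
  have "1 / kk Q - kk Q = (theta (1 / Q ^ 2) (Q ^ 5) * theta (1 / Q) (Q ^ 5)) * (pp (Q ^ 5) / pp (Q ^ 10) ^ 2) ^ 2 / Q"
    unfolding kk_def alg(2)[symmetric] by (simp add: power2_eq_square)
  also have "\<dots> = wprod Q"
    unfolding theta_product[OF Q] wprod_def using nz Q by (simp add: field_simps eval_nat_numeral)
  finally show "wprod Q = 1 / kk Q - kk Q" by simp
qed

section \<open>Norms over the fifth roots of unity\<close>

definition zeta :: complex where "zeta = cis (2 * pi / 5)"

lemma zeta_power: "zeta ^ n = cis (2 * pi * real n / 5)"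
  unfolding zeta_def Complex.DeMoivre by (simp add: mult_ac)

lemma zeta_5: "zeta ^ 5 = 1"
  unfolding zeta_power by (simp add: cis_2pi)

lemma zeta_neq_1: "\<not> 5 dvd n \<Longrightarrow> zeta ^ n \<noteq> 1"
proof
  assume n: "\<not> 5 dvd n" and "zeta ^ n = 1"
  then have "cis (2 * pi * real n / 5) = 1" by (simp add: zeta_power)
  then have "cos (2 * pi * real n / 5) = 1" by (simp add: complex_eq_iff)
  then obtain m :: int where "2 * pi * real n / 5 = real_of_int m * 2 * pi"
    by (auto simp: cos_one_2pi_int)
  then have "real_of_int (int n) = real_of_int (5 * m)" by (simp add: field_simps)
  then have "int n = 5 * m" by linarith
  then show False using n by presburger
qed

lemma sum_zeta: "(\<Sum>j<5. zeta ^ (j * n)) = (if 5 dvd n then 5 else 0)"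
proof (cases "5 dvd n")
  case True
  then obtain m where "n = 5 * m" by auto
  then have "zeta ^ (j * n) = 1" for j
    by (simp add: zeta_5 power_mult mult.left_commute[of j])
  then show ?thesis using True by simp
next
  case False
  have "(\<Sum>j<5. zeta ^ (j * n)) = (\<Sum>j<5. (zeta ^ n) ^ j)" by (simp add: power_mult[symmetric] mult.commute)
  also have "\<dots> = 0"
  proof -
    have "(zeta ^ n) ^ 5 = 1" by (metis zeta_5 power_mult mult.commute power_one)
    then show ?thesis using zeta_neq_1[OF False] by (simp only: sum_gp_strict if_False) simp
  qed
  finally show ?thesis using False by simp
qed

lemma prod_zeta: "(\<Prod>j<5. 1 - zeta ^ j * t) = 1 - t ^ 5"
proof -
  have 0: "1 + zeta + zeta ^ 2 + zeta ^ 3 + zeta ^ 4 = 0"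
    using sum_zeta[of 1] unfolding sum_lessThan_5 by simp
  have "(\<Prod>j<5. 1 - zeta ^ j * t) = (1 - t) * (1 - zeta * t) * (1 - zeta ^ 2 * t) * (1 - zeta ^ 3 * t) * (1 - zeta ^ 4 * t)"
    by (simp add: eval_nat_numeral)
  also have "\<dots> = 1 - t ^ 5"
  proof -
    \<comment> \<open>As a polynomial in z, the difference of the two sides is the fifth cyclotomic
      polynomial times an explicit cofactor.\<close>
    have "(1 - t) * (1 - z * t) * (1 - z ^ 2 * t) * (1 - z ^ 3 * t) * (1 - z ^ 4 * t) - (1 - t ^ 5)
      - (1 + z + z ^ 2 + z ^ 3 + z ^ 4) * (t^5 - t + z * t^2 - z * t^5 + z^3 * t^2 - z^3 * t^3 - z^5 * t^3 + z^5 * t^5 + z^6 * t^4 - z^6 * t^5) = 0" for z :: complex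
      by algebra
    from this[of zeta] show ?thesis unfolding 0 by simp
  qed
  finally show ?thesis .
qed

lemma norm_zeta [simp]: "norm zeta = 1" and zeta_nonzero [simp]: "zeta \<noteq> 0"
  by (simp_all add: zeta_def)

text \<open>The factors with index n prime to 5 multiply to 1 - Q^n; for n = 5m all five agree and
  give (1 - Q^m)^5.\<close>

lemma pp_norm:
  assumes X: "X ^ 5 = Q" and Q: "norm Q < 1"
  shows "(\<Prod>j<5. pp (zeta ^ j * X)) * pp (Q ^ 5) = pp Q ^ 6"
proof -
  have X': "norm X < 1" using X Q by (auto simp: norm_power power_less_one_iff)
  have zX: "norm (zeta ^ j * X) < 1" for j using X' by (simp add: norm_mult norm_power)
  \<comment> \<open>Truncating at a multiple of 5 keeps complete blocks of indices, so the identity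
    is exact before the limit.\<close>
  have fin: "(\<Prod>j<5. qf (zeta ^ j * X) (N * 5)) * qf (Q ^ 5) N = qf Q (N * 5) * qf Q N ^ 5" for N
  proof -
    have single: "(\<Prod>j<5. 1 - (zeta ^ j * X) ^ n) = (if 5 dvd n then (1 - X ^ n) ^ 5 else 1 - Q ^ n)" for n
    proof (cases "5 dvd n")
      case True
      then obtain m where m: "n = 5 * m" by auto
      have "(zeta ^ j) ^ n = 1" for j
        unfolding m by (metis power_mult power_one zeta_5 mult.commute)
      then show ?thesis using True by (simp add: power_mult_distrib)
    next
      case False
      have bij: "bij_betw (\<lambda>j. (j * n) mod 5) {..<5} {..<5}"
      proof (rule bij_betw_imageI)
        show "inj_on (\<lambda>j. (j * n) mod 5) {..<5}"
        proof (rule inj_onI)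
          fix a b assume ab: "a \<in> {..<5}" "b \<in> {..<5::nat}" and eq: "a * n mod 5 = b * n mod 5"
          have "a * (n mod 5) mod 5 = b * (n mod 5) mod 5" using eq by (simp add: mod_mult_right_eq)
          moreover have "n mod 5 = 1 \<or> n mod 5 = 2 \<or> n mod 5 = 3 \<or> n mod 5 = 4" using False by presburger
          ultimately show "a = b" using less_5_cases[of a] less_5_cases[of b] ab by auto
        qed
        then show "(\<lambda>j. (j * n) mod 5) ` {..<5} = {..<5}"
          by (intro endo_inj_surj) auto
      qed
      have "(\<Prod>j<5. 1 - (zeta ^ j * X) ^ n) = (\<Prod>j<5. 1 - zeta ^ ((j * n) mod 5) * X ^ n)"
      proof (rule prod.cong)
        fix j
        have "zeta ^ (j * n) = zeta ^ (5 * ((j * n) div 5) + (j * n) mod 5)" by simp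
        also have "\<dots> = zeta ^ ((j * n) mod 5)" unfolding power_add power_mult zeta_5 by simp
        finally show "1 - (zeta ^ j * X) ^ n = 1 - zeta ^ ((j * n) mod 5) * X ^ n"
          by (simp add: power_mult_distrib power_mult)
      qed simp
      also have "\<dots> = (\<Prod>j<5. 1 - zeta ^ j * X ^ n)"
        using prod.reindex_bij_betw[OF bij, of "\<lambda>j. 1 - zeta ^ j * X ^ n"] by simp
      also have "\<dots> = 1 - Q ^ n"
        unfolding prod_zeta X[symmetric] by (simp flip: power_mult add: mult.commute)
      finally show ?thesis using False by simp
    qed
    have "(\<Prod>j<5. qf (zeta ^ j * X) (N * 5)) = (\<Prod>m<N * 5. \<Prod>j<5. 1 - (zeta ^ j * X) ^ Suc m)"
      unfolding qf_def by (rule prod.swap)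
    also have "\<dots> = (\<Prod>m<N * 5. if 5 dvd Suc m then (1 - X ^ Suc m) ^ 5 else 1 - Q ^ Suc m)"
      unfolding single ..
    also have "\<dots> * qf (Q ^ 5) N = qf Q (N * 5) * qf Q N ^ 5"
    proof (induction N)
      case (Suc N)
      have e: "Suc N * 5 = Suc (Suc (Suc (Suc (Suc (N * 5)))))" by simp
      have d: "5 dvd Suc (Suc (Suc (Suc (Suc (N * 5)))))" "\<not> 5 dvd Suc (N * 5)" "\<not> 5 dvd Suc (Suc (N * 5))"
        "\<not> 5 dvd Suc (Suc (Suc (N * 5)))" "\<not> 5 dvd Suc (Suc (Suc (Suc (N * 5))))" by presburger+
      have x: "X ^ Suc (Suc (Suc (Suc (Suc (N * 5))))) = Q ^ Suc N"
        "(Q ^ 5) ^ Suc N = Q ^ Suc (Suc (Suc (Suc (Suc (N * 5)))))"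
        unfolding e[symmetric]
         apply (simp only: X[symmetric] power_mult[symmetric] mult.commute)
        apply (simp only: power_mult[symmetric] mult.commute)
        done
      define f where "f = (1 - Q ^ Suc (N * 5)) * (1 - Q ^ Suc (Suc (N * 5))) * (1 - Q ^ Suc (Suc (Suc (N * 5))))
        * (1 - Q ^ Suc (Suc (Suc (Suc (N * 5))))) * (1 - Q ^ Suc N) ^ 5 * (1 - Q ^ Suc (Suc (Suc (Suc (Suc (N * 5))))))"
      have L: "(\<Prod>m<Suc N * 5. if 5 dvd Suc m then (1 - X ^ Suc m) ^ 5 else 1 - Q ^ Suc m) * qf (Q ^ 5) (Suc N)
        = (\<Prod>m<N * 5. if 5 dvd Suc m then (1 - X ^ Suc m) ^ 5 else 1 - Q ^ Suc m) * qf (Q ^ 5) N * f"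
        by (simp only: e qf_Suc prod.lessThan_Suc d if_True if_False x f_def mult_ac)
      have R: "qf Q (Suc N * 5) * qf Q (Suc N) ^ 5 = qf Q (N * 5) * qf Q N ^ 5 * f"
        by (simp only: e qf_Suc power_mult_distrib f_def mult_ac)
      show ?case unfolding L R Suc.IH ..
    qed (simp add: qf_def)
    finally show ?thesis .
  qed
  have N5: "filterlim (\<lambda>N. N * 5) at_top sequentially" by (rule mult_nat_right_at_top) simp
  have Q5: "norm (Q ^ 5) < 1" using norm_power_less_1[OF Q] by simp
  have "(\<lambda>N. (\<Prod>j<5. qf (zeta ^ j * X) (N * 5)) * qf (Q ^ 5) N) \<longlonglongrightarrow> (\<Prod>j<5. pp (zeta ^ j * X)) * pp (Q ^ 5)"
    by (intro tendsto_mult tendsto_prod filterlim_compose[OF qf_tendsto N5] qf_tendsto Q5 zX)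
  moreover have "(\<lambda>N. qf Q (N * 5) * qf Q N ^ 5) \<longlonglongrightarrow> pp Q * pp Q ^ 5"
    by (intro tendsto_mult tendsto_power filterlim_compose[OF qf_tendsto N5] qf_tendsto Q)
  ultimately have "(\<Prod>j<5. pp (zeta ^ j * X)) * pp (Q ^ 5) = pp Q * pp Q ^ 5"
    unfolding fin using LIMSEQ_unique by blast
  then show ?thesis by (simp add: eval_nat_numeral)
qed

text \<open>Factor \<open>1 - v - v\<^sup>2 = (1 - g v) (1 - h v)\<close> with \<open>g + h = 1\<close>, \<open>g h = -1\<close>;
  the constant 11 is \<open>g\<^sup>5 + h\<^sup>5\<close>.\<close>

lemma prod_zeta_quadratic: "(\<Prod>j<5. 1 - zeta ^ j * v - (zeta ^ j * v) ^ 2) = 1 - 11 * v ^ 5 - v ^ 10"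
proof -
  define s :: complex where "s = of_real (sqrt 5)"
  have s2: "s ^ 2 = 5" unfolding s_def by (simp flip: of_real_power)
  define g h where "g = (1 + s) / 2" and "h = (1 - s) / 2"
  have gh: "g + h = 1" "g * h = - 1"
    unfolding g_def h_def using s2 by (simp_all add: field_simps power2_eq_square)
  have "(\<Prod>j<5. 1 - zeta ^ j * v - (zeta ^ j * v) ^ 2) = (\<Prod>j<5. (1 - zeta ^ j * (g * v)) * (1 - zeta ^ j * (h * v)))"
  proof (rule prod.cong)
    fix j
    have "(1 - zeta ^ j * (g * v)) * (1 - zeta ^ j * (h * v)) = 1 - (g + h) * (zeta ^ j * v) + (g * h) * (zeta ^ j * v) ^ 2"
      by (simp add: algebra_simps power2_eq_square)
    then show "1 - zeta ^ j * v - (zeta ^ j * v) ^ 2 = (1 - zeta ^ j * (g * v)) * (1 - zeta ^ j * (h * v))"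
      unfolding gh by simp
  qed simp
  also have "\<dots> = (1 - (g * v) ^ 5) * (1 - (h * v) ^ 5)"
    unfolding prod.distrib prod_zeta ..
  also have "\<dots> = 1 - 11 * v ^ 5 - v ^ 10"
  proof -
    have h: "h = 1 - g" using gh(1) by (simp add: eq_diff_eq add.commute)
    have "g ^ 2 - (g + 1) = - (g * h + 1)" unfolding h by (simp add: algebra_simps power2_eq_square)
    then have g2: "g ^ 2 = g + 1" using gh(2) by simp
    have g5: "g ^ 5 = 5 * g + 3"
    proof -
      have "g ^ 5 = g ^ 2 * g ^ 2 * g" by (simp flip: power_add power_Suc2)
      also have "\<dots> = (g + 1) * (g + 1) * g" unfolding g2 ..
      also have "\<dots> = (g ^ 2 + 2 * g + 1) * g" by (simp add: algebra_simps power2_eq_square)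
      also have "\<dots> = (3 * g + 2) * g" unfolding g2 by (simp add: algebra_simps)
      also have "\<dots> = 3 * g ^ 2 + 2 * g" by (simp add: algebra_simps power2_eq_square)
      finally show ?thesis unfolding g2 by (simp add: algebra_simps)
    qed
    have h2: "h ^ 2 = h + 1" unfolding h using g2 by (simp add: algebra_simps power2_eq_square)
    have h5: "h ^ 5 = 5 * h + 3"
    proof -
      have "h ^ 5 = h ^ 2 * h ^ 2 * h" by (simp flip: power_add power_Suc2)
      also have "\<dots> = (h + 1) * (h + 1) * h" unfolding h2 ..
      also have "\<dots> = (h ^ 2 + 2 * h + 1) * h" by (simp add: algebra_simps power2_eq_square)
      also have "\<dots> = (3 * h + 2) * h" unfolding h2 by (simp add: algebra_simps)
      also have "\<dots> = 3 * h ^ 2 + 2 * h" by (simp add: algebra_simps power2_eq_square)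
      finally show ?thesis unfolding h2 by (simp add: algebra_simps)
    qed
    have sum5: "g ^ 5 + h ^ 5 = 11" unfolding g5 h5 by (simp add: h)
    have prod5: "g ^ 5 * h ^ 5 = - 1" using gh(2) by (simp flip: power_mult_distrib)
    have "(1 - (g * v) ^ 5) * (1 - (h * v) ^ 5) = 1 - (g ^ 5 + h ^ 5) * v ^ 5 + (g ^ 5 * h ^ 5) * (v ^ 5 * v ^ 5)"
      by (simp add: power_mult_distrib algebra_simps)
    then show ?thesis unfolding sum5 prod5 by (simp flip: power_add)
  qed
  finally show ?thesis .
qed

text \<open>Ramanujan's formula with 1/r^5 - 11 - r^5. Each conjugate of \<open>pp X\<close> is a
  constant times 1 - v - v^2 by the dissection; the product over the conjugates is evaluated once as
  a norm and once by \<open>prod_zeta_quadratic\<close>.\<close>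

lemma pp_quotient_6:
  assumes Q: "norm Q < 1" "Q \<noteq> 0"
  shows "pp Q ^ 6 = pp (Q ^ 5) ^ 6 * (1 / bb Q ^ 5 - 11 * Q - Q ^ 2 * bb Q ^ 5)"
proof -
  obtain X where X: "X ^ 5 = Q"
    using card_nth_roots[OF Q(2), of 5] by (metis (mono_tags, lifting) Collect_empty_eq card.empty zero_neq_numeral zero_less_numeral)
  have b: "bb Q \<noteq> 0" by (rule bb_nonzero[OF Q])
  define v where "v = X * bb Q"
  have v5: "v ^ 5 = Q * bb Q ^ 5" unfolding v_def power_mult_distrib X ..
  have v10: "v ^ 10 = Q ^ 2 * (bb Q ^ 5) ^ 2"
    using v5 by (metis power_mult_distrib power_mult mult_2_right numeral_Bit0 power2_eq_square power_add)
  define C where "C = pp (Q ^ 5) * (1 / bb Q)"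
  have "pp (zeta ^ j * X) = C * (1 - zeta ^ j * v - (zeta ^ j * v) ^ 2)" for j
  proof -
    have "(zeta ^ j * X) ^ 5 = Q"
      unfolding power_mult_distrib X by (metis mult_1 power_mult power_one zeta_5 mult.commute)
    from pp_dissect'(1)[OF this Q] show ?thesis
      unfolding aa_eq[OF Q] v_def C_def using b by (simp add: field_simps power2_eq_square)
  qed
  then have "(\<Prod>j<5. pp (zeta ^ j * X)) = C ^ 5 * (1 - 11 * v ^ 5 - v ^ 10)"
    by (simp only: prod.distrib prod_zeta_quadratic prod_constant card_lessThan)
  then have "pp Q ^ 6 = (pp (Q ^ 5) * (1 / bb Q)) ^ 5 * (1 - 11 * v ^ 5 - v ^ 10) * pp (Q ^ 5)"
    using pp_norm[OF X Q(1)] by (simp add: C_def)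
  then show ?thesis unfolding v5 v10 using b by (simp add: field_simps eval_nat_numeral)
qed

section \<open>Behaviour at q = 0 and the level ten relations\<close>

lemma pp_holomorphic: "pp holomorphic_on ball 0 1"
  using int_coeffs_qpoch[of 1] by (simp add: int_coeffs_def pp_def[abs_def])

lemma pp_0 [simp]: "pp 0 = 1" by (simp add: pp_def)

lemma pp_tendsto_0: "(f \<longlongrightarrow> 0) F \<Longrightarrow> ((\<lambda>x. pp (f x)) \<longlongrightarrow> 1) F"
proof -
  have "isCont pp 0"
    using holomorphic_on_imp_continuous_on[OF pp_holomorphic] by (simp add: continuous_on_eq_continuous_at)
  then show "(f \<longlongrightarrow> 0) F \<Longrightarrow> ((\<lambda>x. pp (f x)) \<longlongrightarrow> 1) F"
    using isCont_tendsto_compose[of 0 pp f F] by simp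
qed

lemma aa_average:
  assumes X: "X ^ 5 = Q" and Q: "norm Q < 1" "Q \<noteq> 0"
  shows "(\<Sum>j<5. pp (zeta ^ j * X)) = 5 * pp (Q ^ 5) * aa Q"
proof -
  have "pp (zeta ^ j * X) = pp (Q ^ 5) * aa Q - pp (Q ^ 5) * X * zeta ^ (j * 1) - pp (Q ^ 5) * X ^ 2 * bb Q * zeta ^ (j * 2)" for j
  proof -
    have "(zeta ^ j * X) ^ 5 = Q"
      unfolding power_mult_distrib X by (metis mult_1 power_mult power_one zeta_5 mult.commute)
    from pp_dissect'(1)[OF this Q] show ?thesis by (simp add: algebra_simps power_mult)
  qed
  then have "(\<Sum>j<5. pp (zeta ^ j * X)) = 5 * (pp (Q ^ 5) * aa Q) - pp (Q ^ 5) * X * (\<Sum>j<5. zeta ^ (j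
      * 1)) - pp (Q ^ 5) * X ^ 2 * bb Q * (\<Sum>j<5. zeta ^ (j * 2))"
    by (simp only: sum_subtractf sum_distrib_left sum_constant) simp
  then show ?thesis unfolding sum_zeta by simp
qed

text \<open>\<open>AA\<close> is built from theta functions at negative powers of Q, so its limit is
  not visible termwise; the average over fifth roots involves only values of \<open>pp\<close> near
  0.\<close>

lemma aa_tendsto: "(aa \<longlongrightarrow> 1) (at 0)"
proof (rule LIM_I)
  fix e :: real assume e: "e > 0"
  \<comment> \<open>By \<open>aa_average\<close> this is \<open>aa (X^5)\<close> for small nonzero
    X.\<close>
  define g where "g X = (\<Sum>j<5. pp (zeta ^ j * X)) / (5 * pp (X ^ 25))" for X
  have "(g \<longlongrightarrow> (\<Sum>j<(5::nat). 1) / (5 * 1)) (at (0::complex))"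
    unfolding g_def by (intro tendsto_intros pp_tendsto_0) (auto intro!: tendsto_eq_intros)
  then have "(g \<longlongrightarrow> 1) (at 0)" by simp
  from LIM_D[OF this e] obtain d where d: "d > 0" "\<And>X. X \<noteq> 0 \<Longrightarrow> norm X < d \<Longrightarrow> norm (g X - 1) < e" by auto
  show "\<exists>s>0. \<forall>Q. Q \<noteq> 0 \<and> norm (Q - 0) < s \<longrightarrow> norm (aa Q - 1) < e"
  proof (intro exI[of _ "min 1 (d ^ 5)"] conjI allI impI)
    fix Q :: complex assume Q: "Q \<noteq> 0 \<and> norm (Q - 0) < min 1 (d ^ 5)"
    then have Q': "norm Q < 1" "Q \<noteq> 0" by auto
    obtain X where X: "X ^ 5 = Q"
      using card_nth_roots[OF Q'(2), of 5] by (metis (mono_tags, lifting) Collect_empty_eq card.empty zero_neq_numeral zero_less_numeral)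
    have "norm X ^ 5 < d ^ 5" using Q X by (auto simp flip: norm_power)
    then have "norm X < d" by (rule power_less_imp_less_base) (use d in simp)
    moreover have "X \<noteq> 0" using X Q by auto
    moreover have "g X = aa Q"
      using aa_average[OF X Q'] pp_nonzero[OF norm_power_less_1[OF Q'(1)], of 5]
      unfolding g_def X[symmetric] by (simp flip: power_mult)
    ultimately show "norm (aa Q - 1) < e" using d(2)[of X] by simp
  qed (use d in auto)
qed

lemma eventually_unit_disc: "eventually (\<lambda>Q::complex. norm Q < 1 \<and> Q \<noteq> 0) (at 0)"
  unfolding eventually_at by (intro exI[of _ 1]) auto

lemma filterlim_power_at_0: "k > 0 \<Longrightarrow> filterlim (\<lambda>Q::complex. Q ^ k) (at 0) (at 0)"
  by (intro filterlim_atI) (auto intro!: tendsto_eq_intros simp: eventually_at_filter zero_power)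

lemma bb_tendsto: "(bb \<longlongrightarrow> 1) (at 0)"
proof -
  have "((\<lambda>Q. 1 / aa Q) \<longlongrightarrow> 1 / 1) (at 0)" by (intro tendsto_intros aa_tendsto) simp
  moreover have "eventually (\<lambda>Q. bb Q = 1 / aa Q) (at 0)"
    using eventually_unit_disc by eventually_elim (metis aa_bb nonzero_eq_divide_eq mult_zero_left mult.commute zero_neq_one)
  ultimately show ?thesis by (simp add: tendsto_cong)
qed

lemma kk_div_tendsto: "((\<lambda>Q. kk Q / Q) \<longlongrightarrow> 1) (at 0)"
proof -
  have "((\<lambda>Q. bb Q * bb (Q ^ 2) ^ 2) \<longlongrightarrow> 1 * 1 ^ 2) (at 0)"
    by (intro tendsto_intros bb_tendsto filterlim_compose[OF bb_tendsto] filterlim_power_at_0) simp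
  moreover have "eventually (\<lambda>Q. kk Q / Q = bb Q * bb (Q ^ 2) ^ 2) (at 0)"
    using eventually_unit_disc by eventually_elim (simp add: kk_def)
  ultimately show ?thesis by (simp add: tendsto_cong)
qed

lemma kk_tendsto: "(kk \<longlongrightarrow> 0) (at 0)"
proof -
  have "((\<lambda>Q. kk Q / Q * Q) \<longlongrightarrow> 1 * 0) (at 0)" by (intro tendsto_intros kk_div_tendsto)
  moreover have "eventually (\<lambda>Q. kk Q / Q * Q = kk Q) (at 0)"
    using eventually_unit_disc by eventually_elim simp
  ultimately show ?thesis by (simp add: tendsto_cong)
qed

lemma kk_nonzero: "norm Q < 1 \<Longrightarrow> Q \<noteq> 0 \<Longrightarrow> kk Q \<noteq> 0"
  using bb_nonzero[of Q] bb_nonzero[of "Q ^ 2"] norm_power_less_1[of Q 2] by (simp add: kk_def)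

text \<open>The relation gives d = m b^2 with m = (1 + K) / (1 - K), so Q b^5 = K / m^2 and Q^2 d^5
  = K^2 m are rational in K. The numerators then factor into the expressions that will be x and 1/y,
  up to powers of K.\<close>

lemma level_ten_algebra:
  fixes K m Q b d :: complex
  assumes nz: "K \<noteq> 0" "1 - K \<noteq> 0" "1 + K \<noteq> 0" "Q \<noteq> 0" "b \<noteq> 0" "d \<noteq> 0"
    and K: "K = Q * b * d ^ 2" and rel: "d - b ^ 2 = K * (d + b ^ 2)"
  shows "1 / (Q * b ^ 5) - 11 - Q * b ^ 5 = (1 / K + 1 - K) * (1 / K - 4 - K) ^ 2 / (1 / K - K) ^ 2"
    and "1 / (Q ^ 2 * d ^ 5) - 11 - Q ^ 2 * d ^ 5 = (1 / K + 1 - K) ^ 2 * (1 / K - 4 - K) / (1 / K - K)"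
proof -
  define m where "m = (1 + K) / (1 - K)"
  have m0: "m \<noteq> 0" using nz by (simp add: m_def)
  have d: "d = m * b ^ 2"
    using rel nz by (simp add: m_def field_simps)
  have Qb: "Q * b ^ 5 = K / m ^ 2"
    using m0 by (simp add: K d field_simps eval_nat_numeral)
  have Qd: "Q ^ 2 * d ^ 5 = K ^ 2 * m"
    using m0 by (simp add: K d field_simps eval_nat_numeral)
  have W: "1 / K - K = (1 - K) * (1 + K) / K"
    using nz by (simp add: field_simps)
  show "1 / (Q * b ^ 5) - 11 - Q * b ^ 5 = (1 / K + 1 - K) * (1 / K - 4 - K) ^ 2 / (1 / K - K) ^ 2"
  proof -
    have "1 / (K / m ^ 2) - 11 - K / m ^ 2 = ((1 + K) ^ 4 - 11 * K * (1 - K) ^ 2 * (1 + K) ^ 2 - K ^ 2 * (1 - K) ^ 4) / (K * (1 - K) ^ 2 * (1 + K) ^ 2)"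
      unfolding m_def using nz by (simp add: divide_simps; simp add: eval_nat_numeral algebra_simps)
    moreover have "(1 / K + 1 - K) * (1 / K - 4 - K) ^ 2 / (1 / K - K) ^ 2
        = ((1 + K - K ^ 2) * (1 - 4 * K - K ^ 2) ^ 2) / (K * (1 - K) ^ 2 * (1 + K) ^ 2)"
    proof -
      have "1 / K + 1 - K = (1 + K - K ^ 2) / K" "1 / K - 4 - K = (1 - 4 * K - K ^ 2) / K"
        using nz by (simp_all add: field_simps power2_eq_square)
      then show ?thesis unfolding W using nz by (simp add: power_divide power_mult_distrib divide_simps; simp add: eval_nat_numeral)
    qed
    moreover have "(1 + K) ^ 4 - 11 * K * (1 - K) ^ 2 * (1 + K) ^ 2 - K ^ 2 * (1 - K) ^ 4 = (1 + K - K ^ 2) * (1 - 4 * K - K ^ 2) ^ 2"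
      by algebra
    ultimately show ?thesis unfolding Qb by simp
  qed
  show "1 / (Q ^ 2 * d ^ 5) - 11 - Q ^ 2 * d ^ 5 = (1 / K + 1 - K) ^ 2 * (1 / K - 4 - K) / (1 / K - K)"
  proof -
    have "1 / (K ^ 2 * m) - 11 - K ^ 2 * m = ((1 - K) ^ 2 - 11 * K ^ 2 * (1 - K) * (1 + K) - K ^ 4 * (1 + K) ^ 2) / (K ^ 2 * (1 - K) * (1 + K))"
      unfolding m_def using nz by (simp add: divide_simps; simp add: eval_nat_numeral algebra_simps)
    moreover have "(1 / K + 1 - K) ^ 2 * (1 / K - 4 - K) / (1 / K - K)
        = ((1 + K - K ^ 2) ^ 2 * (1 - 4 * K - K ^ 2)) / (K ^ 2 * (1 - K) * (1 + K))"
    proof -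
      have "1 / K + 1 - K = (1 + K - K ^ 2) / K" "1 / K - 4 - K = (1 - 4 * K - K ^ 2) / K"
        using nz by (simp_all add: field_simps power2_eq_square)
      then show ?thesis unfolding W using nz by (simp add: power_divide power_mult_distrib divide_simps; simp add: eval_nat_numeral)
    qed
    moreover have "(1 - K) ^ 2 - 11 * K ^ 2 * (1 - K) * (1 + K) - K ^ 4 * (1 + K) ^ 2 = (1 + K - K ^ 2) ^ 2 * (1 - 4 * K - K ^ 2)"
      by algebra
    ultimately show ?thesis unfolding Qd by simp
  qed
qed

lemma pp_power_nonzero: "norm Q < 1 \<Longrightarrow> k > 0 \<Longrightarrow> pp (Q ^ k) \<noteq> 0"
  by (intro pp_nonzero norm_power_less_1)

text \<open>Selects the correct cube root in the identification of \<open>xprod\<close>, where only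
  the cubes can be compared.\<close>

lemma cube_root_near_1:
  fixes u :: complex
  assumes "u ^ 3 = 1" "norm (u - 1) < 1 / 2"
  shows "u = 1"
proof -
  have "(u - 1) * (u ^ 2 + u + 1) = 0" using assms by (simp add: algebra_simps eval_nat_numeral)
  moreover have "u ^ 2 + u + 1 \<noteq> 0"
  proof
    assume 0: "u ^ 2 + u + 1 = 0"
    have "(u - 1) * (u - 1 + 3) = u ^ 2 + u + 1 - 3" by (simp add: algebra_simps power2_eq_square)
    then have "norm (u - 1) * norm (u - 1 + 3) = 3" using 0 by (simp flip: norm_mult)
    moreover have "norm (u - 1 + 3) \<le> norm (u - 1) + 3" using norm_triangle_ineq[of "u - 1" 3] by simp
    ultimately have "3 \<le> norm (u - 1) * (norm (u - 1) + 3)"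
      using mult_left_mono[of "norm (u - 1 + 3)" "norm (u - 1) + 3" "norm (u - 1)"] by simp
    also have "\<dots> \<le> 1 / 2 * (1 / 2 + 3)" using assms(2) by (intro mult_mono) auto
    finally show False by simp
  qed
  ultimately show ?thesis by simp
qed

text \<open>\<open>pp_quotient_6\<close> at Q and at Q^2 yields two eta quotients as monomials in W,
  X and Y, and W is already known to be \<open>wprod\<close>. One combination gives X^3, fixed by
  the limit of X / \<open>xprod\<close>; another one then gives Y.\<close>

lemma eventually_level_ten:
  "eventually (\<lambda>Q. norm Q < 1 \<and> Q \<noteq> 0 \<and> kk Q \<noteq> 0 \<and> 1 - kk Q \<noteq> 0 \<and> 1 + kk Q \<noteq> 0 \<and>
     xprod Q = 1 / kk Q + 1 - kk Q \<and> 1 / yprod Q = 1 / kk Q - 4 - kk Q) (at 0)"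
proof -
  define X where "X Q = 1 / kk Q + 1 - kk Q" for Q
  have "((\<lambda>Q. inverse (kk Q / Q) + Q - kk Q * Q) \<longlongrightarrow> inverse 1 + 0 - 0 * 0) (at 0)"
    by (intro tendsto_intros kk_div_tendsto kk_tendsto) simp
  moreover have "eventually (\<lambda>Q. inverse (kk Q / Q) + Q - kk Q * Q = Q * X Q) (at 0)"
    using eventually_unit_disc by eventually_elim (simp add: X_def algebra_simps divide_simps)
  ultimately have 1: "((\<lambda>Q. Q * X Q) \<longlongrightarrow> 1) (at 0)" by (simp add: tendsto_cong)
  have "((\<lambda>Q. pp (Q ^ 2) ^ 4 * pp (Q ^ 5) ^ 2 / (pp Q ^ 2 * pp (Q ^ 10) ^ 4)) \<longlongrightarrow> 1 ^ 4 * 1 ^ 2 / (1 ^ 2 * 1 ^ 4)) (at 0)"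
    by (intro tendsto_intros pp_tendsto_0) (auto intro!: tendsto_eq_intros)
  moreover have "eventually (\<lambda>Q. pp (Q ^ 2) ^ 4 * pp (Q ^ 5) ^ 2 / (pp Q ^ 2 * pp (Q ^ 10) ^ 4) = Q * xprod Q) (at 0)"
    using eventually_unit_disc by eventually_elim (simp add: xprod_def)
  ultimately have 2: "((\<lambda>Q. Q * xprod Q) \<longlongrightarrow> 1) (at 0)" by (simp add: tendsto_cong)
  have "((\<lambda>Q. (Q * X Q) / (Q * xprod Q)) \<longlongrightarrow> 1 / 1) (at 0)"
    by (intro tendsto_intros 1 2) simp
  moreover have "eventually (\<lambda>Q. (Q * X Q) / (Q * xprod Q) = X Q / xprod Q) (at 0)"
    using eventually_unit_disc by eventually_elim simp
  ultimately have "((\<lambda>Q. X Q / xprod Q) \<longlongrightarrow> 1) (at 0)" by (simp add: tendsto_cong)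
  then have "eventually (\<lambda>Q. dist (X Q / xprod Q) 1 < 1 / 2) (at 0)"
    by (rule tendstoD) simp
  moreover have "eventually (\<lambda>Q. kk Q \<noteq> 1) (at 0)" "eventually (\<lambda>Q. kk Q \<noteq> - 1) (at 0)"
    using tendsto_imp_eventually_ne[OF kk_tendsto] by auto
  ultimately show ?thesis using eventually_unit_disc
  proof eventually_elim
    case (elim Q)
    then have Q: "norm Q < 1" "Q \<noteq> 0" and k1: "1 - kk Q \<noteq> 0" "1 + kk Q \<noteq> 0"
      by (auto simp: add_eq_0_iff)
    have Q2: "norm (Q ^ 2) < 1" "Q ^ 2 \<noteq> 0" using norm_power_less_1[OF Q(1)] Q by simp_all
    note nz = pp_nonzero[OF Q(1)] pp_power_nonzero[OF Q(1), of 2] pp_power_nonzero[OF Q(1), of 5] pp_power_nonzero[OF Q(1), of 10]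
    note alg = level_ten_algebra[OF kk_nonzero[OF Q] k1 Q(2) bb_nonzero[OF Q] bb_nonzero[OF Q2] kk_def kk_relations(1)[OF Q]]
    define W Y where "W = 1 / kk Q - kk Q" and "Y = 1 / kk Q - 4 - kk Q"
    define e1 e2 where "e1 = pp Q ^ 6 / (Q * pp (Q ^ 5) ^ 6)" and "e2 = pp (Q ^ 2) ^ 6 / (Q ^ 2 * pp (Q ^ 10) ^ 6)"
    have e1: "e1 = X Q * Y ^ 2 / W ^ 2"
      unfolding X_def Y_def W_def alg(1)[symmetric] e1_def pp_quotient_6[OF Q]
      using nz Q bb_nonzero[OF Q] by (simp add: field_simps power2_eq_square)
    have "(Q ^ 2) ^ 5 = Q ^ 10" by (simp flip: power_mult)
    then have e2: "e2 = X Q ^ 2 * Y / W"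
      unfolding X_def Y_def W_def alg(2)[symmetric] e2_def pp_quotient_6[OF Q2]
      using nz Q bb_nonzero[OF Q2] by (simp add: field_simps power2_eq_square)
    have W: "wprod Q = W" unfolding W_def by (rule kk_relations(2)[OF Q])
    have nzp: "wprod Q \<noteq> 0" "xprod Q \<noteq> 0" "yprod Q \<noteq> 0" "e1 \<noteq> 0" "e2 \<noteq> 0"
      using nz Q by (auto simp: wprod_def xprod_def yprod_def e1_def e2_def)
    then have W0: "W \<noteq> 0" "X Q \<noteq> 0" "Y \<noteq> 0" using W e1 by auto
    \<comment> \<open>W and Y cancel in this combination.\<close>
    have "X Q ^ 3 = e2 ^ 2 / e1"
      unfolding e1 e2 using W0 by (simp add: field_simps eval_nat_numeral)
    also have "\<dots> = xprod Q ^ 3"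
      unfolding e1_def e2_def xprod_def using nz Q by (simp add: field_simps eval_nat_numeral)
    finally have "(X Q / xprod Q) ^ 3 = 1" using nzp by (simp add: power_divide)
    then have "X Q / xprod Q = 1" by (rule cube_root_near_1) (use elim(1) in \<open>simp add: dist_norm\<close>)
    then have X: "xprod Q = X Q" using nzp by simp
    have "Y = e2 * wprod Q / xprod Q ^ 2"
      unfolding e2 W X using W0 by (simp add: field_simps)
    also have "\<dots> = 1 / yprod Q"
      unfolding e2_def wprod_def xprod_def yprod_def using nz Q by (simp add: field_simps eval_nat_numeral)
    finally show ?case using Q k1 kk_nonzero[OF Q] X by (simp add: X_def Y_def)
  qed
qed

section \<open>The modular equation for the functions\<close>

definition zf :: "complex \<Rightarrow> complex" where
  "zf q = q ^ 2 * pp (q ^ 50) / pp (q ^ 2)"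

lemma m_algebra:
  fixes K :: complex
  assumes nz: "K \<noteq> 0" "1 - K \<noteq> 0" "1 + K \<noteq> 0"
  defines "m \<equiv> (1 + K) / (1 - K)"
  shows "1 / K + 1 - K = (m ^ 2 + 4 * m - 1) / (m ^ 2 - 1)" "1 / K - 4 - K = 4 * (1 + m - m ^ 2) / (m ^ 2 - 1)"
    and "m ^ 2 - 1 \<noteq> 0" "m \<noteq> 0" "K * (m + 1) = m - 1"
proof -
  define D where "D = 1 - K"
  have K: "K = 1 - D" and m: "m = (2 - D) / D" and D: "D \<noteq> 0"
    using nz by (simp_all add: D_def m_def)
  have m2: "m ^ 2 - 1 = 4 * K / D ^ 2"
    unfolding m K using D by (simp add: field_simps power2_eq_square)
  show "m ^ 2 - 1 \<noteq> 0" unfolding m2 using nz D by simp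
  show "m \<noteq> 0" using nz by (simp add: m_def)
  show "K * (m + 1) = m - 1" unfolding m K using D by (simp add: field_simps)
  have red: "4 * A / D ^ 2 / (4 * K / D ^ 2) = A / K" for A
    using D nz(1) by (simp add: field_simps)
  have num: "m ^ 2 + 4 * m - 1 = 4 * (1 + K - K ^ 2) / D ^ 2" "4 * (1 + m - m ^ 2) = 4 * (1 - 4 * K - K ^ 2) / D ^ 2"
    unfolding m K using D by (simp_all add: field_simps power2_eq_square)
  show "1 / K + 1 - K = (m ^ 2 + 4 * m - 1) / (m ^ 2 - 1)" "1 / K - 4 - K = 4 * (1 + m - m ^ 2) / (m ^ 2 - 1)"
    unfolding m2 num red using nz by (simp_all add: field_simps power2_eq_square)
qed

text \<open>By the five-dissection, \<open>pp q\<close> and \<open>pp (q^2)\<close> are eta factors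
  times polynomials in v = q \<open>bb (q^5)\<close>. So 1/y + 4 = \<open>wprod q\<close> becomes an
  equation between y, v and the parameter M of q^5, and v^5 is rational in M. The second claim is a
  bare identity of eta quotients after writing 1 + 4y = y w and 1 + 5y = y x.\<close>

lemma eventually_modular:
  "eventually (\<lambda>q. Phi (yprod q) (yprod (q ^ 5)) = 0 \<and>
     zf q ^ 2 * ((1 + 4 * yprod q) ^ 3 * (1 + 5 * yprod (q ^ 5)) ^ 4) = yprod q ^ 4 * (1 + 4 * yprod (q ^ 5))) (at 0)"
proof -
  have fl: "filterlim (\<lambda>q::complex. q ^ 5) (at 0) (at 0)" by (rule filterlim_power_at_0) simp
  define m where "m Q = (1 + kk Q) / (1 - kk Q)" for Q
  have "((\<lambda>q. m (q ^ 5)) \<longlongrightarrow> (1 + 0) / (1 - 0)) (at 0)"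
    unfolding m_def by (intro tendsto_intros filterlim_compose[OF kk_tendsto fl]) simp
  then have m1: "((\<lambda>q. m (q ^ 5)) \<longlongrightarrow> 1) (at 0)" by simp
  \<comment> \<open>The extraneous factor of \<open>modular_equation_aux\<close>; it stays away from
    0 because m tends to 1.\<close>
  define f where "f m = m^8 + 6 * m^7 - 3 * m^6 - 42 * m^5 + 20 * m^4 + 42 * m^3 - 3 * m^2 - 6 * m + 1" for m :: complex
  have "((\<lambda>q. f (m (q ^ 5))) \<longlongrightarrow> 1^8 + 6 * 1^7 - 3 * 1^6 - 42 * 1^5 + 20 * 1^4 + 42 * 1^3 - 3 * 1^2 - 6 * 1 + 1) (at 0)"
    unfolding f_def by (intro tendsto_intros m1)
  then have "eventually (\<lambda>q. f (m (q ^ 5)) \<noteq> 0) (at 0)"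
    by (rule tendsto_imp_eventually_ne) simp
  moreover have "((\<lambda>q. 1 + m (q ^ 5) - m (q ^ 5) ^ 2) \<longlongrightarrow> 1 + 1 - 1 ^ 2) (at 0)"
    by (intro tendsto_intros m1)
  then have "eventually (\<lambda>q. 1 + m (q ^ 5) - m (q ^ 5) ^ 2 \<noteq> 0) (at 0)"
    by (rule tendsto_imp_eventually_ne) simp
  moreover note eventually_level_ten eventually_compose_filterlim[OF eventually_level_ten fl]
  ultimately show ?thesis
  proof eventually_elim
    case (elim q)
    define Q where "Q = q ^ 5"
    have q: "norm q < 1" "q \<noteq> 0" using elim by auto
    have Q: "norm Q < 1" "Q \<noteq> 0" using elim by (auto simp: Q_def)
    have Q2: "norm (Q ^ 2) < 1" "Q ^ 2 \<noteq> 0" using norm_power_less_1[OF Q(1)] Q by simp_all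
    have kq: "1 / yprod q = 1 / kk q - 4 - kk q" and K: "kk Q \<noteq> 0" "1 - kk Q \<noteq> 0" "1 + kk Q \<noteq> 0"
      and xQ: "xprod Q = 1 / kk Q + 1 - kk Q" and yQ: "1 / yprod Q = 1 / kk Q - 4 - kk Q"
      and f: "f (m Q) \<noteq> 0" and g: "1 + m Q - m Q ^ 2 \<noteq> 0"
      using elim by (auto simp: Q_def)
    define M where "M = m Q"
    note ma = m_algebra[OF K, folded m_def, folded M_def]
    have nzq: "pp (q ^ k) \<noteq> 0" if "k > 0" for k by (rule pp_power_nonzero[OF q(1) that])
    have pq: "Q ^ 2 = q ^ 10" "Q ^ 5 = q ^ 25" "Q ^ 10 = q ^ 50" by (simp_all add: Q_def flip: power_mult)
    have y0: "yprod q \<noteq> 0" "yprod Q \<noteq> 0"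
      using q nzq[of 1] nzq[of 2] nzq[of 5] nzq[of 10] nzq[of 25] nzq[of 50] Q
      by (auto simp: yprod_def pq) (auto simp: Q_def)
    define v where "v = q * bb Q"
    have v0: "v \<noteq> 0" using q bb_nonzero[OF Q] by (simp add: v_def)
    have d: "bb (Q ^ 2) = M * bb Q ^ 2"
      using kk_relations(1)[OF Q] K by (simp add: M_def m_def field_simps)
    have v5: "v ^ 5 * M ^ 2 = kk Q"
      by (simp only: v_def power_mult_distrib Q_def[symmetric] kk_def d; simp add: eval_nat_numeral)
    have T: "v ^ 5 * M ^ 2 * (M + 1) = M - 1" unfolding v5 by (rule ma)
    have E1: "pp q * v = pp (Q ^ 5) * (q * (1 - v - v ^ 2))"
    proof -
      have e: "pp q = pp (Q ^ 5) * (1 / bb Q - q - q ^ 2 * bb Q)"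
        unfolding aa_eq[OF Q, symmetric] by (rule pp_dissect'(1)[OF _ Q]) (simp add: Q_def)
      show ?thesis unfolding e v_def using bb_nonzero[OF Q]
        by (simp add: field_simps power2_eq_square)
    qed
    have E2: "pp (q ^ 2) * (M * v ^ 2) = pp (Q ^ 10) * (q ^ 2 * (1 - M * v ^ 2 - M ^ 2 * v ^ 4))"
    proof -
      have e: "pp (q ^ 2) = pp (Q ^ 10) * (1 / (M * bb Q ^ 2) - q ^ 2 - q ^ 4 * (M * bb Q ^ 2))"
        unfolding d[symmetric] aa_eq[OF Q2, symmetric] by (rule pp_dissect'(2)[OF _ Q]) (simp add: Q_def)
      show ?thesis unfolding e v_def using bb_nonzero[OF Q] ma(4)
        by (simp add: field_simps eval_nat_numeral)
    qed
    have Wq: "wprod q = (1 + 4 * yprod q) / yprod q"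
    proof -
      have "wprod q = 1 / yprod q + 4" unfolding kq kk_relations(2)[OF q] by simp
      then show ?thesis using y0 by (simp add: field_simps)
    qed
    have main: "4 * yprod q * (1 + M - M^2) * (1 - M * v^2 - M^2 * v^4) = (1 + 4 * yprod q) * (M^2 + 4 * M - 1) * (M * v * (1 - v - v^2))"
    proof -
      have ratio: "xprod Q * yprod Q = pp (q ^ 10) ^ 5 * pp (q ^ 25) / (pp (q ^ 5) ^ 5 * pp (q ^ 50))"
        unfolding xprod_def yprod_def pq using q Q nzq[of 5] nzq[of 10] nzq[of 25] nzq[of 50]
        by (simp add: field_simps) (simp add: Q_def eval_nat_numeral)
      \<comment> \<open>The product \<open>xprod Q * yprod Q\<close>, which is rational in M,
        cancels exactly the eta factors at q^5 and q^10, leaving only those covered by the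
        dissections E1 and E2.\<close>
      have H: "wprod q * (xprod Q * yprod Q) * (pp q * q) * pp (Q ^ 10) = pp (q ^ 2) * pp (Q ^ 5)"
        unfolding ratio wprod_def pq using q nzq[of 1] nzq[of 2] nzq[of 5] nzq[of 10] nzq[of 25] nzq[of 50]
        by (simp add: field_simps)
      have "wprod q * (xprod Q * yprod Q) * (pp q * v) * pp (Q ^ 10) * (q * M * v ^ 2)
          = (wprod q * (xprod Q * yprod Q) * (pp q * q) * pp (Q ^ 10)) * (M * v ^ 2 * v)"
        by (simp only: mult_ac)
      also have "\<dots> = (pp (q ^ 2) * (M * v ^ 2)) * pp (Q ^ 5) * v"
        unfolding H by (simp only: mult_ac)
      finally have "wprod q * (xprod Q * yprod Q) * (pp q * v) * pp (Q ^ 10) * (q * M * v ^ 2) = (pp (q ^ 2) * (M * v ^ 2)) * pp (Q ^ 5) * v" .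
      then have "wprod q * (xprod Q * yprod Q) * (1 - v - v ^ 2) * (M * v) * (pp (Q ^ 5) * pp (Q ^ 10) * q ^ 2 * v)
          = (1 - M * v ^ 2 - M ^ 2 * v ^ 4) * (pp (Q ^ 5) * pp (Q ^ 10) * q ^ 2 * v)"
        unfolding E1 E2 by (simp only: mult_ac power2_eq_square)
      then have "wprod q * (xprod Q * yprod Q) * (1 - v - v ^ 2) * (M * v) = 1 - M * v ^ 2 - M ^ 2 * v ^ 4"
        using nzq[of 25] nzq[of 50] q v0 by (simp add: pq)
      moreover have "xprod Q * yprod Q = (M^2 + 4 * M - 1) / (4 * (1 + M - M^2))"
      proof -
        have "yprod Q = inverse (1 / yprod Q)" by simp
        also have "\<dots> = (M ^ 2 - 1) / (4 * (1 + M - M ^ 2))"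
          unfolding yQ ma(2) by (rule inverse_divide)
        finally have "yprod Q = (M ^ 2 - 1) / (4 * (1 + M - M ^ 2))" .
        then show ?thesis unfolding xQ ma(1) using ma(3) by simp
      qed
      moreover have "4 * y * h * A = a * n * (t * s)" if "a / y * (n / (4 * h)) * s * t = A" "y \<noteq> 0" "h \<noteq> 0"
        for y h A a n s t :: complex
        using that(2,3) unfolding that(1)[symmetric] by simp
      ultimately show ?thesis unfolding Wq using y0(1) g[folded M_def] by metis
    qed
    have "4 * (1 + M - M ^ 2) * yprod Q = M ^ 2 - 1"
      using yQ[unfolded ma(2)] y0 ma(3) g[folded M_def] by (simp add: field_simps)
    from modular_equation[OF main T f[unfolded f_def, folded M_def] g[folded M_def] this]
    have "Phi (yprod q) (yprod Q) = 0" .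
    moreover have "zf q ^ 2 * ((1 + 4 * yprod q) ^ 3 * (1 + 5 * yprod Q) ^ 4) = yprod q ^ 4 * (1 + 4 * yprod Q)"
    proof -
      have "wprod Q = 1 / yprod Q + 4" unfolding yQ kk_relations(2)[OF Q] by simp
      then have w: "1 + 4 * yprod Q = yprod Q * wprod Q" using y0 by (simp add: field_simps)
      have "xprod Q = 1 / yprod Q + 5" unfolding yQ xQ by simp
      then have x: "1 + 5 * yprod Q = yprod Q * xprod Q" using y0 by (simp add: field_simps)
      have w': "1 + 4 * yprod q = yprod q * wprod q" using Wq y0 by simp
      note nz = nzq[of 1] nzq[of 2] nzq[of 5] nzq[of 10] nzq[of 25] nzq[of 50]
      have 1: "yprod q * wprod q = pp (q ^ 2) ^ 2 * pp (q ^ 5) ^ 4 / (pp q ^ 4 * pp (q ^ 10) ^ 2)"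
        unfolding yprod_def wprod_def using q nz by (simp add: field_simps; simp add: eval_nat_numeral)
      have 2: "yprod Q * xprod Q = pp (q ^ 10) ^ 5 * pp (q ^ 25) / (pp (q ^ 5) ^ 5 * pp (q ^ 50))"
        unfolding yprod_def xprod_def pq using Q nz[folded Q_def] unfolding Q_def[symmetric]
        by (simp add: field_simps; simp add: eval_nat_numeral)
      have 3: "yprod Q * wprod Q = pp (q ^ 10) ^ 2 * pp (q ^ 25) ^ 4 / (pp (q ^ 5) ^ 4 * pp (q ^ 50) ^ 2)"
        unfolding yprod_def wprod_def pq using Q nz[folded Q_def] unfolding Q_def[symmetric]
        by (simp add: field_simps; simp add: eval_nat_numeral)
      have gen: "(q ^ 2 * p50 / p2) ^ 2 * ((p2 ^ 2 * p5 ^ 4 / (p1 ^ 4 * p10 ^ 2)) ^ 3 * (p10 ^ 5 * p25 / (p5 ^ 5 * p50)) ^ 4)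
          = (q * (p2 * p10 ^ 3 / (p1 ^ 3 * p5))) ^ 4 * (p10 ^ 2 * p25 ^ 4 / (p5 ^ 4 * p50 ^ 2))"
        if "p1 \<noteq> 0" "p2 \<noteq> 0" "p5 \<noteq> 0" "p10 \<noteq> 0" "p25 \<noteq> 0" "p50 \<noteq> 0" for p1 p2 p5 p10 p25 p50 :: complex
        using that by (simp add: power_divide power_mult_distrib field_simps flip: power_mult power_add)
      show ?thesis unfolding w x w' 1 2 3 unfolding zf_def yprod_def
        by (rule gen) (use nz in simp_all)
    qed
    ultimately show ?case by (simp add: Q_def)
  qed
qed

section \<open>Summation over the fifth roots of unity\<close>

lemma pp_power_holomorphic: "k > 0 \<Longrightarrow> (\<lambda>z. pp (z ^ k)) holomorphic_on ball 0 1"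
  by (rule holomorphic_on_compose_gen[OF _ pp_holomorphic, unfolded o_def])
     (auto intro!: holomorphic_intros simp: norm_power power_less_one_iff)

lemma pp_ball_nonzero: "z \<in> ball 0 1 \<Longrightarrow> k > 0 \<Longrightarrow> pp (z ^ k) \<noteq> 0"
  by (intro pp_power_nonzero) auto

lemma yprod_holomorphic: "yprod holomorphic_on ball 0 1"
  unfolding yprod_def[abs_def] using pp_power_holomorphic[of 1] pp_ball_nonzero[of _ 1]
  by (intro holomorphic_intros pp_power_holomorphic) (auto simp: pp_ball_nonzero)

lemma zf_holomorphic: "zf holomorphic_on ball 0 1"
  unfolding zf_def[abs_def]
  by (intro holomorphic_intros pp_power_holomorphic) (auto simp: pp_ball_nonzero)

lemma yprod_0 [simp]: "yprod 0 = 0" by (simp add: yprod_def)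

lemma yprod_div_tendsto: "((\<lambda>q. yprod q / q) \<longlongrightarrow> 1) (at 0)"
proof -
  have "((\<lambda>q. pp (q ^ 2) * pp (q ^ 10) ^ 3 / (pp q ^ 3 * pp (q ^ 5))) \<longlongrightarrow> 1 * 1 ^ 3 / (1 ^ 3 * 1)) (at 0)"
    by (intro tendsto_intros pp_tendsto_0) (auto intro!: tendsto_eq_intros)
  moreover have "eventually (\<lambda>q. pp (q ^ 2) * pp (q ^ 10) ^ 3 / (pp q ^ 3 * pp (q ^ 5)) = yprod q / q) (at 0)"
    using eventually_unit_disc by eventually_elim (simp add: yprod_def)
  ultimately show ?thesis by (simp add: tendsto_cong)
qed

lemma yprod_tendsto_0: "(yprod \<longlongrightarrow> 0) (at 0)"
proof -
  have "((\<lambda>q. yprod q / q * q) \<longlongrightarrow> 1 * 0) (at 0)" by (intro tendsto_intros yprod_div_tendsto)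
  moreover have "eventually (\<lambda>q. yprod q / q * q = yprod q) (at 0)"
    using eventually_unit_disc by eventually_elim simp
  ultimately show ?thesis by (simp add: tendsto_cong)
qed

lemma zf_div_tendsto: "((\<lambda>q. zf q / q ^ 2) \<longlongrightarrow> 1) (at 0)"
proof -
  have "((\<lambda>q. pp (q ^ 50) / pp (q ^ 2)) \<longlongrightarrow> 1 / 1) (at 0)"
    by (intro tendsto_intros pp_tendsto_0) (auto intro!: tendsto_eq_intros)
  moreover have "eventually (\<lambda>q. pp (q ^ 50) / pp (q ^ 2) = zf q / q ^ 2) (at 0)"
    using eventually_unit_disc by eventually_elim (simp add: zf_def)
  ultimately show ?thesis by (simp add: tendsto_cong)
qed

lemma yprod_power_tendsto: "((\<lambda>q. yprod (q ^ 5)) \<longlongrightarrow> 0) (at 0)"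
  by (rule filterlim_compose[OF yprod_tendsto_0 filterlim_power_at_0]) simp

lemma yprod_power_div_tendsto: "((\<lambda>q. yprod (q ^ 5) / q ^ 2) \<longlongrightarrow> 0) (at 0)"
proof -
  have "((\<lambda>q. yprod (q ^ 5) / q ^ 5 * q ^ 3) \<longlongrightarrow> 1 * 0 ^ 3) (at 0)"
    by (intro tendsto_mult filterlim_compose[OF yprod_div_tendsto filterlim_power_at_0] tendsto_power tendsto_ident_at) simp
  moreover have "eventually (\<lambda>q. yprod (q ^ 5) / q ^ 5 * q ^ 3 = yprod (q ^ 5) / q ^ 2) (at 0)"
    using eventually_unit_disc by eventually_elim (simp add: field_simps flip: power_add)
  ultimately show ?thesis by (simp add: tendsto_cong)
qed

text \<open>Separates the terms free of Y. As Y has order q^5, these alone give the leading term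
  q^2.\<close>

lemma res1_decompose:
  fixes x Y :: complex
  shows "evx res1 x Y = x ^ 2 * (1 + 9 * x + 25 * x ^ 2) + Y * (15 + 325 * Y + 2625 * Y ^ 2 + 9375 * Y ^ 3 + 12500 * Y ^ 4
    + (220 + 4900 * Y + 40500 * Y ^ 2 + 147500 * Y ^ 3 + 200000 * Y ^ 4) * x
    + (1230 + 27825 * Y + 234500 * Y ^ 2 + 870000 * Y ^ 3 + 1200000 * Y ^ 4) * x ^ 2
    + (3100 + 70500 * Y + 604000 * Y ^ 2 + 2280000 * Y ^ 3 + 3200000 * Y ^ 4) * x ^ 3
    + (2980 + 67200 * Y + 584000 * Y ^ 2 + 2240000 * Y ^ 3 + 3200000 * Y ^ 4) * x ^ 4)"
  unfolding evx_unfold by algebra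

text \<open>\<open>residue_square\<close> and the formula for \<open>zf q ^ 2\<close> show that the
  two sides have equal squares. Both are asymptotic to q^2, so their sum does not vanish and they
  are equal.\<close>

lemma eventually_residue:
  "eventually (\<lambda>q. zf q * evx res0 (yprod q) (yprod (q ^ 5)) = evx res1 (yprod q) (yprod (q ^ 5))) (at 0)"
proof -
  define x Y where "x = yprod" and "Y q = yprod (q ^ 5)" for q
  have x0: "(x \<longlongrightarrow> 0) (at 0)" and xq: "((\<lambda>q. x q / q) \<longlongrightarrow> 1) (at 0)"
    and Y0: "(Y \<longlongrightarrow> 0) (at 0)" and Yq: "((\<lambda>q. Y q / q ^ 2) \<longlongrightarrow> 0) (at 0)"
    unfolding x_def Y_def by (rule yprod_tendsto_0 yprod_div_tendsto yprod_power_tendsto yprod_power_div_tendsto)+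
  define G where "G x Y = 15 + 325 * Y + 2625 * Y ^ 2 + 9375 * Y ^ 3 + 12500 * Y ^ 4
    + (220 + 4900 * Y + 40500 * Y ^ 2 + 147500 * Y ^ 3 + 200000 * Y ^ 4) * x
    + (1230 + 27825 * Y + 234500 * Y ^ 2 + 870000 * Y ^ 3 + 1200000 * Y ^ 4) * x ^ 2
    + (3100 + 70500 * Y + 604000 * Y ^ 2 + 2280000 * Y ^ 3 + 3200000 * Y ^ 4) * x ^ 3
    + (2980 + 67200 * Y + 584000 * Y ^ 2 + 2240000 * Y ^ 3 + 3200000 * Y ^ 4) * x ^ 4" for x Y :: complex
  have "((\<lambda>q. (x q / q) ^ 2 * (1 + 9 * x q + 25 * x q ^ 2) + (Y q / q ^ 2) * G (x q) (Y q))
      \<longlongrightarrow> 1 ^ 2 * (1 + 9 * 0 + 25 * 0 ^ 2) + 0 * G 0 0) (at 0)"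
    unfolding G_def by (intro tendsto_intros x0 xq Y0 Yq)
  moreover have "eventually (\<lambda>q. (x q / q) ^ 2 * (1 + 9 * x q + 25 * x q ^ 2) + (Y q / q ^ 2) * G (x q) (Y q)
      = evx res1 (x q) (Y q) / q ^ 2) (at 0)"
    using eventually_unit_disc
    by eventually_elim (simp add: res1_decompose G_def[symmetric] power_divide add_divide_distrib)
  ultimately have 1: "((\<lambda>q. evx res1 (x q) (Y q) / q ^ 2) \<longlongrightarrow> 1) (at 0)" by (simp add: tendsto_cong)
  have "((\<lambda>q. evx res0 (x q) (Y q)) \<longlongrightarrow> evx res0 0 0) (at 0)"
    unfolding evx_unfold by (intro tendsto_intros x0 Y0)
  moreover have "evx res0 0 (0::complex) = 1" by (simp add: evx_unfold)
  ultimately have r0: "((\<lambda>q. evx res0 (x q) (Y q)) \<longlongrightarrow> 1) (at 0)" by simp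
  have "((\<lambda>q. zf q / q ^ 2 * evx res0 (x q) (Y q) + evx res1 (x q) (Y q) / q ^ 2) \<longlongrightarrow> 1 * 1 + 1) (at 0)"
    by (intro tendsto_intros zf_div_tendsto 1 r0)
  then have ne: "eventually (\<lambda>q. zf q / q ^ 2 * evx res0 (x q) (Y q) + evx res1 (x q) (Y q) / q ^ 2 \<noteq> 0) (at 0)"
    by (rule tendsto_imp_eventually_ne) simp
  have "((\<lambda>q. (1 + 4 * x q) ^ 3 * (1 + 5 * Y q) ^ 4) \<longlongrightarrow> (1 + 4 * 0) ^ 3 * (1 + 5 * 0) ^ 4) (at 0)"
    by (intro tendsto_intros x0 Y0)
  then have "eventually (\<lambda>q. (1 + 4 * x q) ^ 3 * (1 + 5 * Y q) ^ 4 \<noteq> 0) (at 0)"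
    by (rule tendsto_imp_eventually_ne) simp
  with ne eventually_modular show ?thesis unfolding Y_def[symmetric] unfolding x_def[symmetric]
  proof eventually_elim
    case (elim q)
    define R0 R1 where "R0 = evx res0 (x q) (Y q)" and "R1 = evx res1 (x q) (Y q)"
    define c where "c = (1 + 4 * x q) ^ 3 * (1 + 5 * Y q) ^ 4"
    have z: "zf q ^ 2 * c = x q ^ 4 * (1 + 4 * Y q)" using elim by (simp add: c_def)
    have "R1 ^ 2 * c - R0 ^ 2 * (x q ^ 4 * (1 + 4 * Y q)) = 0"
      using residue_square[of "x q" "Y q"] elim by (simp add: R0_def R1_def c_def mult.assoc)
    then have "(R1 ^ 2 - (zf q * R0) ^ 2) * c = 0"
      unfolding z[symmetric] by (simp add: algebra_simps power_mult_distrib)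
    then have "R1 ^ 2 - (zf q * R0) ^ 2 = 0" using elim by (simp add: c_def)
    then have "(R1 - zf q * R0) * (zf q * R0 + R1) = 0" by (simp add: algebra_simps power2_eq_square)
    moreover have "zf q * R0 + R1 \<noteq> 0" using elim by (auto simp: R0_def R1_def simp flip: add_divide_distrib)
    ultimately show ?case by (simp add: R0_def R1_def)
  qed
qed

definition dPhi :: "complex \<Rightarrow> complex \<Rightarrow> complex" where
  "dPhi x Y = 5 * x ^ 4 - (\<Sum>j<5. mcoef j Y * (of_nat j * x ^ (j - 1)))"

lemma mcoef_derivative:
  assumes "(g has_field_derivative g') (at z)" "j < 5"
  shows "((\<lambda>q. mcoef j (g q)) has_field_derivative res0 j (g z) * g') (at (z::complex))"
  using assms(1) less_5_cases[OF assms(2)]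
  by (elim disjE; hypsubst; unfold mcoef.simps res0.simps)
     (auto intro!: derivative_eq_intros simp: algebra_simps)

lemma Phi_derivative:
  assumes f: "(f has_field_derivative f') (at z)" and g: "(g has_field_derivative g') (at z)"
  shows "((\<lambda>q. Phi (f q) (g q)) has_field_derivative dPhi (f z) (g z) * f' - evx res0 (f z) (g z) * g') (at (z::complex))"
proof -
  have "((\<lambda>q. \<Sum>j<5. mcoef j (g q) * f q ^ j) has_field_derivative
      (\<Sum>j<5. res0 j (g z) * g' * f z ^ j + of_nat j * f z ^ (j - 1) * f' * mcoef j (g z))) (at z)"
    by (intro DERIV_sum) (auto intro!: derivative_eq_intros f mcoef_derivative[OF g])
  moreover have "((\<lambda>q. f q ^ 5) has_field_derivative 5 * f z ^ 4 * f') (at z)"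
    by (auto intro!: derivative_eq_intros f)
  ultimately have "((\<lambda>q. Phi (f q) (g q)) has_field_derivative 5 * f z ^ 4 * f' -
      (\<Sum>j<5. res0 j (g z) * g' * f z ^ j + of_nat j * f z ^ (j - 1) * f' * mcoef j (g z))) (at z)"
    unfolding Phi_def evx_def by (intro DERIV_diff)
  then show ?thesis
    by (rule DERIV_cong) (simp add: dPhi_def evx_def sum.distrib algebra_simps sum_distrib_left)
qed

definition dy :: "complex \<Rightarrow> complex" where "dy q = q * deriv yprod q"

text \<open>Implicit differentiation of the modular equation along q; the factor 5 is the chain rule
  for q^5.\<close>

lemma eventually_dy:
  "eventually (\<lambda>q. dy q * dPhi (yprod q) (yprod (q ^ 5)) = 5 * evx res0 (yprod q) (yprod (q ^ 5)) * dy (q ^ 5)) (at 0)"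
proof -
  obtain d where d: "d > 0" "\<And>q. q \<noteq> 0 \<Longrightarrow> norm q < d \<Longrightarrow> Phi (yprod q) (yprod (q ^ 5)) = 0"
    using eventually_modular unfolding eventually_at by (auto simp: dist_norm)
  have "dy q * dPhi (yprod q) (yprod (q ^ 5)) = 5 * evx res0 (yprod q) (yprod (q ^ 5)) * dy (q ^ 5)"
    if q: "q \<noteq> 0" "norm q < min d 1" for q
  proof -
    have q1: "norm (q ^ 5) < 1" using norm_power_less_1[of q 5] q by simp
    have f: "(yprod has_field_derivative deriv yprod q) (at q)"
      using q by (intro holomorphic_derivI[OF yprod_holomorphic]) auto
    have g5: "(yprod has_field_derivative deriv yprod (q ^ 5)) (at (q ^ 5))"
      using q1 by (intro holomorphic_derivI[OF yprod_holomorphic]) auto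
    have p5: "((\<lambda>q. q ^ 5) has_field_derivative 5 * q ^ 4) (at q)"
      by (auto intro!: derivative_eq_intros)
    have g: "((\<lambda>q. yprod (q ^ 5)) has_field_derivative deriv yprod (q ^ 5) * (5 * q ^ 4)) (at q)"
      using DERIV_chain2[OF g5 p5] .
    have "((\<lambda>q. 0) has_field_derivative dPhi (yprod q) (yprod (q ^ 5)) * deriv yprod q
        - evx res0 (yprod q) (yprod (q ^ 5)) * (deriv yprod (q ^ 5) * (5 * q ^ 4))) (at q)"
      by (rule has_field_derivative_transform_within_open[OF Phi_derivative[OF f g], of "ball 0 d - {0}"])
         (use q d in auto)
    then have "dPhi (yprod q) (yprod (q ^ 5)) * deriv yprod q
        - evx res0 (yprod q) (yprod (q ^ 5)) * (deriv yprod (q ^ 5) * (5 * q ^ 4)) = 0"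
      using DERIV_unique[OF _ DERIV_const] by blast
    then have "q * (dPhi (yprod q) (yprod (q ^ 5)) * deriv yprod q)
        = q * (evx res0 (yprod q) (yprod (q ^ 5)) * (deriv yprod (q ^ 5) * (5 * q ^ 4)))"
      by simp
    then show ?thesis unfolding dy_def by (simp add: mult_ac eval_nat_numeral)
  qed
  then show ?thesis unfolding eventually_at using d(1) by (intro exI[of _ "min d 1"]) (auto simp: dist_norm)
qed

section \<open>Lagrange interpolation at the roots of Phi\<close>

lemma lagrange_poly:
  fixes y :: "nat \<Rightarrow> complex" and r :: "complex poly"
  assumes inj: "inj_on y {..<n}" and deg: "degree r < n"
  shows "r = (\<Sum>i<n. smult (poly r (y i) / (\<Prod>j\<in>{..<n} - {i}. y i - y j)) (\<Prod>j\<in>{..<n} - {i}. [:- y j, 1:]))"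
    (is "r = ?s")
proof (rule poly_eqI_degree[of "y ` {..<n}"])
  have card: "card (y ` {..<n}) = n" using inj by (simp add: card_image)
  show "card (y ` {..<n}) > degree r" using deg card by simp
  have "degree ?s \<le> n - 1"
  proof (rule degree_sum_le)
    fix i assume i: "i \<in> {..<n}"
    have "degree (\<Prod>j\<in>{..<n} - {i}. [:- y j, 1:]) \<le> (\<Sum>j\<in>{..<n} - {i}. degree [:- y j, 1:])"
      using degree_prod_sum_le[of "{..<n} - {i}" "\<lambda>j. [:- y j, 1:]"] by (simp add: o_def)
    also have "\<dots> = n - 1" using i by simp
    finally show "degree (smult (poly r (y i) / (\<Prod>j\<in>{..<n} - {i}. y i - y j)) (\<Prod>j\<in>{..<n} - {i}. [:- y j, 1:])) \<le> n - 1"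
      using degree_smult_le order_trans by blast
  qed simp
  then show "card (y ` {..<n}) > degree ?s" using deg card by simp
  fix x assume "x \<in> y ` {..<n}"
  then obtain k where k: "k < n" "x = y k" by auto
  have nz: "(\<Prod>j\<in>{..<n} - {k}. y k - y j) \<noteq> 0" using k inj by (auto simp: inj_on_def)
  have z: "(\<Prod>j\<in>{..<n} - {i}. y k - y j) = 0" if "i < n" "i \<noteq> k" for i
    using that k by (intro prod_zero) auto
  have "poly ?s x = (\<Sum>i<n. if i = k then poly r (y k) else 0)"
    unfolding poly_sum k by (intro sum.cong) (use nz z k in \<open>auto simp: poly_prod\<close>)
  then show "poly r x = poly ?s x" using k by simp
qed

text \<open>Compares coefficients of x^(n-1) in Lagrange's formula, whose basis products are monic
  of that degree.\<close>

lemma lagrange_coeff: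
  fixes y :: "nat \<Rightarrow> complex" and r :: "complex poly"
  assumes inj: "inj_on y {..<n}" and deg: "degree r < n"
  shows "(\<Sum>i<n. poly r (y i) / (\<Prod>j\<in>{..<n} - {i}. y i - y j)) = coeff r (n - 1)"
proof -
  have "coeff (\<Prod>j\<in>{..<n} - {i}. [:- y j, 1:]) (n - 1) = 1" if "i < n" for i
  proof -
    have "degree (\<Prod>j\<in>{..<n} - {i}. [:- y j, 1:]) = n - 1"
      using that by (subst degree_prod_eq_sum_degree) auto
    moreover have "lead_coeff (\<Prod>j\<in>{..<n} - {i}. [:- y j, 1:]) = 1"
      by (simp add: lead_coeff_prod)
    ultimately show ?thesis by simp
  qed
  moreover have "coeff r (n - 1) = (\<Sum>i<n. poly r (y i) / (\<Prod>j\<in>{..<n} - {i}. y i - y j) * coeff (\<Prod>j\<in>{..<n} - {i}. [:- y j, 1:]) (n - 1))"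
    by (subst lagrange_poly[OF inj deg]) (simp add: coeff_sum)
  ultimately show ?thesis by simp
qed

text \<open>The partial fraction expansion. It sums over the roots a rational function with poles
  elsewhere, as needed for the initial value.\<close>

lemma lagrange_fraction:
  fixes y :: "nat \<Rightarrow> complex" and r :: "complex poly"
  assumes inj: "inj_on y {..<n}" and deg: "degree r < n" and x: "\<forall>i<n. x \<noteq> y i"
  shows "(\<Sum>i<n. poly r (y i) / (\<Prod>j\<in>{..<n} - {i}. y i - y j) / (x - y i)) = poly r x / (\<Prod>j<n. x - y j)"
proof -
  have "poly r x = (\<Sum>i<n. poly r (y i) / (\<Prod>j\<in>{..<n} - {i}. y i - y j) * (\<Prod>j\<in>{..<n} - {i}. x - y j))"
    by (subst lagrange_poly[OF inj deg]) (simp add: poly_sum poly_prod)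
  also have "\<dots> = (\<Sum>i<n. poly r (y i) / (\<Prod>j\<in>{..<n} - {i}. y i - y j) / (x - y i)) * (\<Prod>j<n. x - y j)"
    unfolding sum_distrib_right
  proof (rule sum.cong)
    fix i assume "i \<in> {..<n}"
    then have "(\<Prod>j<n. x - y j) = (x - y i) * (\<Prod>j\<in>{..<n} - {i}. x - y j)" and "x - y i \<noteq> 0"
      using x by (auto simp: prod.remove)
    then show "poly r (y i) / (\<Prod>j\<in>{..<n} - {i}. y i - y j) * (\<Prod>j\<in>{..<n} - {i}. x - y j)
      = poly r (y i) / (\<Prod>j\<in>{..<n} - {i}. y i - y j) / (x - y i) * (\<Prod>j<n. x - y j)" by simp
  qed simp
  finally show ?thesis using x by (simp add: prod_zero_iff)
qed

definition cpoly :: "(nat \<Rightarrow> complex \<Rightarrow> complex) \<Rightarrow> complex \<Rightarrow> complex poly" where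
  "cpoly c Y = (\<Sum>j<5. monom (c j Y) j)"

lemma poly_cpoly [simp]: "poly (cpoly c Y) x = evx c x Y"
  by (simp add: cpoly_def evx_def poly_sum poly_monom)

lemma degree_cpoly: "degree (cpoly c Y) < 5"
proof -
  have "degree (cpoly c Y) \<le> 4"
    unfolding cpoly_def by (intro degree_sum_le) (auto intro: order_trans[OF degree_monom_le])
  then show ?thesis by simp
qed

lemma Phi_roots:
  assumes inj: "inj_on y {..<5::nat}" and root: "\<forall>i<5. Phi (y i) Y = 0"
  shows "Phi x Y = (\<Prod>j<5. x - y j)" and "i < 5 \<Longrightarrow> dPhi (y i) Y = (\<Prod>j\<in>{..<5} - {i}. y i - y j)"
proof -
  define p where "p = monom 1 5 - cpoly mcoef Y"
  have p: "poly p x = Phi x Y" for x by (simp add: p_def Phi_def poly_monom)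
  have l5: "coeff p 5 = 1"
    using degree_cpoly[of mcoef Y] by (simp add: p_def coeff_eq_0)
  have "degree p \<le> 5"
    unfolding p_def using degree_cpoly[of mcoef Y] by (intro degree_diff_le degree_monom_le) simp
  moreover have "5 \<le> degree p" using l5 by (intro le_degree) simp
  ultimately have d5: "degree p = 5" by simp
  define r where "r = (\<Prod>j<5. [:- y j, 1:])"
  have dr: "degree r = 5" unfolding r_def by (subst degree_prod_eq_sum_degree) auto
  have lr: "coeff r 5 = 1" using lead_coeff_prod[of "\<lambda>j. [:- y j, 1:]" "{..<5}"] dr by (simp add: r_def)
  have pr: "p = r"
  proof (rule poly_eqI_degree_lead_coeff[of _ 5 _ "y ` {..<5}"])
    show "card (y ` {..<5}) \<ge> 5" using inj by (simp add: card_image)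
    fix z assume "z \<in> y ` {..<5}"
    then obtain i where i: "i < 5" "z = y i" by auto
    then have "poly p z = 0" using root by (simp add: p)
    moreover have "poly r z = 0" using i by (auto simp: r_def poly_prod intro!: prod_zero)
    ultimately show "poly p z = poly r z" by simp
  qed (simp_all add: d5 dr l5 lr)
  show "Phi x Y = (\<Prod>j<5. x - y j)"
    unfolding p[symmetric] pr r_def by (simp add: poly_prod)
  assume i: "i < 5"
  have "p = [:- y i, 1:] * (\<Prod>j\<in>{..<5} - {i}. [:- y j, 1:])"
    unfolding pr r_def using i by (subst prod.remove[of _ i]) auto
  then have "poly (pderiv p) (y i) = (\<Prod>j\<in>{..<5} - {i}. y i - y j)"
    by (simp only: pderiv_mult) (simp add: pderiv_pCons poly_prod)
  moreover have "poly (pderiv p) x = dPhi x Y" for x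
    unfolding p_def dPhi_def cpoly_def
    by (simp add: pderiv_diff pderiv_monom poly_monom poly_sum mult_ac sum_lessThan_5 pderiv_add)
  ultimately show "dPhi (y i) Y = (\<Prod>j\<in>{..<5} - {i}. y i - y j)" by simp
qed

text \<open>For k below 5 the sum is a leading coefficient in Lagrange's formula; beyond that the
  equation of the roots supplies the recursion of \<open>hs\<close>.\<close>

lemma sum_powers_hs:
  assumes inj: "inj_on y {..<5::nat}" and root: "\<forall>i<5. Phi (y i) Y = 0"
  shows "(\<Sum>i<5. y i ^ k / dPhi (y i) Y) = hs Y k"
proof (induction k rule: less_induct)
  case (less k)
  show ?case
  proof (cases k rule: nat_cases_5)
    case 1
    have "(\<Sum>i<5. y i ^ k / dPhi (y i) Y) = (\<Sum>i<5. poly (monom 1 k) (y i) / (\<Prod>j\<in>{..<5} - {i}. y i - y j))"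
      using Phi_roots(2)[OF inj root] by (intro sum.cong) (auto simp: poly_monom)
    also have "\<dots> = coeff (monom 1 k) (5 - 1)"
      by (rule lagrange_coeff[OF inj]) (use 1 degree_monom_le[of "1::complex" k] in linarith)
    finally show ?thesis using 1 by (simp add: hs_small)
  next
    case (2 m)
    have "y i ^ k = (\<Sum>j<5. mcoef j Y * y i ^ (m + j))" if "i < 5" for i
      using root[rule_format, OF that] unfolding Phi_def evx_def 2 by (simp add: power_add sum_distrib_left mult_ac)
    then have "(\<Sum>i<5. y i ^ k / dPhi (y i) Y) = (\<Sum>i<5. \<Sum>j<5. mcoef j Y * (y i ^ (m + j) / dPhi (y i) Y))"
      by (simp add: sum_divide_distrib)
    also have "\<dots> = (\<Sum>j<5. mcoef j Y * (\<Sum>i<5. y i ^ (m + j) / dPhi (y i) Y))"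
      unfolding sum_distrib_left by (rule sum.swap)
    also have "\<dots> = (\<Sum>j<5. mcoef j Y * hs Y (m + j))"
      using 2 by (intro sum.cong refl arg_cong2[where f = "(*)"] less) auto
    finally show ?thesis unfolding 2 hs_add_5 .
  qed
qed

lemma sum_evx_pw:
  assumes inj: "inj_on y {..<5::nat}" and root: "\<forall>i<5. Phi (y i) Y = 0"
  shows "(\<Sum>i<5. evx c (y i) Y * y i ^ n / dPhi (y i) Y) = pw c Y n"
proof -
  have "(\<Sum>i<5. evx c (y i) Y * y i ^ n / dPhi (y i) Y) = (\<Sum>i<5. \<Sum>j<5. c j Y * (y i ^ (n + j) / dPhi (y i) Y))"
    unfolding evx_def sum_distrib_right sum_divide_distrib power_add by (simp add: mult_ac)
  also have "\<dots> = pw c Y n"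
    unfolding pw_def sum_powers_hs[OF inj root, symmetric] sum_distrib_left by (rule sum.swap)
  finally show ?thesis .
qed

lemma sum_evx_fraction:
  assumes inj: "inj_on y {..<5::nat}" and root: "\<forall>i<5. Phi (y i) Y = 0" and x: "\<forall>i<5. x \<noteq> y i"
  shows "(\<Sum>i<5. evx c (y i) Y / dPhi (y i) Y / (x - y i)) = evx c x Y / Phi x Y"
  using lagrange_fraction[OF inj degree_cpoly x, of c Y] Phi_roots(2)[OF inj root]
  unfolding Phi_roots(1)[OF inj root] by simp

lemma dPhi_nonzero:
  assumes inj: "inj_on y {..<5::nat}" and root: "\<forall>i<5. Phi (y i) Y = 0" and i: "i < 5"
  shows "dPhi (y i) Y \<noteq> 0"
  unfolding Phi_roots(2)[OF inj root i] using inj_onD[OF inj] i by fastforce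

lemma zeta_tendsto: "filterlim (\<lambda>q. zeta ^ i * q) (at 0) (at 0)"
  by (intro filterlim_atI) (auto intro!: tendsto_eq_intros simp: eventually_at_filter zeta_nonzero)

lemma zeta_fifth: "(zeta ^ i * q) ^ 5 = q ^ 5"
  by (simp add: power_mult_distrib zeta_5 flip: power_mult) (simp add: mult.commute[of i] power_mult zeta_5)

lemma eventually_zeta:
  assumes "eventually P (at (0::complex))"
  shows "eventually (\<lambda>q. \<forall>i<5::nat. P (zeta ^ i * q)) (at 0)"
proof -
  have "eventually (\<lambda>q. \<forall>i\<in>{..<5::nat}. P (zeta ^ i * q)) (at 0)"
    by (intro eventually_ball_finite ballI eventually_compose_filterlim[OF assms zeta_tendsto]) simp
  then show ?thesis by eventually_elim auto
qed

text \<open>The derivative of y at 0 is 1, so y is injective near 0 and the five conjugates are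
  distinct. They are then all the roots of \<open>Phi\<close>, each of them simple.\<close>

lemma eventually_inj_yprod: "eventually (\<lambda>q. inj_on (\<lambda>i. yprod (zeta ^ i * q)) {..<5}) (at 0)"
proof -
  have "(yprod has_field_derivative deriv yprod 0) (at 0)"
    by (intro holomorphic_derivI[OF yprod_holomorphic]) auto
  then have "((\<lambda>q. yprod q / q) \<longlongrightarrow> deriv yprod 0) (at 0)" by (simp add: has_field_derivative_iff)
  then have "deriv yprod 0 = 1" using yprod_div_tendsto by (rule tendsto_unique[OF at_neq_bot])
  then obtain r where r: "r > 0" "inj_on yprod (ball 0 r)"
    using has_complex_derivative_locally_injective[OF yprod_holomorphic, of 0] by auto
  have "inj_on (\<lambda>i. zeta ^ i) {..<5}"
  proof (rule inj_onI)
    fix i j assume ij: "i \<in> {..<5::nat}" "j \<in> {..<5}" "zeta ^ i = zeta ^ j"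
    have "zeta ^ (j - i) = 1" if "i < j" "zeta ^ i = zeta ^ j" for i j
    proof -
      have "zeta ^ j = zeta ^ i * zeta ^ (j - i)" using that(1) by (simp flip: power_add)
      then show ?thesis using that zeta_nonzero by simp
    qed
    note * = this
    have "\<not> i < j" if "i < 5" "j < 5" "zeta ^ i = zeta ^ j" for i j
      using *[of i j] zeta_neq_1[of "j - i"] that nat_dvd_not_less[of "j - i" 5] by auto
    then show "i = j" using ij by (metis lessThan_iff linorder_neqE_nat)
  qed
  then have z: "inj_on (\<lambda>i. zeta ^ i * q) {..<5}" if "q \<noteq> 0" for q
    using that by (auto simp: inj_on_def)
  have "eventually (\<lambda>q. q \<noteq> 0 \<and> norm q < r) (at 0)"
    unfolding eventually_at using r by (intro exI[of _ r]) auto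
  then show ?thesis
  proof eventually_elim
    case (elim q)
    have "(\<lambda>i. zeta ^ i * q) ` {..<5} \<subseteq> ball 0 r"
      using elim by (auto simp: norm_mult norm_power norm_zeta)
    then have "inj_on yprod ((\<lambda>i. zeta ^ i * q) ` {..<5})" by (rule inj_on_subset[OF r(2)])
    then have "inj_on (yprod \<circ> (\<lambda>i. zeta ^ i * q)) {..<5}" using z elim by (intro comp_inj_on) auto
    then show ?case by (simp add: o_def)
  qed
qed

lemma eventually_roots:
  "eventually (\<lambda>q. norm q < 1 \<and> q \<noteq> 0 \<and> inj_on (\<lambda>i. yprod (zeta ^ i * q)) {..<5} \<and>
    (\<forall>i<5. Phi (yprod (zeta ^ i * q)) (yprod (q ^ 5)) = 0 \<and>
      dy (zeta ^ i * q) = 5 * (evx res0 (yprod (zeta ^ i * q)) (yprod (q ^ 5)) / dPhi (yprod (zeta ^ i * q)) (yprod (q ^ 5))) * dy (q ^ 5) \<and>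
      zf (zeta ^ i * q) * dy (zeta ^ i * q) = 5 * (evx res1 (yprod (zeta ^ i * q)) (yprod (q ^ 5)) / dPhi (yprod (zeta ^ i * q)) (yprod (q ^ 5))) * dy (q ^ 5))) (at 0)"
  using eventually_unit_disc eventually_inj_yprod eventually_zeta[OF eventually_modular]
    eventually_zeta[OF eventually_dy] eventually_zeta[OF eventually_residue]
proof eventually_elim
  case (elim q)
  note el = elim[unfolded zeta_fifth]
  have root: "\<forall>i<5. Phi (yprod (zeta ^ i * q)) (yprod (q ^ 5)) = 0" using el by blast
  have nz: "dPhi (yprod (zeta ^ i * q)) (yprod (q ^ 5)) \<noteq> 0" if "i < 5" for i
    by (rule dPhi_nonzero[OF el(2) root that])
  have d: "dy (zeta ^ i * q) = 5 * (evx res0 (yprod (zeta ^ i * q)) (yprod (q ^ 5)) / dPhi (yprod (zeta ^ i * q)) (yprod (q ^ 5))) * dy (q ^ 5)"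
    if "i < 5" for i using el(4) nz that by (simp add: field_simps)
  have "zf (zeta ^ i * q) * dy (zeta ^ i * q) = 5 * (evx res1 (yprod (zeta ^ i * q)) (yprod (q ^ 5)) / dPhi (yprod (zeta ^ i * q)) (yprod (q ^ 5))) * dy (q ^ 5)"
    if i: "i < 5" for i unfolding d[OF i] el(5)[rule_format, OF i, symmetric] by simp
  then show ?case using el(1,2) root d by blast
qed

lemma eventually_sum_res0:
  "eventually (\<lambda>q. (\<Sum>i<5. yprod (zeta ^ i * q) ^ n * dy (zeta ^ i * q)) = 5 * (pw res0 (yprod (q ^ 5)) n * dy (q ^ 5))) (at 0)"
  using eventually_roots
proof eventually_elim
  case (elim q)
  have "(\<Sum>i<5. yprod (zeta ^ i * q) ^ n * dy (zeta ^ i * q)) =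
      (\<Sum>i<5. evx res0 (yprod (zeta ^ i * q)) (yprod (q ^ 5)) * yprod (zeta ^ i * q) ^ n / dPhi (yprod (zeta ^ i * q)) (yprod (q ^ 5)) * (5 * dy (q ^ 5)))"
    using elim by (intro sum.cong) auto
  also have "\<dots> = pw res0 (yprod (q ^ 5)) n * (5 * dy (q ^ 5))"
    unfolding sum_distrib_right[symmetric] using elim by (subst sum_evx_pw) auto
  finally show ?case by simp
qed

lemma eventually_sum_res1:
  "eventually (\<lambda>q. (\<Sum>i<5. zf (zeta ^ i * q) * yprod (zeta ^ i * q) ^ n * dy (zeta ^ i * q)) = 5 * (pw res1 (yprod (q ^ 5)) n * dy (q ^ 5))) (at 0)"
  using eventually_roots
proof eventually_elim
  case (elim q)
  have "zf (zeta ^ i * q) * yprod (zeta ^ i * q) ^ n * dy (zeta ^ i * q)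
      = evx res1 (yprod (zeta ^ i * q)) (yprod (q ^ 5)) * yprod (zeta ^ i * q) ^ n / dPhi (yprod (zeta ^ i * q)) (yprod (q ^ 5)) * (5 * dy (q ^ 5))"
    if "i < 5" for i
  proof -
    have "zf (zeta ^ i * q) * dy (zeta ^ i * q) = 5 * (evx res1 (yprod (zeta ^ i * q)) (yprod (q ^ 5)) / dPhi (yprod (zeta ^ i * q)) (yprod (q ^ 5))) * dy (q ^ 5)"
      using elim that by blast
    moreover have "zf (zeta ^ i * q) * yprod (zeta ^ i * q) ^ n * dy (zeta ^ i * q) = (zf (zeta ^ i * q) * dy (zeta ^ i * q)) * yprod (zeta ^ i * q) ^ n"
      by simp
    ultimately show ?thesis by simp
  qed
  then have "(\<Sum>i<5. zf (zeta ^ i * q) * yprod (zeta ^ i * q) ^ n * dy (zeta ^ i * q)) =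
      (\<Sum>i<5. evx res1 (yprod (zeta ^ i * q)) (yprod (q ^ 5)) * yprod (zeta ^ i * q) ^ n / dPhi (yprod (zeta ^ i * q)) (yprod (q ^ 5)) * (5 * dy (q ^ 5)))"
    by (intro sum.cong) auto
  also have "\<dots> = pw res1 (yprod (q ^ 5)) n * (5 * dy (q ^ 5))"
    unfolding sum_distrib_right[symmetric] using elim by (subst sum_evx_pw) auto
  finally show ?case by simp
qed

section \<open>The initial value\<close>

definition initial_value :: "complex \<Rightarrow> complex" where
  "initial_value Y = 5 * (24 + 265 * Y + 1350 * Y ^ 2 + 2500 * Y ^ 3) / (1 + 5 * Y) ^ 3"

lemma initial_identities:
  fixes Y :: complex
  shows "evx res1 (- 1 / 5) Y = (1 + 5 * Y) ^ 2 * (1 + 11 * Y + 55 * Y ^ 2 + 100 * Y ^ 3) / 125"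
    and "Phi (- 1 / 5) Y = - ((1 + 5 * Y) ^ 5 / 3125)"
    and "evx res1 (- 1 / 4) Y = 5 * (1 + 4 * Y) / 256" and "Phi (- 1 / 4) Y = - ((1 + 4 * Y) / 1024)"
    and "evx res1 0 Y = 5 * Y * (1 + 5 * Y) ^ 3 * (3 + 20 * Y)" and "Phi 0 Y = - (Y * (1 + 5 * Y) ^ 4)"
  unfolding Phi_def evx_unfold by (simp_all add: field_simps eval_nat_numeral)

text \<open>The bracket has simple poles at y = -1/5, -1/4 and 0, so the sum is a combination of
  \<open>evx res1\<close> / \<open>Phi\<close> at these points. At -1/4 the quotient is the constant
  -20 and at 0 the factor Y cancels; only powers of 1 + 5Y stay in the denominator.\<close>

lemma eventually_sum_initial:
  "eventually (\<lambda>q. (\<Sum>i<5. zf (zeta ^ i * q) * (dy (zeta ^ i * q) *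
      (25 / (1 + 5 * yprod (zeta ^ i * q)) - 4 / (1 + 4 * yprod (zeta ^ i * q)) + 1 / yprod (zeta ^ i * q))))
    = 5 * (initial_value (yprod (q ^ 5)) * dy (q ^ 5))) (at 0)"
proof -
  have t: "((\<lambda>q. 1 + c * yprod q) \<longlongrightarrow> 1 + c * 0) (at 0)" for c
    by (intro tendsto_intros yprod_tendsto_0)
  have ne: "eventually (\<lambda>q. 1 + c * yprod q \<noteq> 0) (at 0)" for c
    by (rule tendsto_imp_eventually_ne[OF t]) simp
  have fl: "filterlim (\<lambda>q::complex. q ^ 5) (at 0) (at 0)" by (rule filterlim_power_at_0) simp
  have y0: "eventually (\<lambda>q. yprod q \<noteq> 0) (at 0)"
    using tendsto_imp_eventually_ne[OF yprod_div_tendsto zero_neq_one[symmetric]] by eventually_elim auto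
  show ?thesis
    using eventually_roots eventually_zeta[OF ne[of 4]] eventually_zeta[OF ne[of 5]]
      eventually_zeta[OF y0] eventually_compose_filterlim[OF ne[of 4] fl]
      eventually_compose_filterlim[OF ne[of 5] fl] eventually_compose_filterlim[OF y0 fl]
  proof eventually_elim
    case (elim q)
    define y Y where "y i = yprod (zeta ^ i * q)" and "Y = yprod (q ^ 5)" for i
    define S where "S x = evx res1 x Y / Phi x Y" for x
    have inj: "inj_on y {..<5}" and root: "\<forall>i<5. Phi (y i) Y = 0"
      using elim(1) by (auto simp: y_def[abs_def] Y_def)
    have y: "1 + 4 * y i \<noteq> 0" "1 + 5 * y i \<noteq> 0" "y i \<noteq> 0" if "i < 5" for i
      using elim(2-4) that by (auto simp: y_def)
    have Y: "1 + 4 * Y \<noteq> 0" "1 + 5 * Y \<noteq> 0" "Y \<noteq> 0" using elim(5-7) by (auto simp: Y_def)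
    have S: "(\<Sum>i<5. evx res1 (y i) Y / dPhi (y i) Y / (x - y i)) = S x" if "\<forall>i<5. x \<noteq> y i" for x
      unfolding S_def by (rule sum_evx_fraction[OF inj root that])
    have "- 1 / 5 \<noteq> y i" "- 1 / 4 \<noteq> y i" "0 \<noteq> y i" if "i < 5" for i
      using y[OF that] by (auto simp: eq_commute[of _ "y i"])
    then have ne: "\<forall>i<5. - 1 / 5 \<noteq> y i" "\<forall>i<5. - 1 / 4 \<noteq> y i" "\<forall>i<5. 0 \<noteq> y i" by blast+
    have summand: "zf (zeta ^ i * q) * (dy (zeta ^ i * q) * (25 / (1 + 5 * y i) - 4 / (1 + 4 * y i) + 1 / y i))
      = (- 5 * (evx res1 (y i) Y / dPhi (y i) Y / (- 1 / 5 - y i)) + evx res1 (y i) Y / dPhi (y i) Y / (- 1 / 4 - y i)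
         - evx res1 (y i) Y / dPhi (y i) Y / (0 - y i)) * (5 * dy (q ^ 5))" if i: "i < 5" for i
    proof -
      have "25 / (1 + 5 * y i) - 4 / (1 + 4 * y i) + 1 / y i = - 5 / (- 1 / 5 - y i) + 1 / (- 1 / 4 - y i) - 1 / (0 - y i)"
      proof -
        have "25 / (1 + 5 * y i) = - 5 / (- 1 / 5 - y i)" "4 / (1 + 4 * y i) = - (1 / (- 1 / 4 - y i))"
          using y[OF i] ne[rule_format, OF i] by (simp_all add: divide_simps)
        then show ?thesis by simp
      qed
      moreover have "zf (zeta ^ i * q) * dy (zeta ^ i * q) = 5 * (evx res1 (y i) Y / dPhi (y i) Y) * dy (q ^ 5)"
        using elim(1) i unfolding y_def Y_def by blast
      moreover have "5 * R * d * (- 5 / a + 1 / b - 1 / c) = (- 5 * (R / a) + R / b - R / c) * (5 * d)" for R a b c d :: complex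
        by (simp add: divide_inverse algebra_simps)
      ultimately show ?thesis unfolding mult.assoc[symmetric] by (simp only:)
    qed
    have "(\<Sum>i<5. zf (zeta ^ i * q) * (dy (zeta ^ i * q) * (25 / (1 + 5 * y i) - 4 / (1 + 4 * y i) + 1 / y i)))
      = (- 5 * S (- 1 / 5) + S (- 1 / 4) - S 0) * (5 * dy (q ^ 5))"
      unfolding S[OF ne(1), symmetric] S[OF ne(2), symmetric] S[OF ne(3), symmetric]
        sum_distrib_left sum.distrib[symmetric] sum_subtractf[symmetric] sum_distrib_right
      using summand by (intro sum.cong) auto
    also have "- 5 * S (- 1 / 5) + S (- 1 / 4) - S 0 = initial_value Y"
    proof -
      have s1: "S (- 1 / 5) = - (25 * (1 + 11 * Y + 55 * Y ^ 2 + 100 * Y ^ 3) / (1 + 5 * Y) ^ 3)"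
        unfolding S_def initial_identities using Y by (simp add: divide_simps eval_nat_numeral)
      have s2: "S (- 1 / 4) = - 20"
      proof -
        have "5 * w / 256 / - (w / 1024) = - 20" if "w \<noteq> 0" for w :: complex
          using that by simp
        then show ?thesis unfolding S_def initial_identities using Y by blast
      qed
      have s3: "S 0 = - (5 * (3 + 20 * Y) / (1 + 5 * Y))"
        unfolding S_def initial_identities using Y by (simp add: divide_simps eval_nat_numeral)
      show ?thesis
        unfolding initial_value_def s1 s2 s3 using Y(2) by (simp add: divide_simps) (simp add: algebra_simps eval_nat_numeral)
    qed
    finally show ?case by (simp add: y_def Y_def)
  qed
qed

section \<open>From functions to power series\<close>

lemma has_fps_expansion_eqI:
  fixes f g :: "complex \<Rightarrow> complex"
  assumes f: "f has_fps_expansion A" and g: "g has_fps_expansion B"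
    and ev: "eventually (\<lambda>q. f q = g q) (at 0)"
  shows "A = B"
proof -
  \<comment> \<open>A function with an expansion is continuous at 0, so agreement on a punctured
    neighbourhood extends to the point itself.\<close>
  have "f \<midarrow>0\<rightarrow> f 0" "g \<midarrow>0\<rightarrow> g 0"
    using has_fps_expansion_imp_continuous[OF f, of UNIV] has_fps_expansion_imp_continuous[OF g, of UNIV]
    by (simp_all add: continuous_within)
  moreover have "f \<midarrow>0\<rightarrow> g 0" using \<open>g \<midarrow>0\<rightarrow> g 0\<close> tendsto_cong[OF ev] by simp
  ultimately have "f 0 = g 0" using LIM_unique by blast
  then have "eventually (\<lambda>q. f q = g q) (nhds 0)"
    using ev eventually_nhds_conv_at[of _ "0::complex"] by blast
  then show ?thesis using fps_expansion_unique_complex[OF _ g] f has_fps_expansion_cong by blast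
qed

lemma has_fps_expansion_rotate:
  fixes f :: "complex \<Rightarrow> complex"
  assumes "f has_fps_expansion A"
  shows "(\<lambda>q. f (c * q)) has_fps_expansion Abs_fps (\<lambda>n. c ^ n * fps_nth A n)"
proof -
  have "(f \<circ> (\<lambda>q. c * q)) has_fps_expansion (A oo (fps_const c * fps_X))"
    by (intro fps_expansion_intros assms) simp
  then show ?thesis by (simp add: o_def fps_compose_linear)
qed

lemma has_fps_expansion_compose_power:
  fixes f :: "complex \<Rightarrow> complex"
  assumes "f has_fps_expansion A" "k > 0"
  shows "(\<lambda>q. f (q ^ k)) has_fps_expansion (A oo fps_X ^ k)"
proof -
  have "(f \<circ> (\<lambda>q. q ^ k)) has_fps_expansion (A oo fps_X ^ k)"
    using assms by (intro fps_expansion_intros) (auto simp: fps_X_power_nth)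
  then show ?thesis by (simp add: o_def)
qed

text \<open>Summing over q to zeta^i q removes every coefficient whose index is not divisible by 5
  and multiplies the others by 5, so the sum is 5 U(A) at q^5.\<close>

lemma usec_eqI:
  assumes f: "f has_fps_expansion A" and g: "g has_fps_expansion B"
    and ev: "eventually (\<lambda>q. (\<Sum>i<5. f (zeta ^ i * q)) = 5 * g (q ^ 5)) (at 0)"
  shows "usec A = B"
proof -
  have "(\<Sum>i<5. Abs_fps (\<lambda>n. (zeta ^ i) ^ n * fps_nth A n)) = fps_const 5 * (B oo fps_X ^ 5)"
    by (rule has_fps_expansion_eqI[OF _ _ ev])
       (intro fps_expansion_intros has_fps_expansion_rotate[OF f] has_fps_expansion_compose_power[OF g]; simp)+
  then have "fps_nth (\<Sum>i<5. Abs_fps (\<lambda>n. (zeta ^ i) ^ n * fps_nth A n)) (5 * n) = fps_nth (fps_const 5 * (B oo fps_X ^ 5)) (5 * n)" for n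
    by simp
  moreover have "fps_nth (\<Sum>i<5. Abs_fps (\<lambda>n. (zeta ^ i) ^ n * fps_nth A n)) (5 * n) = (\<Sum>i<5. zeta ^ (i * (5 * n))) * fps_nth A (5 * n)" for n
    by (simp add: fps_sum_nth sum_distrib_right flip: power_mult)
  ultimately have "5 * fps_nth A (5 * n) = 5 * fps_nth B n" for n
    by (simp add: sum_zeta fps_compose_X_power_nth)
  then show ?thesis by (intro fps_ext) simp
qed

lemma has_fps_expansion_mcoef: "j < 5 \<Longrightarrow> mcoef j has_fps_expansion mcoef j fps_X"
  and has_fps_expansion_res0: "j < 5 \<Longrightarrow> res0 j has_fps_expansion res0 j fps_X"
  and has_fps_expansion_res1: "j < 5 \<Longrightarrow> res1 j has_fps_expansion res1 j fps_X"
  for j :: nat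
  unfolding atomize_imp
  by (safe dest!: less_5_cases; unfold mcoef.simps[abs_def] res0.simps[abs_def] res1.simps[abs_def]; intro fps_expansion_intros)+

lemma has_fps_expansion_hs: "(\<lambda>Y. hs Y k) has_fps_expansion hs fps_X k"
proof (induction k rule: less_induct)
  case (less k)
  show ?case
  proof (cases k rule: nat_cases_5)
    case 1
    then show ?thesis by (auto simp: hs_small intro: fps_expansion_intros)
  next
    case (2 m)
    show ?thesis unfolding 2 hs_add_5
      by (intro fps_expansion_intros has_fps_expansion_mcoef less) (auto simp: 2)
  qed
qed

lemma has_fps_expansion_pw:
  assumes "\<And>j. j < 5 \<Longrightarrow> c j has_fps_expansion c' j fps_X"
  shows "(\<lambda>Y. pw c Y n) has_fps_expansion pw c' fps_X n"
  unfolding pw_def by (intro fps_expansion_intros has_fps_expansion_hs assms) simp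

definition yser :: "complex fps" where "yser = fps_expansion yprod 0"
definition zser :: "complex fps" where "zser = fps_expansion zf 0"

lemma yser: "yprod has_fps_expansion yser"
  unfolding yser_def by (rule holomorphic_has_fps_expansion[OF yprod_holomorphic])

lemma zser: "zf has_fps_expansion zser"
  unfolding zser_def by (rule holomorphic_has_fps_expansion[OF zf_holomorphic])

lemma yser_0 [simp]: "fps_nth yser 0 = 0"
  by (simp add: yser_def fps_expansion_def)

definition dyser :: "complex fps" where "dyser = fps_X * fps_deriv yser"

lemma dyser: "dy has_fps_expansion dyser"
  unfolding dyser_def dy_def[abs_def] by (intro fps_expansion_intros yser)

lemma has_fps_expansion_compose_yser:
  assumes "f has_fps_expansion A"
  shows "(\<lambda>q. f (yprod q)) has_fps_expansion (A oo yser)"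
  using has_fps_expansion_compose[OF assms yser] by (simp add: o_def)

lemma usec_row0: "usec (yser ^ n * dyser) = (pw res0 fps_X n oo yser) * dyser"
  by (rule usec_eqI[where f = "\<lambda>q. yprod q ^ n * dy q" and g = "\<lambda>q. pw res0 (yprod q) n * dy q"])
     (use eventually_sum_res0 in \<open>auto intro!: fps_expansion_intros yser dyser
        has_fps_expansion_compose_yser[OF has_fps_expansion_pw] has_fps_expansion_res0\<close>)

lemma usec_row1: "usec (zser * yser ^ n * dyser) = (pw res1 fps_X n oo yser) * dyser"
  by (rule usec_eqI[where f = "\<lambda>q. zf q * yprod q ^ n * dy q" and g = "\<lambda>q. pw res1 (yprod q) n * dy q"])
     (use eventually_sum_res1 in \<open>auto intro!: fps_expansion_intros yser dyser zser
        has_fps_expansion_compose_yser[OF has_fps_expansion_pw] has_fps_expansion_res1\<close>)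

lemma usec_odd: "usec ((h oo yser) * dyser) = (uop res0 h oo yser) * dyser"
  using usec_uop[of yser 1 dyser res0 h] usec_row0 by simp

lemma usec_even: "usec (zser * (h oo yser) * dyser) = (uop res1 h oo yser) * dyser"
  by (rule usec_uop) (simp_all add: usec_row1)

lemma initial_value_expansion: "initial_value has_fps_expansion Hq 0"
proof -
  have "(\<lambda>Y::complex. 5 * ((24 + 265 * Y + 1350 * Y ^ 2 + 2500 * Y ^ 3) * inverse ((1 + 5 * Y) ^ 3))) has_fps_expansion
      5 * ((24 + 265 * fps_X + 1350 * fps_X ^ 2 + 2500 * fps_X ^ 3) * inverse ((1 + 5 * fps_X) ^ 3))"
    by (intro fps_expansion_intros) simp
  then show ?thesis
    by (simp only: initial_value_def[abs_def] Hq.simps zz_def fps_inverse_power divide_inverse mult.assoc)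
qed

section \<open>Eisenstein series as logarithmic derivatives\<close>

definition eis :: "complex \<Rightarrow> complex" where
  "eis z = 1 - 24 * (\<Sum>n. of_nat (Suc n) * z ^ Suc n / (1 - z ^ Suc n))"

lemma eis_holomorphic: "eis holomorphic_on ball 0 1"
  using int_coeffs_lambert unfolding eis_def[abs_def] int_coeffs_def by (auto intro!: holomorphic_intros)

lemma eis_power_holomorphic: "k > 0 \<Longrightarrow> (\<lambda>z. eis (z ^ k)) holomorphic_on ball 0 1"
  by (rule holomorphic_on_compose_gen[OF _ eis_holomorphic, unfolded o_def])
     (auto intro!: holomorphic_intros simp: norm_power power_less_one_iff)

lemma pp_uniform_limit:
  assumes "0 < r" "r < 1"
  shows "uniform_limit (ball 0 r) (\<lambda>N z. \<Prod>m<N. 1 - z ^ Suc m) pp sequentially"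
proof -
  have "uniformly_convergent_on (ball 0 r) (\<lambda>N z. \<Prod>m<N. 1 - (z::complex) ^ Suc m)"
  proof (rule uniformly_convergent_on_subset[of "cball 0 r"], rule uniformly_convergent_on_prod')
    show "uniformly_convergent_on (cball 0 r) (\<lambda>N z. \<Sum>m<N. norm (1 - (z::complex) ^ Suc m - 1))"
    proof (rule Weierstrass_m_test_ev[THEN uniformly_convergentI])
      show "summable (\<lambda>m. r ^ Suc m)" using assms by (subst summable_Suc_iff) (rule summable_geometric, simp)
      show "\<forall>\<^sub>F m in sequentially. \<forall>z\<in>cball 0 r. norm (norm (1 - (z::complex) ^ Suc m - 1)) \<le> r ^ Suc m"
        using assms by (intro always_eventually allI ballI) (auto simp: norm_power norm_mult intro!: mult_mono power_mono)
    qed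
  qed (auto intro!: continuous_intros simp: ball_subset_cball)
  then obtain l where l: "uniform_limit (ball 0 r) (\<lambda>N z. \<Prod>m<N. 1 - (z::complex) ^ Suc m) l sequentially"
    by (auto simp: uniformly_convergent_on_def)
  have "l z = pp z" if "z \<in> ball 0 r" for z
    using tendsto_uniform_limitI[OF l that] has_prod_1_minus_power(2)[of z 1] that assms unfolding pp_def
    by (intro LIMSEQ_unique[where X = "\<lambda>N. \<Prod>m<N. 1 - z ^ Suc m"]) (auto simp del: power_Suc)
  then show ?thesis by (intro uniform_limit_cong'[THEN iffD1, OF _ _ l] refl)
qed

text \<open>The product may be differentiated logarithmically term by term because it converges
  locally uniformly; the terms form the Lambert series of \<open>eis\<close>.\<close>

lemma deriv_pp:
  assumes z: "norm z < 1"
  shows "z * deriv pp z = pp z * ((eis z - 1) / 24)"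
proof -
  define r where "r = (norm z + 1) / 2"
  have r: "0 < r" "r < 1" "norm z < r" using z by (simp_all add: r_def add_nonneg_pos)
  have "(\<lambda>k. deriv (\<lambda>z. 1 - z ^ Suc k) z / (1 - z ^ Suc k)) sums (deriv pp z / pp z)"
    by (rule logderiv_prodinf_complex_uniform_limit[OF pp_uniform_limit[OF r(1,2)]])
       (use r z pp_nonzero in \<open>auto intro!: holomorphic_intros simp del: power_Suc\<close>)
  then have "(\<lambda>k. - (of_nat (Suc k) * z ^ k) / (1 - z ^ Suc k)) sums (deriv pp z / pp z)"
  proof (rule sums_cong[THEN iffD1, rotated])
    fix k
    have "((\<lambda>z. 1 - z ^ Suc k) has_field_derivative 0 - of_nat (Suc k) * (1 * z ^ (Suc k - Suc 0))) (at z)"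
      by (intro DERIV_diff DERIV_const DERIV_power DERIV_ident)
    then have "((\<lambda>z. 1 - z ^ Suc k) has_field_derivative - (of_nat (Suc k) * z ^ k)) (at z)" by simp
    then show "deriv (\<lambda>z. 1 - z ^ Suc k) z / (1 - z ^ Suc k) = - (of_nat (Suc k) * z ^ k) / (1 - z ^ Suc k)"
      by (simp only: DERIV_imp_deriv)
  qed
  then have "(\<lambda>k. (- z) * (- (of_nat (Suc k) * z ^ k) / (1 - z ^ Suc k))) sums ((- z) * (deriv pp z / pp z))"
    by (rule sums_mult)
  then have "(\<lambda>k. of_nat (Suc k) * z ^ Suc k / (1 - z ^ Suc k)) sums (- z * (deriv pp z / pp z))"
    by (simp add: mult_ac)
  then have "eis z = 1 - 24 * (- z * (deriv pp z / pp z))" unfolding eis_def by (simp only: sums_unique[symmetric])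
  then show ?thesis using pp_nonzero[of z] z by simp
qed

text \<open>Here l is D f / f for D = z d/dz. Stating it as a derivative, with nonvanishing
  included, makes it closed under products, powers and quotients.\<close>

definition has_logderiv :: "(complex \<Rightarrow> complex) \<Rightarrow> complex \<Rightarrow> complex \<Rightarrow> bool" where
  "has_logderiv f l z \<longleftrightarrow> f z \<noteq> 0 \<and> (f has_field_derivative f z * l / z) (at z)"

lemma has_logderiv_mult:
  "has_logderiv f a z \<Longrightarrow> has_logderiv g b z \<Longrightarrow> has_logderiv (\<lambda>z. f z * g z) (a + b) z"
  unfolding has_logderiv_def by (auto intro!: derivative_eq_intros simp: algebra_simps add_divide_distrib)

lemma has_logderiv_power: "has_logderiv f a z \<Longrightarrow> has_logderiv (\<lambda>z. f z ^ n) (of_nat n * a) z"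
  unfolding has_logderiv_def
  using DERIV_power[of f "f z * a / z" z UNIV n] by (cases n) (auto simp: mult_ac)

lemma has_logderiv_divide:
  assumes "has_logderiv f a z" "has_logderiv g b z"
  shows "has_logderiv (\<lambda>z. f z / g z) (a - b) z"
  using assms unfolding has_logderiv_def
  by (auto intro!: derivative_eq_intros simp: divide_simps) (auto simp: algebra_simps)

lemma has_logderiv_ident: "z \<noteq> 0 \<Longrightarrow> has_logderiv (\<lambda>z. z) 1 z"
  by (simp add: has_logderiv_def)

lemma has_logderiv_pp:
  assumes z: "norm z < 1" "z \<noteq> 0" and k: "k > 0"
  shows "has_logderiv (\<lambda>z. pp (z ^ k)) (of_nat k * ((eis (z ^ k) - 1) / 24)) z"
proof -
  have zk: "norm (z ^ k) < 1" by (rule norm_power_less_1[OF z(1) k])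
  have "(pp has_field_derivative deriv pp (z ^ k)) (at (z ^ k))"
    by (intro holomorphic_derivI[OF pp_holomorphic]) (use zk in auto)
  moreover have "((\<lambda>z. z ^ k) has_field_derivative of_nat k * z ^ (k - 1)) (at z)"
    by (auto intro!: derivative_eq_intros)
  ultimately have d: "((\<lambda>z. pp (z ^ k)) has_field_derivative deriv pp (z ^ k) * (of_nat k * z ^ (k - 1))) (at z)"
    by (rule DERIV_chain2)
  have "deriv pp (z ^ k) * (of_nat k * z ^ (k - 1)) = of_nat k * (z ^ k * deriv pp (z ^ k)) / z"
    using z k by (simp add: power_eq_if)
  also have "\<dots> = pp (z ^ k) * (of_nat k * ((eis (z ^ k) - 1) / 24)) / z"
    unfolding deriv_pp[OF zk] by simp
  finally show ?thesis using d pp_power_nonzero[OF z(1) k] unfolding has_logderiv_def by simp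
qed

definition ff :: "complex \<Rightarrow> complex" where
  "ff z = (50 * eis (z ^ 10) - 25 * eis (z ^ 5) - 2 * eis (z ^ 2) + eis z) / 24"

definition fa :: "complex \<Rightarrow> complex" where "fa z = 2 * eis (z ^ 2) - eis z"

text \<open>The logarithmic derivatives lY, lW, lX of the three quotients are linear in Eisenstein
  series, and F = -lW, A = 5 lX - lW + 5 lY. Differentiating w = 1/y + 4 and x = 1/y + 5 gives lY =
  -lW (1 + 4y) = -lX (1 + 5y), so everything reduces to lY = D y / y.\<close>

lemma eventually_eisenstein:
  "eventually (\<lambda>q. dy q = yprod q * (1 + 4 * yprod q) * ff q \<and>
     fa q = dy q * (25 / (1 + 5 * yprod q) - 4 / (1 + 4 * yprod q) + 1 / yprod q)) (at 0)"
proof -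
  have "eventually (\<lambda>q. norm q < 1 \<and> q \<noteq> 0 \<and> yprod q \<noteq> 0 \<and> wprod q = 1 / yprod q + 4 \<and> xprod q = 1 / yprod q + 5) (at 0)"
    using eventually_level_ten tendsto_imp_eventually_ne[OF yprod_div_tendsto zero_neq_one[symmetric]]
    by eventually_elim (auto simp: kk_relations(2))
  then obtain d where d: "d > 0" "\<And>q. q \<noteq> 0 \<Longrightarrow> norm q < d \<Longrightarrow>
      norm q < 1 \<and> yprod q \<noteq> 0 \<and> wprod q = 1 / yprod q + 4 \<and> xprod q = 1 / yprod q + 5"
    unfolding eventually_at by (auto simp: dist_norm)
  have "dy q = yprod q * (1 + 4 * yprod q) * ff q \<and>
     fa q = dy q * (25 / (1 + 5 * yprod q) - 4 / (1 + 4 * yprod q) + 1 / yprod q)" if q: "q \<noteq> 0" "norm q < d" for q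
  proof -
    have q1: "norm q < 1" and y0: "yprod q \<noteq> 0" and w: "wprod q = 1 / yprod q + 4" and x: "xprod q = 1 / yprod q + 5"
      using d(2)[OF q] by auto
    define P where "P k = of_nat k * ((eis (q ^ k) - 1) / 24)" for k
    have hP: "has_logderiv (\<lambda>z. pp (z ^ k)) (P k) q" if "k > 0" for k
      unfolding P_def by (rule has_logderiv_pp[OF q1 q(1) that])
    have hP1: "has_logderiv pp (P 1) q" using hP[of 1] by simp
    define lY lW lX where "lY = 1 + ((P 2 + of_nat 3 * P 10) - (of_nat 3 * P 1 + P 5))"
      and "lW = (P 2 + of_nat 5 * P 5) - (1 + P 1 + of_nat 5 * P 10)"
      and "lX = (of_nat 4 * P 2 + of_nat 2 * P 5) - (1 + of_nat 2 * P 1 + of_nat 4 * P 10)"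
    have Y: "has_logderiv yprod lY q" unfolding yprod_def[abs_def] lY_def
      by (intro has_logderiv_mult has_logderiv_power has_logderiv_divide has_logderiv_ident hP hP1 q) auto
    have W: "has_logderiv wprod lW q" unfolding wprod_def[abs_def] lW_def
      by (intro has_logderiv_mult has_logderiv_power has_logderiv_divide has_logderiv_ident hP hP1 q) auto
    have X: "has_logderiv xprod lX q" unfolding xprod_def[abs_def] lX_def
      by (intro has_logderiv_mult has_logderiv_power has_logderiv_divide has_logderiv_ident hP hP1 q) auto
    have inv: "((\<lambda>q. 1 / yprod q + c) has_field_derivative - (lY / (yprod q * q))) (at q)" for c
      using Y y0 unfolding has_logderiv_def by (auto intro!: derivative_eq_intros simp: field_simps)
    have clear: "lY = - l * (1 + c * yprod q)" if "(1 / yprod q + c) * l / q = - (lY / (yprod q * q))" for l c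
    proof -
      have "lY = - (- (lY / (yprod q * q))) * (yprod q * q)" using q(1) y0 by simp
      also have "\<dots> = - l * (1 + c * yprod q)" unfolding that[symmetric] using q(1) y0 by (simp add: field_simps)
      finally show ?thesis .
    qed
    have "(wprod has_field_derivative - (lY / (yprod q * q))) (at q)"
      by (rule has_field_derivative_transform_within_open[OF inv[of 4], of "ball 0 d - {0}"]) (use d q in auto)
    then have "wprod q * lW / q = - (lY / (yprod q * q))"
      using W DERIV_unique unfolding has_logderiv_def by blast
    then have lW: "lY = - lW * (1 + 4 * yprod q)" unfolding w by (rule clear)
    have "(xprod has_field_derivative - (lY / (yprod q * q))) (at q)"
      by (rule has_field_derivative_transform_within_open[OF inv[of 5], of "ball 0 d - {0}"]) (use d q in auto)
    then have "xprod q * lX / q = - (lY / (yprod q * q))"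
      using X DERIV_unique unfolding has_logderiv_def by blast
    then have lX: "lY = - lX * (1 + 5 * yprod q)" unfolding x by (rule clear)
    have dy: "dy q = yprod q * lY"
      using Y q(1) unfolding has_logderiv_def dy_def by (auto simp: DERIV_imp_deriv)
    have f: "ff q = - lW" unfolding ff_def lW_def P_def by (simp add: field_simps)
    have a: "fa q = 5 * lX - lW + 5 * lY" unfolding fa_def lX_def lW_def lY_def P_def by (simp add: field_simps)
    have w0: "1 + 4 * yprod q \<noteq> 0" using W w y0 unfolding has_logderiv_def by (auto simp: field_simps)
    have x0: "1 + 5 * yprod q \<noteq> 0" using X x y0 unfolding has_logderiv_def by (auto simp: field_simps)
    have lW': "lW = - lY / (1 + 4 * yprod q)" and lX': "lX = - lY / (1 + 5 * yprod q)"
      using lW lX w0 x0 by (simp_all add: divide_simps)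
    have "dy q = yprod q * (1 + 4 * yprod q) * ff q" unfolding dy f lW by simp
    moreover have "fa q = dy q * (25 / (1 + 5 * yprod q) - 4 / (1 + 4 * yprod q) + 1 / yprod q)"
      unfolding a lX' lW' dy using w0 x0 y0 by (simp add: divide_simps) (simp add: algebra_simps)
    ultimately show ?thesis by blast
  qed
  then show ?thesis unfolding eventually_at using d(1) by (auto simp: dist_norm)
qed

section \<open>The generating functions\<close>

lemma fps_conv_radius_ge_1:
  fixes F :: "complex fps"
  assumes "\<And>z. z \<noteq> 0 \<Longrightarrow> norm z < 1 \<Longrightarrow> summable (\<lambda>n. fps_nth F n * z ^ n)"
  shows "fps_conv_radius F \<ge> 1"
  unfolding fps_conv_radius_def
proof (rule conv_radius_geI_ex)
  fix r :: real assume "0 < r" "ereal r < 1"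
  then show "\<exists>z. norm z = r \<and> summable (\<lambda>n. fps_nth F n * z ^ n)"
    using assms[of "of_real r"] by (intro exI[of _ "of_real r"]) auto
qed

lemma eval_fps_has_fps_expansion:
  fixes F :: "complex fps"
  shows "fps_conv_radius F \<ge> 1 \<Longrightarrow> eval_fps F has_fps_expansion F"
  by (auto simp: has_fps_expansion_def intro: less_le_trans[of 0 1])

lemma eq_on_unit_disc:
  fixes f g :: "complex \<Rightarrow> complex"
  assumes f: "f holomorphic_on ball 0 1" "f has_fps_expansion F"
    and g: "g holomorphic_on ball 0 1" "g has_fps_expansion F" and z: "norm z < 1"
  shows "f z = g z"
proof (rule sums_unique2)
  show "(\<lambda>n. fps_nth F n * z ^ n) sums f z"
    by (rule has_fps_expansion_imp_sums_complex[OF f(2), of 1]) (use f(1) z in \<open>auto simp: one_ereal_def\<close>)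
  show "(\<lambda>n. fps_nth F n * z ^ n) sums g z"
    by (rule has_fps_expansion_imp_sums_complex[OF g(2), of 1]) (use g(1) z in \<open>auto simp: one_ereal_def\<close>)
qed

definition ppser :: "nat \<Rightarrow> complex fps" where "ppser k = fps_expansion pp 0 oo fps_X ^ k"
definition faser :: "complex fps" where "faser = fps_expansion fa 0"
definition ffser :: "complex fps" where "ffser = fps_expansion ff 0"
definition cser :: "complex fps" where "cser = Abs_fps (\<lambda>n. of_int (c_seq n))"
definition lser :: "nat \<Rightarrow> complex fps" where "lser a = Abs_fps (\<lambda>n. of_int (c_seq (5 ^ a * n + lam a)))"

lemma ppser: "k > 0 \<Longrightarrow> (\<lambda>z. pp (z ^ k)) has_fps_expansion ppser k"
  unfolding ppser_def
  by (intro has_fps_expansion_compose_power holomorphic_has_fps_expansion pp_holomorphic)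

lemma fa_holomorphic: "fa holomorphic_on ball 0 1"
  unfolding fa_def[abs_def] by (intro holomorphic_intros eis_holomorphic eis_power_holomorphic) simp

lemma ff_holomorphic: "ff holomorphic_on ball 0 1"
  unfolding ff_def[abs_def] by (intro holomorphic_intros eis_holomorphic eis_power_holomorphic) simp_all

lemma faser: "fa has_fps_expansion faser"
  unfolding faser_def by (rule holomorphic_has_fps_expansion[OF fa_holomorphic])

lemma ffser: "ff has_fps_expansion ffser"
  unfolding ffser_def by (rule holomorphic_has_fps_expansion[OF ff_holomorphic])

lemma ppser_compose_power: "k > 0 \<Longrightarrow> j > 0 \<Longrightarrow> ppser k oo fps_X ^ j = ppser (k * j)"
  by (rule has_fps_expansion_eqI[OF has_fps_expansion_compose_power[OF ppser] ppser])
     (simp_all add: mult.commute flip: power_mult)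

lemma E2_eis: "E2 \<tau> = eis (qexp \<tau>)"
  unfolding E2_def eis_def ..

lemma qexp_of_nat_mult: "qexp (of_nat k * \<tau>) = qexp \<tau> ^ k"
  by (simp add: qexp_def mult_ac flip: exp_of_nat_mult)

lemma cser_sums:
  assumes "z \<noteq> 0" "norm z < 1"
  shows "(\<lambda>n. fps_nth cser n * z ^ n) sums (fa z / pp (z ^ 2))"
proof -
  obtain \<tau> where \<tau>: "Im \<tau> > 0" "qexp \<tau> = z" using qexp_surj assms by metis
  show ?thesis
    using c_seq_sums[OF \<tau>(1)]
    unfolding E2_eis qexp_double \<tau>(2) fa_def qpoch_def pp_power cser_def by simp
qed

lemma faser_eq: "faser = ppser 2 * cser"
proof (rule has_fps_expansion_eqI[OF faser])
  have "fps_conv_radius cser \<ge> 1"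
    by (rule fps_conv_radius_ge_1) (use cser_sums sums_summable in blast)
  then show "(\<lambda>z. pp (z ^ 2) * eval_fps cser z) has_fps_expansion ppser 2 * cser"
    by (intro fps_expansion_intros ppser eval_fps_has_fps_expansion) simp
  show "eventually (\<lambda>z. fa z = pp (z ^ 2) * eval_fps cser z) (at 0)"
    using eventually_unit_disc
  proof eventually_elim
    case (elim z)
    have "eval_fps cser z = fa z / pp (z ^ 2)"
      using sums_unique[OF cser_sums, of z] elim by (simp add: eval_fps_def)
    then show ?case using pp_power_nonzero[of z 2] elim by simp
  qed
qed

lemma zser_eq: "zser * ppser 2 = fps_X ^ 2 * ppser 50"
proof (rule has_fps_expansion_eqI)
  show "(\<lambda>z. zf z * pp (z ^ 2)) has_fps_expansion zser * ppser 2"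
    by (intro fps_expansion_intros zser ppser) simp
  show "(\<lambda>z. z ^ 2 * pp (z ^ 50)) has_fps_expansion fps_X ^ 2 * ppser 50"
    by (intro fps_expansion_intros ppser) simp
  show "eventually (\<lambda>z. zf z * pp (z ^ 2) = z ^ 2 * pp (z ^ 50)) (at 0)"
    using eventually_unit_disc
    by eventually_elim (simp add: zf_def pp_power_nonzero)
qed

lemma dyser_eq: "dyser = yser * (1 + 4 * yser) * ffser"
  by (rule has_fps_expansion_eqI[OF dyser, of "\<lambda>q. yprod q * (1 + 4 * yprod q) * ff q"])
     (use eventually_eisenstein in \<open>auto intro!: fps_expansion_intros yser ffser elim: eventually_mono\<close>)

lemma usec_initial: "usec (zser * faser) = (Hq 0 oo yser) * dyser"
proof (rule usec_eqI)
  show "(\<lambda>q. zf q * fa q) has_fps_expansion zser * faser"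
    by (intro fps_expansion_intros zser faser)
  show "(\<lambda>q. initial_value (yprod q) * dy q) has_fps_expansion (Hq 0 oo yser) * dyser"
    by (intro fps_expansion_intros has_fps_expansion_compose_yser initial_value_expansion dyser)
  show "eventually (\<lambda>q. (\<Sum>i<5. zf (zeta ^ i * q) * fa (zeta ^ i * q)) = 5 * (initial_value (yprod (q ^ 5)) * dy (q ^ 5))) (at 0)"
    using eventually_sum_initial eventually_zeta[OF eventually_eisenstein]
    by eventually_elim simp
qed

definition Lser :: "nat \<Rightarrow> complex fps" where
  "Lser a = ppser (if odd a then 10 else 2) * (fps_X * lser a)"

text \<open>Coefficient 5(n + 1) of the shifted series is coefficient 5n + (5 - k) of f; the
  constant term vanishes because k is positive, whence the factor X.\<close>

lemma usec_shift:
  assumes "0 < k" "k < 5"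
  shows "usec (fps_X ^ k * f) = fps_X * Abs_fps (\<lambda>n. fps_nth f (5 * n + (5 - k)))"
proof (rule fps_ext)
  fix n
  show "fps_nth (usec (fps_X ^ k * f)) n = fps_nth (fps_X * Abs_fps (\<lambda>n. fps_nth f (5 * n + (5 - k)))) n"
  proof (cases n)
    case (Suc m)
    have "5 * Suc m - k = 5 * m + (5 - k)" "\<not> 5 * Suc m < k" using assms by simp_all
    then show ?thesis unfolding Suc usec_nth fps_X_power_mult_nth by simp
  qed (use assms in \<open>simp add: fps_X_power_mult_nth\<close>)
qed

lemma usec_shift_1: "usec (fps_X * f) = fps_X * Abs_fps (\<lambda>n. fps_nth f (5 * n + 4))"
  and usec_shift_2: "usec (fps_X ^ 2 * f) = fps_X * Abs_fps (\<lambda>n. fps_nth f (5 * n + 3))"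
  and usec_shift_3: "usec (fps_X ^ 3 * f) = fps_X * Abs_fps (\<lambda>n. fps_nth f (5 * n + 2))"
  using usec_shift[of 1 f] usec_shift[of 2 f] usec_shift[of 3 f] by simp_all

text \<open>Twelve times the difference is 48 or 24 times 5^a. The digits 4 and 2 are the residues
  modulo 5 that U has to select.\<close>

lemma lam_Suc: "lam (Suc a) = 5 ^ a * (if odd a then 4 else 2) + lam a"
  using twelve_mult_lam[of a] twelve_mult_lam[of "Suc a"] by (cases "odd a") auto

lemma lser_Suc:
  "odd a \<Longrightarrow> lser (Suc a) = Abs_fps (\<lambda>n. fps_nth (lser a) (5 * n + 4))"
  "even a \<Longrightarrow> lser (Suc a) = Abs_fps (\<lambda>n. fps_nth (lser a) (5 * n + 2))"
  unfolding lser_def lam_Suc by (rule fps_ext; simp add: algebra_simps)+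

text \<open>Multiplication by Z exchanges \<open>pp (q^2)\<close> for q^2 \<open>pp (q^50)\<close>.
  U turns the latter product into \<open>pp (q^10)\<close>, and the shift by 2 selects the residue
  3, which is \<open>lam 1\<close>.\<close>

lemma Lser_1: "Lser 1 = usec (zser * faser)"
proof -
  have "zser * faser = (zser * ppser 2) * cser" unfolding faser_eq by (simp only: mult.assoc)
  also have "\<dots> = (ppser 10 oo fps_X ^ 5) * (fps_X ^ 2 * cser)"
    unfolding zser_eq by (simp add: ppser_compose_power mult_ac)
  finally have "usec (zser * faser) = ppser 10 * (fps_X * Abs_fps (\<lambda>n. fps_nth cser (5 * n + 3)))"
    by (simp only: usec_compose_mult usec_shift_2)
  moreover have "lser 1 = Abs_fps (\<lambda>n. fps_nth cser (5 * n + 3))"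
    by (simp add: lser_def cser_def lam_def)
  ultimately show ?thesis by (simp add: Lser_def)
qed

text \<open>For odd a the prefactor \<open>pp (q^10)\<close> is a function of q^5 and leaves U as
  \<open>pp (q^2)\<close>. For even a the prefactor \<open>pp (q^2)\<close> is not, and Z first
  replaces it. The shifts q and q^3 select the digits 4 and 2 of \<open>lam_Suc\<close>.\<close>

lemma Lser_Suc: "Lser (Suc a) = (if odd a then usec (Lser a) else usec (zser * Lser a))"
proof (cases "odd a")
  case True
  have "Lser a = (ppser 2 oo fps_X ^ 5) * (fps_X * lser a)"
    using True by (simp add: Lser_def ppser_compose_power)
  then have "usec (Lser a) = ppser 2 * (fps_X * lser (Suc a))"
    by (simp only: usec_compose_mult usec_shift_1 lser_Suc(1)[OF True])
  then show ?thesis using True by (simp add: Lser_def)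
next
  case False
  have "zser * Lser a = (zser * ppser 2) * (fps_X * lser a)"
    using False by (simp add: Lser_def mult.assoc)
  also have "\<dots> = (ppser 10 oo fps_X ^ 5) * (fps_X ^ 3 * lser a)"
    unfolding zser_eq by (simp add: ppser_compose_power mult_ac power3_eq_cube power2_eq_square)
  finally have "usec (zser * Lser a) = ppser 10 * (fps_X * lser (Suc a))"
    using False by (simp add: usec_compose_mult usec_shift_3 lser_Suc(2))
  then show ?thesis using False by (simp add: Lser_def)
qed

lemma Lser_eq: "Lser (Suc a) = (Hq a oo yser) * dyser"
proof (induction a)
  case 0
  then show ?case using Lser_1 usec_initial by simp
next
  case (Suc a)
  show ?case
  proof (cases "even a")
    case True
    then show ?thesis unfolding Lser_Suc[of "Suc a"] Suc using usec_odd[of "Hq a"] by simp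
  next
    case False
    then show ?thesis unfolding Lser_Suc[of "Suc a"] Suc using usec_even[of "Hq a"] by (simp add: mult.assoc)
  qed
qed

lemma Lser_polynomial:
  "\<exists>P :: int poly. (1 + 5 * yser) ^ psi (Suc a) * Lser (Suc a)
     = 5 ^ Suc a * ffser * (fps_of_poly (map_poly of_int P) oo yser)"
proof -
  obtain P :: "int poly" where
    P: "fps_X * (1 + 4 * fps_X) * zz ^ psi (Suc a) * Hq a = fps_const (5 ^ Suc a) * fps_of_poly (map_poly of_int P)"
    using int_poly_Hq by blast
  have lin: "(1 + numeral w * fps_X) oo yser = 1 + numeral w * yser" for w
    by (simp add: fps_compose_add_distrib fps_compose_mult_distrib numeral_fps_const)
  have "(1 + 5 * yser) ^ psi (Suc a) * Lser (Suc a)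
      = (fps_X * (1 + 4 * fps_X) * zz ^ psi (Suc a) * Hq a oo yser) * ffser"
  proof -
    have "(fps_X * (1 + 4 * fps_X) * zz ^ psi (Suc a) * Hq a oo yser)
        = yser * (1 + 4 * yser) * (1 + 5 * yser) ^ psi (Suc a) * (Hq a oo yser)"
      unfolding zz_def by (simp add: fps_compose_mult_distrib lin flip: fps_compose_power)
    then show ?thesis unfolding Lser_eq dyser_eq by (simp only: mult_ac)
  qed
  also have "\<dots> = 5 ^ Suc a * ffser * (fps_of_poly (map_poly of_int P) oo yser)"
    unfolding P by (simp add: fps_compose_mult_distrib mult_ac numeral_fps_const fps_const_power)
  finally show ?thesis by blast
qed

section \<open>Return to functions on the upper half-plane\<close>

lemma summable_lser:
  assumes "z \<noteq> 0" "norm z < 1"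
  shows "summable (\<lambda>n. fps_nth (lser a) n * z ^ n)"
proof -
  obtain \<tau> where \<tau>: "Im \<tau> > 0" "qexp \<tau> = z" using qexp_surj assms by metis
  have "summable (\<lambda>n. z * (of_int (c_seq (5 ^ a * n + lam a)) * z ^ n))"
    using summable_L_fun[OF \<tau>(1), of a] unfolding \<tau>(2) by (simp add: mult_ac)
  then show ?thesis using assms(1) by (simp add: lser_def summable_mult_D)
qed

lemma lser_conv_radius: "fps_conv_radius (lser a) \<ge> 1"
  by (rule fps_conv_radius_ge_1[OF summable_lser])

lemma qpoch_pp: "qpoch k \<tau> = pp (qexp \<tau> ^ k)"
  unfolding qpoch_def pp_power ..

lemma L_fun_eval:
  assumes "Im \<tau> > 0"
  shows "L_fun a \<tau> = pp (qexp \<tau> ^ (if odd a then 10 else 2)) * (qexp \<tau> * eval_fps (lser a) (qexp \<tau>))"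
proof -
  have "qexp \<tau> * eval_fps (lser a) (qexp \<tau>) = (\<Sum>n. qexp \<tau> * (fps_nth (lser a) n * qexp \<tau> ^ n))"
    unfolding eval_fps_def
    by (rule suminf_mult[symmetric]) (intro summable_lser qexp_nonzero norm_qexp_less_1 assms)
  then show ?thesis by (simp add: L_fun_def qpoch_pp lser_def mult_ac)
qed

lemma y_fun_yprod:
  assumes "Im \<tau> > 0"
  shows "y_fun \<tau> = yprod (qexp \<tau>)"
proof -
  define z where "z = qexp \<tau>"
  have z: "norm z < 1" unfolding z_def by (rule norm_qexp_less_1[OF assms])
  have hp: "(\<lambda>m. 1 - z ^ (k * Suc m)) has_prod pp (z ^ k)" if "k > 0" for k
    unfolding pp_power by (rule convergent_prod_has_prod[OF has_prod_1_minus_power(1)[OF z that]])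
  have "(\<lambda>m. (1 - z ^ (2 * Suc m)) * (1 - z ^ (10 * Suc m)) ^ 3 / ((1 - z ^ Suc m) ^ 3 * (1 - z ^ (5 * Suc m))))
      has_prod (pp (z ^ 2) * pp (z ^ 10) ^ 3 / (pp z ^ 3 * pp (z ^ 5)))"
    by (intro has_prod_divide has_prod_mult has_prod_power hp) (use hp[of 1] in simp_all)
  then show ?thesis unfolding y_fun_def yprod_def z_def[symmetric] by (simp only: has_prod_unique[symmetric])
qed

lemma F_fun_ff: "F_fun \<tau> = ff (qexp \<tau>)"
  using qexp_of_nat_mult[of 10 \<tau>] qexp_of_nat_mult[of 5 \<tau>]
  by (simp add: F_fun_def ff_def E2_eis qexp_double)

lemma has_fps_expansion_poly: "poly p has_fps_expansion fps_of_poly (p :: complex poly)"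
  by (simp add: has_fps_expansion_def)

theorem theorem1p3:
  fixes \<alpha> :: nat
  assumes "\<alpha> \<ge> 1"
  shows "\<exists>P :: int poly. \<forall>\<tau> :: complex. Im \<tau> > 0 \<longrightarrow>
    (1 + 5 * y_fun \<tau>) ^ psi \<alpha> * L_fun \<alpha> \<tau> = 5 ^ \<alpha> * F_fun \<tau> * poly (map_poly of_int P) (y_fun \<tau>)"
proof -
  define k :: nat where "k = (if odd \<alpha> then 10 else 2)"
  have k: "k > 0" by (simp add: k_def)
  obtain a where a: "\<alpha> = Suc a" using assms by (cases \<alpha>) auto
  obtain P :: "int poly" where
    P: "(1 + 5 * yser) ^ psi \<alpha> * Lser \<alpha> = 5 ^ \<alpha> * ffser * (fps_of_poly (map_poly of_int P) oo yser)"
    using Lser_polynomial unfolding a by blast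
  have "(1 + 5 * y_fun \<tau>) ^ psi \<alpha> * L_fun \<alpha> \<tau> = 5 ^ \<alpha> * F_fun \<tau> * poly (map_poly of_int P) (y_fun \<tau>)"
    if \<tau>: "Im \<tau> > 0" for \<tau>
    unfolding y_fun_yprod[OF \<tau>] F_fun_ff L_fun_eval[OF \<tau>] k_def[symmetric]
  \<comment> \<open>Both sides are holomorphic in q on the whole unit disc, so the power series
    identity settles every point of the upper half-plane, not only those with small q.\<close>
  proof (rule eq_on_unit_disc[where f = "\<lambda>z. (1 + 5 * yprod z) ^ psi \<alpha> * (pp (z ^ k) * (z * eval_fps (lser \<alpha>) z))"
      and g = "\<lambda>z. 5 ^ \<alpha> * ff z * poly (map_poly of_int P) (yprod z)"])
    have "ball 0 1 \<subseteq> eball (0::complex) (fps_conv_radius (lser \<alpha>))"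
    proof
      fix x :: complex assume "x \<in> ball 0 1"
      then have "ereal (norm x) < 1" by simp
      also note lser_conv_radius[of \<alpha>]
      finally show "x \<in> eball 0 (fps_conv_radius (lser \<alpha>))" by simp
    qed
    then show "(\<lambda>z. (1 + 5 * yprod z) ^ psi \<alpha> * (pp (z ^ k) * (z * eval_fps (lser \<alpha>) z))) holomorphic_on ball 0 1"
      by (intro holomorphic_intros yprod_holomorphic pp_power_holomorphic k)
    show "(\<lambda>z. 5 ^ \<alpha> * ff z * poly (map_poly of_int P) (yprod z)) holomorphic_on ball 0 1"
      by (intro holomorphic_intros ff_holomorphic yprod_holomorphic)
    show "(\<lambda>z. (1 + 5 * yprod z) ^ psi \<alpha> * (pp (z ^ k) * (z * eval_fps (lser \<alpha>) z))) has_fps_expansion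
        (1 + 5 * yser) ^ psi \<alpha> * Lser \<alpha>"
      unfolding Lser_def k_def[symmetric]
      by (intro fps_expansion_intros yser ppser k eval_fps_has_fps_expansion lser_conv_radius)
    show "(\<lambda>z. 5 ^ \<alpha> * ff z * poly (map_poly of_int P) (yprod z)) has_fps_expansion
        (1 + 5 * yser) ^ psi \<alpha> * Lser \<alpha>"
      unfolding P by (intro fps_expansion_intros ffser has_fps_expansion_compose_yser has_fps_expansion_poly)
  qed (rule norm_qexp_less_1[OF \<tau>])
  then show ?thesis by blast
qed

end
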